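(* Let $\sigma>0$ and let $K(t)=\exp\left(-\frac{t^2}{2\sigma^2}\right)$ be the Gaussian kernel. Let $\mu=\sum_{t_j\in T}a_j\delta_{t_j}$ with $T\subset\mathbb{R}$ finite and $a_j\in\mathbb{R}$. Let $S=\{s_1,\ldots,s_n\}$ be a grid of sample locations with $s_{i+1}=s_i+\tau$ and step size $\tau\in[0.065\,\sigma,\,0.2375\,\sigma]$. Let $w\in\mathbb{R}^n$, let $\mathcal{N}:=\{s_i\in S: w_i\neq 0\}$ be the set of noise locations, and let the data be $$y_i=(K*\mu)(s_i)+w_i,\qquad i=1,\ldots,n.$$ With $\mathcal{I}$ and $\mathcal{C}$ the sets of clean samples surrounding the spikes and the corruptions respectively (defined in the context), assume that $$|\mathcal{I}|=2|T|,\qquad |\mathcal{C}|=2|\mathcal{N}|,\qquad \mathcal{C}\cap\mathcal{I}=\emptyset .$$ If $\Delta(T)\geq 3.751\,\sigma$ and $\Delta(\mathcal{N})\geq 3.751\,\sigma$, then solving $$\underset{\tilde\mu,\tilde w}{\text{minimize}}\ \|\tilde\mu\|_{\mathrm{TV}}+\lambda\|\tilde w\|_1\quad\text{subject to}\quad (K*\tilde\mu)(s_i)+\tilde w_i=y_i,\ i=1,\ldots,n,$$ with parameter $\lambda:=2$ recovers $\mu$ and $w$ exactly, i.e. $(\mu,w)$ is the unique solution.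
   Context: $\delta_t$ denotes the Dirac measure at $t$, and $(K*\mu)(s)=\int K(s-t)\,d\mu(t)$. In the minimization problem, $\tilde w$ ranges over $\mathbb{R}^n$ and $\tilde\mu$ ranges over the finite signed Borel measures supported on a fixed compact interval of $\mathbb{R}$ that contains $T$; $\|\cdot\|_{\mathrm{TV}}$ is the total-variation norm of a measure (for $\sum_i b_i\delta_{t_i}$ with distinct $t_i$ it equals $\sum_i|b_i|$). For a finite set $A\subset\mathbb{R}$, its minimum separation is $\Delta(A)=\min_{a\neq a'\in A}|a-a'|$ (understood as $+\infty$ if $A$ has at most one element). The surrounding sets are $$\mathcal{I}:=\{s_i\in S\setminus\mathcal{N}: \exists t_j\in T,\ s_i\le t_j<s_{i+1}\}\cup\{s_{i+1}\in S\setminus\mathcal{N}: \exists t_j\in T,\ s_i\le t_j<s_{i+1}\},$$ $$\mathcal{C}:=\{s_{i-1}\in S\setminus\mathcal{N}: s_i\in\mathcal{N}\}\cup\{s_{i+1}\in S\setminus\mathcal{N}: s_i\in\mathcal{N}\},$$ where only indices in $\{1,\ldots,n\}$ are considered. *)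

theory Defs
  imports "HOL-Probability.Probability"
begin

text \<open>
  A finite signed Borel measure on the real line is represented by its values on Borel sets.
  As for the library's \<^const>\<open>measure\<close>, the value on every non-Borel set is 0, so that two
  signed measures are the same measure iff they are equal as functions.
\<close>

definition signed_borel_measure :: "(real set \<Rightarrow> real) \<Rightarrow> bool" where
  "signed_borel_measure \<nu> \<longleftrightarrow>
     (\<forall>A. A \<notin> sets borel \<longrightarrow> \<nu> A = 0) \<and> \<nu> {} = 0 \<and>
     (\<forall>A :: nat \<Rightarrow> real set. range A \<subseteq> sets borel \<longrightarrow> disjoint_family A \<longrightarrow>
        (\<lambda>i. \<nu> (A i)) sums \<nu> (\<Union>i. A i))"

definition supported_on :: "(real set \<Rightarrow> real) \<Rightarrow> real set \<Rightarrow> bool" where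
  "supported_on \<nu> X \<longleftrightarrow> (\<forall>A\<in>sets borel. A \<inter> X = {} \<longrightarrow> \<nu> A = 0)"

definition tv_norm :: "(real set \<Rightarrow> real) \<Rightarrow> ereal" where
  "tv_norm \<nu> = (SUP P\<in>{P. finite P \<and> P \<subseteq> sets borel \<and> partition_on UNIV P}. ereal (\<Sum>A\<in>P. \<bar>\<nu> A\<bar>))"

text \<open>
  Jordan decomposition: the upper variation of \<open>\<nu>\<close>; the lower variation is that of \<open>-\<nu>\<close>.
  Negative values of \<open>\<nu> B\<close> are truncated to 0 by \<^const>\<open>ennreal\<close>, which does not change the
  supremum because \<open>B = {}\<close> contributes 0.
\<close>

definition upper_variation :: "(real set \<Rightarrow> real) \<Rightarrow> real measure" where
  "upper_variation \<nu> =
     measure_of UNIV (sets borel) (\<lambda>A. SUP B\<in>{B\<in>sets borel. B \<subseteq> A}. ennreal (\<nu> B))"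

definition signed_integral :: "(real set \<Rightarrow> real) \<Rightarrow> (real \<Rightarrow> real) \<Rightarrow> real" where
  "signed_integral \<nu> f =
     (\<integral>t. f t \<partial>upper_variation \<nu>) - (\<integral>t. f t \<partial>upper_variation (\<lambda>A. - \<nu> A))"

definition conv_measure :: "(real \<Rightarrow> real) \<Rightarrow> (real set \<Rightarrow> real) \<Rightarrow> real \<Rightarrow> real" where
  "conv_measure K \<nu> s = signed_integral \<nu> (\<lambda>t. K (s - t))"

text \<open>\<^term>\<open>return borel t\<close> is the Dirac measure at \<open>t\<close>.\<close>

definition dirac_comb :: "real set \<Rightarrow> (real \<Rightarrow> real) \<Rightarrow> real set \<Rightarrow> real" where
  "dirac_comb T a A = (\<Sum>t\<in>T. a t * measure (return borel t) A)"

definition gaussian_kernel :: "real \<Rightarrow> real \<Rightarrow> real" where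
  "gaussian_kernel \<sigma> t = exp (- (t\<^sup>2 / (2 * \<sigma>\<^sup>2)))"

text \<open>The infimum of the empty set is \<open>\<infinity>\<close> in \<^typ>\<open>ereal\<close>.\<close>

definition min_separation :: "real set \<Rightarrow> ereal" where
  "min_separation A = (INF (a, b)\<in>{(a, b). a \<in> A \<and> b \<in> A \<and> a \<noteq> b}. ereal \<bar>a - b\<bar>)"

text \<open>
  Samples are indexed by \<open>{1..n}\<close>. The vector space \<open>\<real>\<^sup>n\<close> is \<^term>\<open>{1..n} \<rightarrow>\<^sub>E (UNIV :: real set)\<close>;
  its elements are extensional, so equality of functions is equality of vectors.
\<close>

definition grid_points :: "nat \<Rightarrow> (nat \<Rightarrow> real) \<Rightarrow> real set" where
  "grid_points n s = s ` {1..n}"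

definition noise_locations :: "nat \<Rightarrow> (nat \<Rightarrow> real) \<Rightarrow> (nat \<Rightarrow> real) \<Rightarrow> real set" where
  "noise_locations n s w = {s i |i. i \<in> {1..n} \<and> w i \<noteq> 0}"

definition spike_neighbors :: "nat \<Rightarrow> (nat \<Rightarrow> real) \<Rightarrow> (nat \<Rightarrow> real) \<Rightarrow> real set \<Rightarrow> real set" where
  "spike_neighbors n s w T =
     {s i |i. i \<in> {1..n} \<and> i + 1 \<in> {1..n} \<and> s i \<in> grid_points n s - noise_locations n s w \<and>
        (\<exists>t\<in>T. s i \<le> t \<and> t < s (i + 1))} \<union>
     {s (i + 1) |i. i \<in> {1..n} \<and> i + 1 \<in> {1..n} \<and>
        s (i + 1) \<in> grid_points n s - noise_locations n s w \<and>
        (\<exists>t\<in>T. s i \<le> t \<and> t < s (i + 1))}"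

definition noise_neighbors :: "nat \<Rightarrow> (nat \<Rightarrow> real) \<Rightarrow> (nat \<Rightarrow> real) \<Rightarrow> real set" where
  "noise_neighbors n s w =
     {s (i - 1) |i. i \<in> {1..n} \<and> i - 1 \<in> {1..n} \<and>
        s (i - 1) \<in> grid_points n s - noise_locations n s w \<and> s i \<in> noise_locations n s w} \<union>
     {s (i + 1) |i. i \<in> {1..n} \<and> i + 1 \<in> {1..n} \<and>
        s (i + 1) \<in> grid_points n s - noise_locations n s w \<and> s i \<in> noise_locations n s w}"

definition feasible ::
    "(real \<Rightarrow> real) \<Rightarrow> nat \<Rightarrow> (nat \<Rightarrow> real) \<Rightarrow> (nat \<Rightarrow> real) \<Rightarrow> real set \<Rightarrow>
     (real set \<Rightarrow> real) \<times> (nat \<Rightarrow> real) \<Rightarrow> bool" where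
  "feasible K n s y X = (\<lambda>(\<nu>, v).
     signed_borel_measure \<nu> \<and> supported_on \<nu> X \<and> v \<in> {1..n} \<rightarrow>\<^sub>E UNIV \<and>
     (\<forall>i\<in>{1..n}. conv_measure K \<nu> (s i) + v i = y i))"

definition objective :: "real \<Rightarrow> nat \<Rightarrow> (real set \<Rightarrow> real) \<times> (nat \<Rightarrow> real) \<Rightarrow> ereal" where
  "objective l n = (\<lambda>(\<nu>, v). tv_norm \<nu> + ereal (l * (\<Sum>i\<in>{1..n}. \<bar>v i\<bar>)))"

text \<open>
  The set function in the definition of \<^const>\<open>upper_variation\<close> is indeed a measure, so
  \<^const>\<open>measure_of\<close> does not degenerate there.
\<close>

lemma emeasure_upper_variation:
  assumes \<nu>: "signed_borel_measure \<nu>" and A: "A \<in> sets borel"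
  shows "emeasure (upper_variation \<nu>) A = (SUP B\<in>{B\<in>sets borel. B \<subseteq> A}. ennreal (\<nu> B))"
proof -
  define p where "p A = (SUP B\<in>{B\<in>sets borel. B \<subseteq> A}. ennreal (\<nu> B))" for A :: "real set"
  have \<nu>0: "\<nu> {} = 0" using \<nu> by (simp add: signed_borel_measure_def)
  have sums: "(\<lambda>i. \<nu> (F i)) sums \<nu> (\<Union>i. F i)"
    if "range F \<subseteq> sets borel" "disjoint_family F" for F :: "nat \<Rightarrow> real set"
    using \<nu> that by (simp add: signed_borel_measure_def)
  have add: "\<nu> (B \<union> C) = \<nu> B + \<nu> C"
    if "B \<in> sets borel" "C \<in> sets borel" "B \<inter> C = {}" for B C
  proof -
    have "(\<lambda>i. \<nu> (binaryset B C i)) sums \<nu> (\<Union>i. binaryset B C i)"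
      using that by (intro sums) (auto simp: range_binaryset_eq disjoint_family_on_def binaryset_def)
    moreover have "(\<lambda>i. \<nu> (binaryset B C i)) sums (\<nu> B + \<nu> C)"
      using binaryset_sums[of \<nu> B C] \<nu>0 by simp
    ultimately show ?thesis by (simp add: UN_binaryset_eq sums_unique2)
  qed
  have p_upper: "ennreal (\<nu> B) \<le> p A" if "B \<in> sets borel" "B \<subseteq> A" for A B
    unfolding p_def using that by (intro SUP_upper) auto
  have p_mono: "p A \<le> p B" if "A \<subseteq> B" for A B
    unfolding p_def using that by (intro SUP_subset_mono) auto
  have pair: "ennreal (\<nu> B) + ennreal (\<nu> C) \<le> p (A1 \<union> A2)"
    if "A1 \<inter> A2 = {}" "B \<in> sets borel" "B \<subseteq> A1" "C \<in> sets borel" "C \<subseteq> A2" for A1 A2 B C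
  proof (cases "\<nu> B \<ge> 0 \<and> \<nu> C \<ge> 0")
    case True
    have "ennreal (\<nu> B) + ennreal (\<nu> C) = ennreal (\<nu> (B \<union> C))"
      using True that by (subst add) auto
    also have "\<dots> \<le> p (A1 \<union> A2)" using that by (intro p_upper) auto
    finally show ?thesis .
  next
    case False
    then consider "ennreal (\<nu> B) = 0" | "ennreal (\<nu> C) = 0"
      by (auto simp: ennreal_eq_0_iff)
    then show ?thesis
    proof cases
      case 1
      have "ennreal (\<nu> C) \<le> p (A1 \<union> A2)" by (rule p_upper) (use that in blast)+
      then show ?thesis by (simp only: 1 add_0_left)
    next
      case 2
      have "ennreal (\<nu> B) \<le> p (A1 \<union> A2)" by (rule p_upper) (use that in blast)+
      then show ?thesis by (simp only: 2 add_0_right)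
    qed
  qed
  have ne: "{B\<in>sets borel. B \<subseteq> A} \<noteq> {}" for A :: "real set" by blast
  have superadd: "p A1 + p A2 \<le> p (A1 \<union> A2)" if "A1 \<inter> A2 = {}" for A1 A2
  proof -
    have 1: "p A1 + ennreal (\<nu> C) \<le> p (A1 \<union> A2)" if "C \<in> sets borel" "C \<subseteq> A2" for C
    proof -
      have "p A1 + ennreal (\<nu> C) = (SUP B\<in>{B\<in>sets borel. B \<subseteq> A1}. ennreal (\<nu> B) + ennreal (\<nu> C))"
        unfolding p_def by (rule ennreal_SUP_add_left[OF ne, symmetric])
      also have "\<dots> \<le> p (A1 \<union> A2)"
        by (intro SUP_least pair) (use \<open>A1 \<inter> A2 = {}\<close> that in auto)
      finally show ?thesis .
    qed
    have "p A1 + p A2 = (SUP C\<in>{C\<in>sets borel. C \<subseteq> A2}. p A1 + ennreal (\<nu> C))"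
      unfolding p_def[of A2] add.commute[of "p A1"] by (rule ennreal_SUP_add_left[OF ne, symmetric])
    also have "\<dots> \<le> p (A1 \<union> A2)" by (intro SUP_least 1) auto
    finally show ?thesis .
  qed
  have ca: "countably_additive (sets borel) p"
  proof (rule countably_additiveI)
    fix F :: "nat \<Rightarrow> real set"
    assume F: "range F \<subseteq> sets borel" "disjoint_family F" "(\<Union>i. F i) \<in> sets borel"
    have part: "(\<Sum>i<n. p (F i)) \<le> p (\<Union>i<n. F i)" for n
    proof (induction n)
      case 0
      show ?case by simp
    next
      case (Suc n)
      have "(\<Sum>i<Suc n. p (F i)) \<le> p (\<Union>i<n. F i) + p (F n)"
        using Suc by (simp add: add_right_mono)
      also have "\<dots> \<le> p ((\<Union>i<n. F i) \<union> F n)"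
        by (rule superadd) (use F(2) in \<open>auto simp: disjoint_family_on_def disjoint_iff dest: less_imp_neq\<close>)
      also have "(\<Union>i<n. F i) \<union> F n = (\<Union>i<Suc n. F i)"
        by (simp add: lessThan_Suc Un_commute)
      finally show ?case .
    qed
    have "(\<Sum>i. p (F i)) \<le> p (\<Union>i. F i)"
      by (rule suminf_le_const[OF summableI])
         (rule order_trans[OF part p_mono], auto)
    moreover have "p (\<Union>i. F i) \<le> (\<Sum>i. p (F i))"
      unfolding p_def[of "\<Union>i. F i"]
    proof (rule SUP_least)
      fix B assume "B \<in> {B\<in>sets borel. B \<subseteq> (\<Union>i. F i)}"
      then have B: "B \<in> sets borel" "B = (\<Union>i. B \<inter> F i)" by auto
      have "(\<lambda>i. \<nu> (B \<inter> F i)) sums \<nu> (\<Union>i. B \<inter> F i)"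
        using F B(1) by (intro sums) (auto simp: disjoint_family_on_def)
      then have "(\<lambda>n. ennreal (\<Sum>i<n. \<nu> (B \<inter> F i))) \<longlonglongrightarrow> ennreal (\<nu> B)"
        using B(2) by (simp add: sums_def tendsto_ennrealI)
      moreover have "ennreal (\<Sum>i<n. \<nu> (B \<inter> F i)) \<le> (\<Sum>i. p (F i))" for n
      proof -
        have "ennreal (\<Sum>i<n. \<nu> (B \<inter> F i)) \<le> ennreal (\<Sum>i<n. max 0 (\<nu> (B \<inter> F i)))"
          by (intro ennreal_leI sum_mono) simp
        also have "\<dots> = (\<Sum>i<n. ennreal (max 0 (\<nu> (B \<inter> F i))))"
          by (rule sum_ennreal[symmetric]) simp
        also have "\<dots> \<le> (\<Sum>i<n. p (F i))"
        proof (rule sum_mono)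
          fix i
          have "ennreal (\<nu> (B \<inter> F i)) \<le> p (F i)"
            using F(1) B(1) by (intro p_upper) auto
          then show "ennreal (max 0 (\<nu> (B \<inter> F i))) \<le> p (F i)"
            by (simp add: max_def ennreal_neg)
        qed
        also have "\<dots> \<le> (\<Sum>i. p (F i))"
          by (intro sum_le_suminf summableI) auto
        finally show ?thesis .
      qed
      ultimately show "ennreal (\<nu> B) \<le> (\<Sum>i. p (F i))"
        by (intro LIMSEQ_le_const2) auto
    qed
    ultimately show "(\<Sum>i. p (F i)) = p (\<Union>i. F i)" by (rule antisym)
  qed
  have "p {} = 0" by (simp add: p_def \<nu>0 cong: conj_cong)
  then have pos: "positive (sets borel) p" by (simp add: positive_def)
  have sa: "sigma_algebra (UNIV :: real set) (sets borel)"
    using sets.sigma_algebra_axioms[of "borel :: real measure"] by simp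
  have "emeasure (upper_variation \<nu>) A = p A"
    unfolding upper_variation_def p_def[symmetric]
    by (rule emeasure_measure_of_sigma[OF sa pos ca A])
  then show ?thesis by (simp add: p_def)
qed

end

theory Submission
  imports Defs "HOL-Probability.Hoeffding"
begin

text \<open>
  It suffices to find, for all signs \<open>\<epsilon>\<close> on \<open>T\<close> and \<open>\<delta>\<close> on the corrupted samples, a vector \<open>q\<close> with
  \<open>q\<^sub>i = 2 \<delta>\<^sub>i\<close> at corrupted and \<open>\<bar>q\<^sub>i\<bar> < 2\<close> at clean samples for which \<open>Q t = (\<Sum>i. q\<^sub>i K (s\<^sub>i - t))\<close>
  equals \<open>\<epsilon>\<close> on \<open>T\<close> and has modulus less than 1 elsewhere. Applied to the signs of the difference
  between a competitor and \<open>(\<mu>, w)\<close>, one such vector shows that the competitor is strictly worse;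
  in particular, no separate argument is needed for uniqueness.

  After rescaling, \<open>\<sigma> = 1\<close>. At every spike, the two surrounding Gaussians are combined into a bump
  (value 1, slope 0 at the spike) and a wave (value 0, slope 1). At every corruption, the coefficients
  \<open>- \<delta>, 2 \<delta>, - \<delta>\<close> on three consecutive samples produce a second difference of the Gaussian, whose
  derivatives of order \<open>m\<close> are at most \<open>\<tau>\<^sup>2\<close> times a bound for the derivative of order \<open>m + 2\<close> of the
  Gaussian. The conditions \<open>Q = \<epsilon>\<close> and \<open>Q' = 0\<close> on \<open>T\<close> form a system for the coefficients of the
  bumps and waves that is a small perturbation of the identity, so it is solved by iteration. With
  the resulting estimates, \<open>\<bar>Q\<bar> < 1\<close> follows near a spike from Taylor's theorem, and farther away from
  the decay of the bumps.
\<close>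

section \<open>Derivatives of the Gaussian\<close>

text \<open>The obstacle is the prescribed modulus 2 at a corrupted sample: the Gaussian placed
  there would by itself push \<open>Q\<close> up to modulus 2, where less than 1 is allowed. A spike
  may lie within a few grid steps of a corruption, where the kernel has hardly decayed, so distance
  is no help and cancellation by the two clean neighbours is needed. The weights -1, 2, -1
  annihilate affine functions, leave an error of order \<open>\<tau>\<^sup>2\<close> at every
  distance, and still respect the bound 2 at clean samples. A second conflict concerns the step
  size. Written in sampled Gaussians, bumps and waves carry a division by \<tau>; the upper bound on
  \<tau> keeps the corruption part small, the lower bound keeps these quotients below 2. All
  constants are rational, so that every numerical estimate reduces to exact arithmetic. They are
  calibrated for separation 15/4 and largest step 19/80 in units of the Gaussian width.\<close>

lemma exp_ge_quartic:
  fixes y :: real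
  assumes "0 \<le> y"
  shows "1 + y + y^2/2 + y^3/6 + y^4/24 \<le> exp y"
proof -
  have "(\<Sum>k<5. y^k /\<^sub>R fact k) \<le> (\<Sum>k. y^k /\<^sub>R fact k)"
    by (rule sum_le_suminf[OF summable_exp_generic]) (use assms in auto)
  then show ?thesis
    by (simp add: exp_def eval_nat_numeral fact_numeral field_simps)
qed

text \<open>Reduces a numerical upper bound on \<open>exp (- x)\<close> to rational arithmetic:
  \<open>y\<close> is about \<open>x / m\<close>, small enough for the quartic to be sharp,
  \<open>d\<close> is the value of the quartic rounded down, and the power \<open>m\<close> undoes
  the division.\<close>

lemma exp_minus_le:
  fixes y :: real and m :: nat
  assumes "0 \<le> y" "d \<le> 1 + y + y^2/2 + y^3/6 + y^4/24" "0 \<le> d" "1 \<le> c * d ^ m" "0 \<le> c"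
    "real m * y \<le> x"
  shows "exp (- x) \<le> c"
proof -
  have "d \<le> exp y" using assms exp_ge_quartic[of y] by linarith
  then have "d ^ m \<le> exp y ^ m" using assms by (intro power_mono) auto
  also have "\<dots> \<le> exp x" using assms by (simp flip: exp_of_nat_mult)
  finally have "c * d ^ m \<le> c * exp x"
    using assms by (intro mult_left_mono)
  then have "1 \<le> c * exp x" using assms by linarith
  then show ?thesis by (simp add: exp_minus field_simps)
qed

lemma taylor_second_order_bound:
  fixes f f' f'' :: "real \<Rightarrow> real"
  assumes f: "\<And>x. (f has_real_derivative f' x) (at x)"
    and f': "\<And>x. (f' has_real_derivative f'' x) (at x)"
    and M: "\<And>x. x \<in> closed_segment a b \<Longrightarrow> \<bar>f'' x\<bar> \<le> M"
  shows "\<bar>f b - f a - f' a * (b - a)\<bar> \<le> M * (b - a)\<^sup>2 / 2"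
proof (cases "a = b")
  case False
  define D where "D m = (if m = 0 then f else if m = 1 then f' else f'')" for m :: nat
  have "\<exists>t. (if b < a then b < t \<and> t < a else a < t \<and> t < b) \<and>
    f b = (\<Sum>m<2. (D m a / fact m) * (b - a)^m) + (D 2 t / fact 2) * (b - a)^2"
    by (rule Taylor[where a = "min a b" and b = "max a b"])
      (use False in \<open>auto simp: D_def less_2_cases_iff f f'\<close>)
  then obtain t where t: "if b < a then b < t \<and> t < a else a < t \<and> t < b"
    and eq: "f b = f a + f' a * (b - a) + f'' t / 2 * (b - a)^2"
    by (auto simp: D_def numeral_2_eq_2)
  have "t \<in> closed_segment a b"
    using t by (auto simp: closed_segment_eq_real_ivl split: if_splits)
  then have "\<bar>f'' t\<bar> * (b - a)\<^sup>2 \<le> M * (b - a)\<^sup>2"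
    by (intro mult_right_mono M) auto
  then show ?thesis by (simp add: eq abs_mult)
qed simp

text \<open>Taylor expansion at \<open>u\<close> in both directions: the first order terms cancel
  and the two remainders add up.\<close>

lemma second_difference_bound:
  fixes f f' f'' :: "real \<Rightarrow> real"
  assumes f: "\<And>x. (f has_real_derivative f' x) (at x)"
    and f': "\<And>x. (f' has_real_derivative f'' x) (at x)"
    and M: "\<And>x. \<bar>x - u\<bar> \<le> \<tau> \<Longrightarrow> \<bar>f'' x\<bar> \<le> M" and "0 \<le> \<tau>"
  shows "\<bar>2 * f u - f (u - \<tau>) - f (u + \<tau>)\<bar> \<le> M * \<tau>\<^sup>2"
proof -
  have "\<bar>f (u + \<tau>) - f u - f' u * (u + \<tau> - u)\<bar> \<le> M * (u + \<tau> - u)\<^sup>2 / 2"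
    by (rule taylor_second_order_bound[OF f f'])
      (use \<open>0 \<le> \<tau>\<close> in \<open>auto intro!: M simp: closed_segment_eq_real_ivl split: if_splits\<close>)
  then have "\<bar>f (u + \<tau>) - f u - f' u * \<tau>\<bar> \<le> M * \<tau>\<^sup>2 / 2" by simp
  moreover have "\<bar>f (u - \<tau>) - f u - f' u * (u - \<tau> - u)\<bar> \<le> M * (u - \<tau> - u)\<^sup>2 / 2"
    by (rule taylor_second_order_bound[OF f f'])
      (use \<open>0 \<le> \<tau>\<close> in \<open>auto intro!: M simp: closed_segment_eq_real_ivl split: if_splits\<close>)
  then have "\<bar>f (u - \<tau>) - f u + f' u * \<tau>\<bar> \<le> M * \<tau>\<^sup>2 / 2" by simp
  ultimately show ?thesis by argo
qed

section \<open>The Gaussian, its first four derivatives and their global bounds\<close>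

definition gauss :: "real \<Rightarrow> real" where
  "gauss u = exp (- (u\<^sup>2 / 2))"

definition gauss1 :: "real \<Rightarrow> real" where
  "gauss1 u = - u * gauss u"

definition gauss2 :: "real \<Rightarrow> real" where
  "gauss2 u = (u\<^sup>2 - 1) * gauss u"

definition gauss3 :: "real \<Rightarrow> real" where
  "gauss3 u = (3 * u - u ^ 3) * gauss u"

definition gauss4 :: "real \<Rightarrow> real" where
  "gauss4 u = (u ^ 4 - 6 * u\<^sup>2 + 3) * gauss u"

lemma gauss_pos [simp]: "0 < gauss u" and gauss_nonneg [simp]: "0 \<le> gauss u"
  by (simp_all add: gauss_def)

lemma gauss_deriv [derivative_intros]:
  assumes "(f has_real_derivative f') (at x within A)"
  shows "((\<lambda>x. gauss (f x)) has_real_derivative gauss1 (f x) * f') (at x within A)"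
  unfolding gauss_def gauss1_def by (auto intro!: derivative_eq_intros assms)

lemma gauss1_deriv [derivative_intros]:
  assumes "(f has_real_derivative f') (at x within A)"
  shows "((\<lambda>x. gauss1 (f x)) has_real_derivative gauss2 (f x) * f') (at x within A)"
  unfolding gauss1_def gauss2_def
  by (auto intro!: derivative_eq_intros assms simp: gauss1_def algebra_simps power2_eq_square)

lemma gauss2_deriv [derivative_intros]:
  assumes "(f has_real_derivative f') (at x within A)"
  shows "((\<lambda>x. gauss2 (f x)) has_real_derivative gauss3 (f x) * f') (at x within A)"
  unfolding gauss3_def gauss2_def
  by (auto intro!: derivative_eq_intros assms
      simp: gauss1_def algebra_simps power2_eq_square power3_eq_cube)

lemma gauss3_deriv [derivative_intros]:
  assumes "(f has_real_derivative f') (at x within A)"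
  shows "((\<lambda>x. gauss3 (f x)) has_real_derivative gauss4 (f x) * f') (at x within A)"
  unfolding gauss3_def gauss4_def
  by (auto intro!: derivative_eq_intros assms
      simp: gauss1_def algebra_simps power2_eq_square power3_eq_cube power4_eq_xxxx)

lemma gauss_mult_le_iff: "p * gauss u \<le> c \<longleftrightarrow> p \<le> c * exp (u\<^sup>2 / 2)"
  by (simp add: gauss_def exp_minus field_simps)

text \<open>Moves the Gaussian to the other side, so that a bound on a derivative becomes a
  polynomial inequality against a lower bound of the exponential.\<close>

lemma abs_mult_gauss_le:
  assumes "p \<le> c * exp (u\<^sup>2 / 2)" "- p \<le> c * exp (u\<^sup>2 / 2)"
  shows "\<bar>p * gauss u\<bar> \<le> c"
  using assms gauss_mult_le_iff[of p u c] gauss_mult_le_iff[of "-p" u c] by (simp add: abs_le_iff)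


lemma gauss2_bound: "\<bar>gauss2 u\<bar> \<le> 1"
proof -
  define v where "v = u\<^sup>2"
  have v: "0 \<le> v" by (simp add: v_def)
  have e: "1 + v/2 + v^2/8 + v^3/48 + v^4/384 \<le> exp (v/2)"
    using exp_ge_quartic[of "v/2"] v by (simp add: power_divide)
  have "0 \<le> v^3" "0 \<le> v^4" "0 \<le> v^2" using v by simp_all
  moreover have "0 \<le> (v - 2)\<^sup>2" by simp
  then have "0 \<le> v\<^sup>2 - 4 * v + 4" by (simp add: power2_eq_square algebra_simps)
  ultimately show ?thesis
    unfolding gauss2_def by (intro abs_mult_gauss_le; fold v_def) (use e v in argo)+
qed

text \<open>The bound is attained at 0, as is the bound 1 for \<open>gauss2\<close>. The auxiliary
  squares settle the polynomial inequalities that remain once the exponential is replaced by its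
  quartic minorant.\<close>

lemma gauss4_bound: "\<bar>gauss4 u\<bar> \<le> 3"
proof -
  define v where "v = u\<^sup>2"
  have v: "0 \<le> v" by (simp add: v_def)
  have u4: "u ^ 4 = v\<^sup>2" by (simp add: v_def flip: power_mult)
  have e: "1 + v/2 + v^2/8 + v^3/48 + v^4/384 \<le> exp (v/2)"
    using exp_ge_quartic[of "v/2"] v by (simp add: power_divide)
  have p: "0 \<le> v^3" "0 \<le> v^4" "0 \<le> v^2" using v by simp_all
  have "0 \<le> v * ((v - 5)\<^sup>2 + 95)" using v by simp
  then have 1: "0 \<le> v^3 - 10 * v\<^sup>2 + 120 * v"
    by (simp add: power2_eq_square power3_eq_cube algebra_simps)
  have "0 \<le> (10 * v - 17)\<^sup>2" by simp
  then have 2: "0 \<le> 100 * v\<^sup>2 - 340 * v + 289" by (simp add: power2_eq_square algebra_simps)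
  show ?thesis
    unfolding gauss4_def by (intro abs_mult_gauss_le; unfold u4; fold v_def) (use e v p 1 2 in argo)+
qed

text \<open>Unlike the even derivatives, \<open>gauss3\<close> has an odd polynomial factor;
  squaring turns the inequality into one in \<open>u\<^sup>2\<close> alone.\<close>

lemma gauss3_sq:
  assumes "u\<^sup>2 * (u\<^sup>2 - 3)\<^sup>2 \<le> c\<^sup>2 * exp (u\<^sup>2)" "0 \<le> c"
  shows "\<bar>gauss3 u\<bar> \<le> c"
proof -
  have "(3 * u - u ^ 3)\<^sup>2 = u\<^sup>2 * (u\<^sup>2 - 3)\<^sup>2" by algebra
  also have "\<dots> \<le> c\<^sup>2 * exp (u\<^sup>2)" by fact
  also have "\<dots> = (c * exp (u\<^sup>2/2))\<^sup>2"
    by (simp add: power_mult_distrib flip: exp_double)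
  finally have "\<bar>3 * u - u ^ 3\<bar> \<le> c * exp (u\<^sup>2/2)"
    using abs_le_square_iff[of "3 * u - u ^ 3" "c * exp (u\<^sup>2/2)"] \<open>0 \<le> c\<close> by simp
  then show ?thesis unfolding gauss3_def
    by (intro abs_mult_gauss_le) auto
qed

lemma gauss3_bound: "\<bar>gauss3 u\<bar> \<le> 3/2"
proof (rule gauss3_sq)
  define v where "v = u\<^sup>2"
  have v: "0 \<le> v" by (simp add: v_def)
  have e: "1 + v + v^2/2 + v^3/6 + v^4/24 \<le> exp v"
    using exp_ge_quartic[of v] v by simp
  have "0 \<le> (25 * v - 14)\<^sup>2" by simp
  then have 1: "0 \<le> 625 * v\<^sup>2 - 700 * v + 196" by (simp add: power2_eq_square algebra_simps)
  have "0 \<le> (v - 1)\<^sup>2" by simp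
  then have 2: "0 \<le> v\<^sup>2 - 2 * v + 1" by (simp add: power2_eq_square algebra_simps)
  \<comment> \<open>With weight 1/96 this square accounts for the cubic and quartic terms; what
    remains is a positive quadratic, handled by the two squares above.\<close>
  have "0 \<le> v\<^sup>2 * (3 * v - 10)\<^sup>2" by simp
  then have 3: "0 \<le> 9 * v^4 - 60 * v^3 + 100 * v^2"
    by (simp add: power2_eq_square power3_eq_cube power4_eq_xxxx algebra_simps)
  have "0 \<le> v\<^sup>2" by simp
  moreover have "v * (v - 3)\<^sup>2 = v^3 - 6 * v\<^sup>2 + 9 * v"
    by (simp add: power2_eq_square power3_eq_cube algebra_simps)
  moreover have "(3/2)\<^sup>2 = ((9/4)::real)" by (simp add: power2_eq_square)
  ultimately have "v * (v - 3)\<^sup>2 \<le> 9/4 * exp v"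
    using 1 2 3 e v by linarith
  then have "v * (v - 3)\<^sup>2 \<le> (3/2)\<^sup>2 * exp v" by (simp add: power2_eq_square)
  then show "u\<^sup>2 * (u\<^sup>2 - 3)\<^sup>2 \<le> (3/2)\<^sup>2 * exp (u\<^sup>2)" by (simp only: v_def)
qed simp

text \<open>
  A point at distance at least \<open>15/8\<close> (half of the minimum separation) or \<open>15/4\<close> from a corruption keeps
  distance \<open>131/80 = 15/8 - 19/80\<close> or \<open>281/80 = 15/4 - 19/80\<close> under shifts by the step size, which is at
  most \<open>19/80 = 0.2375\<close>.
\<close>

lemma exp_three_halves_ge: "112/25 \<le> exp ((3/2)::real)"
proof -
  have "exp (- (3/2)) \<le> (1/(112/25)::real)"
    by (rule exp_minus_le[where y = "1/4" and d = "321/250" and m = 6]) (simp_all add: power_divide)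
  then show ?thesis by (simp add: exp_minus field_simps)
qed

text \<open>For \<open>\<bar>u\<bar>\<close> beyond 1 the maximum is \<open>2 * exp (- 3/2)\<close>,
  about 0.446, at \<open>v = 3\<close>. The tangent of \<open>exp (v/2)\<close> there vanishes
  exactly at \<open>v = 1\<close>, so it is a multiple of the factor \<open>v - 1\<close>.\<close>

lemma gauss2_tail:
  assumes "131/80 \<le> \<bar>u\<bar>"
  shows "\<bar>gauss2 u\<bar> \<le> 9/20"
proof -
  define v where "v = u\<^sup>2"
  have "(131/80)\<^sup>2 \<le> \<bar>u\<bar>\<^sup>2" using assms by (intro power_mono) auto
  then have v: "67/25 \<le> v" by (simp add: v_def power2_eq_square)
  have "v / 2 = 3/2 + (v - 3) / 2" by (simp add: field_simps)
  then have "exp (v/2) = exp (3/2) * exp ((v - 3)/2)" by (simp only: exp_add)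
  moreover have "1 + (v - 3) / 2 \<le> exp ((v - 3)/2)" by simp
  then have "112/25 * (1 + (v - 3) / 2) \<le> exp (3/2) * exp ((v - 3)/2)"
    using v exp_three_halves_ge by (intro mult_mono) (auto simp: field_simps)
  ultimately have "56/25 * v - 56/25 \<le> exp (v/2)" by (simp add: field_simps)
  then show ?thesis
    unfolding gauss2_def by (intro abs_mult_gauss_le; fold v_def) (use v in linarith)+
qed

text \<open>The polynomial factor vanishes at \<open>v = 3\<close>. Near this zero a crude bound
  suffices; beyond it the maximum lies at \<open>v = 3 + sqrt 6\<close>, about 5.45, whence the
  expansion point 11/2.\<close>

lemma gauss3_tail:
  assumes "131/80 \<le> \<bar>u\<bar>"
  shows "\<bar>gauss3 u\<bar> \<le> 2/5"
proof (rule gauss3_sq)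
  define v where "v = u\<^sup>2"
  have "(131/80)\<^sup>2 \<le> \<bar>u\<bar>\<^sup>2" using assms by (intro power_mono) auto
  then have v: "67/25 \<le> v" by (simp add: v_def power2_eq_square)
  have "v * (v - 3)\<^sup>2 \<le> (2/5)\<^sup>2 * exp v"
  proof (cases "v \<le> 17/5")
    case True
    have "(v - 3)\<^sup>2 \<le> (2/5)\<^sup>2" by (rule power2_le_iff_abs_le[THEN iffD2]) (use True v in \<open>auto simp: abs_if field_simps\<close>)
    then have "v * (v - 3)\<^sup>2 \<le> 17/5 * (2/5)\<^sup>2" using True v by (intro mult_mono) auto
    moreover have "1 + v \<le> exp v" by simp
    then have "17/5 \<le> exp v" using v by linarith
    then have "17/5 * (2/5)\<^sup>2 \<le> exp v * (2/5)\<^sup>2" by (intro mult_right_mono) auto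
    ultimately show ?thesis by (simp only: mult.commute)
  next
    case False
    define s where "s = v - (17/5)"
    have s: "0 \<le> s" using False by (simp add: s_def)
    have "exp (-(11/2)) \<le> (1/244::real)"
      by (rule exp_minus_le[where y = "1/2" and d = "4121/2500" and m = 11]) (simp_all add: power_divide)
    then have e: "244 \<le> exp ((11/2)::real)" by (simp add: exp_minus field_simps)
    \<comment> \<open>A tangent line for one third of the exponent, cubed afterwards, since
      \<open>v * (v - 3)\<^sup>2\<close> grows cubically.\<close>
    have "3/10 + s/3 \<le> exp ((v - (11/2)) / 3)"
      using exp_ge_add_one_self[of "(v - (11/2)) / 3"] by (simp add: s_def field_simps)
    then have "(3/10 + s/3) ^ 3 \<le> exp ((v - (11/2)) / 3) ^ 3" using s by (intro power_mono) auto
    also have "\<dots> = exp (real 3 * ((v - 11/2) / 3))" by (rule exp_of_nat_mult[symmetric])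
    also have "real 3 * ((v - 11/2) / 3) = v - 11/2" by (simp add: field_simps)
    finally have "(3/10 + s/3) ^ 3 \<le> exp (v - 11/2)" .
    then have "244 * (3/10 + s/3) ^ 3 \<le> exp (11/2) * exp (v - (11/2))"
      using s e by (intro mult_mono) auto
    then have "244 * (3/10 + s/3) ^ 3 \<le> exp v" by (simp flip: exp_add)
    moreover have "(s + 17/5) * (s + 2/5)\<^sup>2 \<le> 4/25 * 244 * (3/10 + s/3) ^ 3"
    proof -
      have "0 \<le> s * ((s - 1/2)\<^sup>2)" using s by simp
      then have "0 \<le> s^3 - s\<^sup>2 + 1/4 * s" by (simp add: power2_eq_square power3_eq_cube algebra_simps)
      moreover have "0 \<le> s\<^sup>2" "0 \<le> s^3" using s by simp_all
      moreover have "(s + 17/5) * (s + 2/5)\<^sup>2 = s^3 + 21/5 * s\<^sup>2 + 72/25 * s + 68/125"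
        by (simp add: power2_eq_square power3_eq_cube field_simps)
      moreover have "(3/10 + s/3) ^ 3 = s^3/27 + s\<^sup>2/10 + 9/100 * s + 27/1000"
        by (simp add: power2_eq_square power3_eq_cube field_simps)
      ultimately show ?thesis using s by linarith
    qed
    moreover have "v * (v - 3)\<^sup>2 = (s + 17/5) * (s + 2/5)\<^sup>2" by (simp add: s_def)
    ultimately have "v * (v - 3)\<^sup>2 \<le> 4/25 * exp v" by linarith
    then show ?thesis by (simp add: power2_eq_square)
  qed
  then show "u\<^sup>2 * (u\<^sup>2 - 3)\<^sup>2 \<le> (2/5)\<^sup>2 * exp (u\<^sup>2)" by (simp only: v_def)
qed simp

text \<open>On this range the modulus is largest at the left end, where the polynomial is negative;
  hence the tangent of \<open>exp (v/2)\<close> at \<open>v = 67/25\<close> in the second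
  half.\<close>

lemma gauss4_tail:
  assumes "131/80 \<le> \<bar>u\<bar>"
  shows "\<bar>gauss4 u\<bar> \<le> 8/5"
proof -
  define v where "v = u\<^sup>2"
  have "(131/80)\<^sup>2 \<le> \<bar>u\<bar>\<^sup>2" using assms by (intro power_mono) auto
  then have v: "67/25 \<le> v" by (simp add: v_def power2_eq_square)
  have u4: "u ^ 4 = v\<^sup>2" by (simp add: v_def flip: power_mult)
  have e: "1 + v/2 + v^2/8 + v^3/48 + v^4/384 \<le> exp (v/2)"
    using exp_ge_quartic[of "v/2"] v by (simp add: power_divide)
  have "v\<^sup>2 - 6 * v + 3 \<le> 8/5 * exp (v/2)"
  proof -
    have "0 \<le> v * (v - 12)\<^sup>2" using v by simp
    then have "0 \<le> v^3 - 24 * v\<^sup>2 + 144 * v"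
      by (simp add: power2_eq_square power3_eq_cube algebra_simps)
    moreover have "0 \<le> v^4" by simp
    ultimately show ?thesis using e v by linarith
  qed
  moreover have "- (v\<^sup>2 - 6 * v + 3) \<le> 8/5 * exp (v/2)"
  proof -
    have "exp (-(67/50)) \<le> (1/(381/100)::real)"
      by (rule exp_minus_le[where y = "67/200" and d = "1747/1250" and m = 4]) (simp_all add: power_divide)
    then have e: "381/100 \<le> exp ((67/50)::real)" by (simp add: exp_minus field_simps)
    have "1 + (v/2 - (67/50)) \<le> exp (v/2 - (67/50))" by (rule exp_ge_add_one_self)
    then have "381/100 * (1 + (v/2 - (67/50))) \<le> exp (67/50) * exp (v/2 - (67/50))"
      using v e by (intro mult_mono) auto
    then have "381/100 * (1 + (v/2 - (67/50))) \<le> exp (v/2)" by (simp flip: exp_add)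
    then have "381/200 * v - 381/100 * (17/50) \<le> exp (v/2)" by (simp add: field_simps)
    moreover have "0 \<le> (v - (67/25))\<^sup>2" by simp
    then have "0 \<le> v\<^sup>2 - (134/25) * v + 4489/625" by (simp add: power2_eq_square algebra_simps)
    ultimately show ?thesis using v by linarith
  qed
  ultimately show ?thesis
    unfolding gauss4_def by (intro abs_mult_gauss_le; unfold u4; fold v_def) auto
qed

text \<open>The logarithmic derivative \<open>m / r + q - 2 * p * r\<close> is decreasing, and the
  last hypothesis makes it at most -1 at \<open>r0\<close>. Decay at unit rate is what the geometric
  sums over separated points need.\<close>

lemma power_times_gaussian_tail:
  fixes r r0 p q :: real
  assumes "0 < r0" "r0 \<le> r" "0 \<le> p" "real m / r0 + q + 1 \<le> 2 * p * r0"
  shows "r ^ m * exp (q * r - p * r\<^sup>2) \<le> r0 ^ m * exp (q * r0 - p * r0\<^sup>2) * exp (- (r - r0))"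
proof -
  have "r / r0 = 1 + (r - r0) / r0" using assms by (simp add: field_simps)
  also have "\<dots> \<le> exp ((r - r0) / r0)" by (rule exp_ge_add_one_self)
  finally have "(r / r0) ^ m \<le> exp ((r - r0) / r0) ^ m" using assms by (intro power_mono) auto
  then have "r ^ m \<le> r0 ^ m * exp (real m / r0 * (r - r0))"
    using assms by (simp add: power_divide field_simps flip: exp_of_nat_mult)
  then have "r ^ m * exp (q * r - p * r\<^sup>2)
      \<le> r0 ^ m * exp (real m / r0 * (r - r0)) * exp (q * r - p * r\<^sup>2)"
    by (intro mult_right_mono) auto
  also have "\<dots> = r0 ^ m * exp (real m / r0 * (r - r0) + (q * r - p * r\<^sup>2))"
    by (simp add: exp_add)
  also have "\<dots> \<le> r0 ^ m * exp ((q * r0 - p * r0\<^sup>2) + - (r - r0))"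
  proof -
    have "2 * p * r0 \<le> p * (r + r0)" using assms by (simp add: algebra_simps mult_left_mono)
    then have "(r - r0) * (real m / r0 + q + 1) \<le> (r - r0) * (p * (r + r0))"
      using assms by (intro mult_left_mono) auto
    then have "real m / r0 * (r - r0) + (q * r - p * r\<^sup>2) \<le> (q * r0 - p * r0\<^sup>2) + - (r - r0)"
      by (simp add: algebra_simps power2_eq_square)
    then show ?thesis using assms by (intro mult_left_mono) auto
  qed
  finally show ?thesis by (simp only: exp_add mult.assoc)
qed

lemma gauss_power_far:
  assumes "281/80 \<le> \<bar>u\<bar>" "m \<le> 4"
  shows "\<bar>u\<bar> ^ m * gauss u \<le> (281/80) ^ m * (53/25000) * exp (- (\<bar>u\<bar> - (281/80)))"
proof -
  have "\<bar>u\<bar> ^ m * exp (0 * \<bar>u\<bar> - 1/2 * \<bar>u\<bar>\<^sup>2)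
      \<le> (281/80) ^ m * exp (0 * (281/80) - 1/2 * (281/80)\<^sup>2) * exp (- (\<bar>u\<bar> - (281/80)))"
    by (rule power_times_gaussian_tail) (use assms in \<open>auto simp: field_simps\<close>)
  also have "exp (0 * (281/80) - 1/2 * (281/80)\<^sup>2) = exp (- ((78961/6400)/2::real))"
    by (simp add: power2_eq_square)
  also have "\<dots> \<le> 53/25000"
    by (rule exp_minus_le[where y = "77/200" and d = "2939/2000" and m = 16]) (simp_all add: power_divide)
  finally show ?thesis by (simp add: gauss_def mult_left_mono mult_right_mono)
qed

lemma gauss2_far:
  assumes "281/80 \<le> \<bar>u\<bar>"
  shows "\<bar>gauss2 u\<bar> \<le> 27/1000 * exp (- (\<bar>u\<bar> - (281/80)))"
proof -
  have "1 \<le> \<bar>u\<bar>\<^sup>2" using assms by (intro one_le_power) auto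
  then have "\<bar>u\<^sup>2 - 1\<bar> \<le> \<bar>u\<bar>\<^sup>2" by simp
  then have "\<bar>gauss2 u\<bar> \<le> \<bar>u\<bar>\<^sup>2 * gauss u"
    unfolding gauss2_def abs_mult by (simp add: mult_right_mono)
  also have "\<dots> \<le> (281/80)\<^sup>2 * (53/25000) * exp (- (\<bar>u\<bar> - (281/80)))"
    by (rule gauss_power_far) (use assms in auto)
  also have "\<dots> \<le> 27/1000 * exp (- (\<bar>u\<bar> - (281/80)))"
    by (intro mult_right_mono) (simp_all add: power2_eq_square)
  finally show ?thesis .
qed

lemma gauss3_far:
  assumes "281/80 \<le> \<bar>u\<bar>"
  shows "\<bar>gauss3 u\<bar> \<le> 23/250 * exp (- (\<bar>u\<bar> - (281/80)))"
proof -
  have "(281/80)\<^sup>2 \<le> \<bar>u\<bar>\<^sup>2" using assms by (intro power_mono) auto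
  then have "\<bar>3 - u\<^sup>2\<bar> \<le> \<bar>u\<bar>\<^sup>2" by (simp add: power2_eq_square)
  then have "\<bar>u\<bar> * \<bar>3 - u\<^sup>2\<bar> \<le> \<bar>u\<bar> * \<bar>u\<bar>\<^sup>2" by (intro mult_left_mono) auto
  then have "\<bar>u\<bar> * \<bar>3 - u\<^sup>2\<bar> \<le> \<bar>u\<bar> ^ 3" by (simp add: power3_eq_cube power2_eq_square)
  moreover have "3 * u - u ^ 3 = u * (3 - u\<^sup>2)" by (simp add: power3_eq_cube power2_eq_square algebra_simps)
  ultimately have "\<bar>gauss3 u\<bar> \<le> \<bar>u\<bar> ^ 3 * gauss u"
    unfolding gauss3_def abs_mult by (simp add: mult_right_mono abs_mult)
  also have "\<dots> \<le> (281/80) ^ 3 * (53/25000) * exp (- (\<bar>u\<bar> - (281/80)))"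
    by (rule gauss_power_far) (use assms in auto)
  also have "\<dots> \<le> 23/250 * exp (- (\<bar>u\<bar> - (281/80)))"
    by (intro mult_right_mono) (simp_all add: power3_eq_cube)
  finally show ?thesis .
qed

lemma gauss4_far:
  assumes "281/80 \<le> \<bar>u\<bar>"
  shows "\<bar>gauss4 u\<bar> \<le> 33/100 * exp (- (\<bar>u\<bar> - (281/80)))"
proof -
  have "(281/80)\<^sup>2 \<le> \<bar>u\<bar>\<^sup>2" using assms by (intro power_mono) auto
  then have v: "12 \<le> u\<^sup>2" by (simp add: power2_eq_square)
  then have "12 * u\<^sup>2 \<le> u\<^sup>2 * u\<^sup>2" by (intro mult_right_mono) auto
  then have "12 * u\<^sup>2 \<le> u ^ 4" by (simp flip: power_add)
  then have "\<bar>u ^ 4 - 6 * u\<^sup>2 + 3\<bar> \<le> u ^ 4" using v by linarith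
  then have "\<bar>u ^ 4 - 6 * u\<^sup>2 + 3\<bar> \<le> \<bar>u\<bar> ^ 4" by simp
  then have "\<bar>gauss4 u\<bar> \<le> \<bar>u\<bar> ^ 4 * gauss u"
    unfolding gauss4_def abs_mult by (simp add: mult_right_mono)
  also have "\<dots> \<le> (281/80) ^ 4 * (53/25000) * exp (- (\<bar>u\<bar> - (281/80)))"
    by (rule gauss_power_far) (use assms in auto)
  also have "\<dots> \<le> 33/100 * exp (- (\<bar>u\<bar> - (281/80)))"
    by (intro mult_right_mono) (simp_all add: power4_eq_xxxx)
  finally show ?thesis .
qed

text \<open>The sign is that of minus the second derivative, so that the centre carries the weight 2
  prescribed at a corrupted sample and the neighbours carry weights of modulus 1.\<close>

definition second_diff :: "real \<Rightarrow> (real \<Rightarrow> real) \<Rightarrow> real \<Rightarrow> real" where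
  "second_diff \<tau> f u = 2 * f u - f (u - \<tau>) - f (u + \<tau>)"

lemma second_diff_deriv:
  assumes "\<And>x. (f has_real_derivative f' x) (at x)"
  shows "(second_diff \<tau> f has_real_derivative second_diff \<tau> f' x) (at x)"
proof -
  have "((\<lambda>u. f (u - \<tau>)) has_real_derivative f' (x - \<tau>) * 1) (at x)"
    by (rule DERIV_chain2[OF assms]) (auto intro!: derivative_eq_intros)
  moreover have "((\<lambda>u. f (u + \<tau>)) has_real_derivative f' (x + \<tau>) * 1) (at x)"
    by (rule DERIV_chain2[OF assms]) (auto intro!: derivative_eq_intros)
  ultimately show ?thesis
    unfolding second_diff_def using assms[of x] by (auto intro!: derivative_eq_intros)
qed

text \<open>Three regimes: anywhere, from half the separation on, and from the full separation on.
  The hypotheses on \<open>f''\<close> start 19/80 earlier because the bound involves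
  \<open>f''\<close> up to one step away from \<open>u\<close>.\<close>

lemma second_diff_bounds:
  fixes f f' f'' :: "real \<Rightarrow> real"
  assumes f: "\<And>x. (f has_real_derivative f' x) (at x)"
    and f': "\<And>x. (f' has_real_derivative f'' x) (at x)"
    and \<tau>: "0 \<le> \<tau>" "\<tau> \<le> 19/80"
    and M: "\<And>x. \<bar>f'' x\<bar> \<le> M"
    and M': "\<And>x. (131/80) \<le> \<bar>x\<bar> \<Longrightarrow> \<bar>f'' x\<bar> \<le> M'"
    and F: "\<And>x. (281/80) \<le> \<bar>x\<bar> \<Longrightarrow> \<bar>f'' x\<bar> \<le> F * exp (- (\<bar>x\<bar> - (281/80)))" and "0 \<le> F"
  shows "\<bar>second_diff \<tau> f u\<bar> \<le> M * \<tau>\<^sup>2"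
    and "15/8 \<le> \<bar>u\<bar> \<Longrightarrow> \<bar>second_diff \<tau> f u\<bar> \<le> M' * \<tau>\<^sup>2"
    and "15/4 \<le> \<bar>u\<bar> \<Longrightarrow> \<bar>second_diff \<tau> f u\<bar> \<le> F * \<tau>\<^sup>2 * exp (- (\<bar>u\<bar> - (15/4)))"
proof -
  note * = second_difference_bound[OF f f' _ \<tau>(1), folded second_diff_def]
  show "\<bar>second_diff \<tau> f u\<bar> \<le> M * \<tau>\<^sup>2" by (rule *) (rule M)
  show "\<bar>second_diff \<tau> f u\<bar> \<le> M' * \<tau>\<^sup>2" if "15/8 \<le> \<bar>u\<bar>"
    by (rule *, rule M') (use that \<tau> in \<open>simp add: abs_if split: if_splits\<close>)
  show "\<bar>second_diff \<tau> f u\<bar> \<le> F * \<tau>\<^sup>2 * exp (- (\<bar>u\<bar> - (15/4)))" if "15/4 \<le> \<bar>u\<bar>"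
  proof -
    have "\<bar>second_diff \<tau> f u\<bar> \<le> F * exp (- (\<bar>u\<bar> - (15/4))) * \<tau>\<^sup>2"
    proof (rule *)
      fix x assume x: "\<bar>x - u\<bar> \<le> \<tau>"
      then have ux: "\<bar>u\<bar> - (19/80) \<le> \<bar>x\<bar>" using \<tau> by linarith
      have "\<bar>f'' x\<bar> \<le> F * exp (- (\<bar>x\<bar> - (281/80)))" by (rule F) (use ux that in linarith)
      also have "\<dots> \<le> F * exp (- (\<bar>u\<bar> - (15/4)))"
        using ux \<open>0 \<le> F\<close> by (intro mult_left_mono) auto
      finally show "\<bar>f'' x\<bar> \<le> F * exp (- (\<bar>u\<bar> - (15/4)))" .
    qed
    then show ?thesis by (simp add: mult_ac)
  qed
qed

lemma gauss_has_deriv: "(gauss has_real_derivative gauss1 x) (at x)"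
  and gauss1_has_deriv: "(gauss1 has_real_derivative gauss2 x) (at x)"
  and gauss2_has_deriv: "(gauss2 has_real_derivative gauss3 x) (at x)"
  and gauss3_has_deriv: "(gauss3 has_real_derivative gauss4 x) (at x)"
  using gauss_deriv[OF DERIV_ident, of x] gauss1_deriv[OF DERIV_ident, of x]
    gauss2_deriv[OF DERIV_ident, of x] gauss3_deriv[OF DERIV_ident, of x] by simp_all

lemmas second_diff_gauss_bounds = second_diff_bounds[OF gauss_has_deriv gauss1_has_deriv _ _
    gauss2_bound gauss2_tail gauss2_far, simplified]
  and second_diff_gauss1_bounds = second_diff_bounds[OF gauss1_has_deriv gauss2_has_deriv _ _
    gauss3_bound gauss3_tail gauss3_far, simplified]
  and second_diff_gauss2_bounds = second_diff_bounds[OF gauss2_has_deriv gauss3_has_deriv _ _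
    gauss4_bound gauss4_tail gauss4_far, simplified]

section \<open>The interpolating atoms\<close>

text \<open>The mean of \<open>exp (Y * u)\<close> for the centred random variable \<open>Y\<close>
  with values \<open>- x\<close> and \<open>z\<close>; hence value 1 and slope 0 at 0.\<close>

definition interp_g :: "real \<Rightarrow> real \<Rightarrow> real \<Rightarrow> real" where
  "interp_g x z u = (z * exp (- x * u) + x * exp (z * u)) / (x + z)"

text \<open>A divided difference with value 0 and slope 1 at 0. The functions
  \<open>interp_h1\<close> and \<open>interp_h2\<close> are its derivatives, and the derivative of
  \<open>interp_g\<close> is \<open>x * z\<close> times it.\<close>

definition interp_h :: "real \<Rightarrow> real \<Rightarrow> real \<Rightarrow> real" where
  "interp_h x z u = (exp (z * u) - exp (- x * u)) / (x + z)"

definition interp_h1 :: "real \<Rightarrow> real \<Rightarrow> real \<Rightarrow> real" where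
  "interp_h1 x z u = (z * exp (z * u) + x * exp (- x * u)) / (x + z)"

definition interp_h2 :: "real \<Rightarrow> real \<Rightarrow> real \<Rightarrow> real" where
  "interp_h2 x z u = (z\<^sup>2 * exp (z * u) - x\<^sup>2 * exp (- x * u)) / (x + z)"

text \<open>
  The Gaussians centred at \<open>- x\<close> and \<open>z\<close> are multiples of \<open>gauss u * exp (- x * u)\<close> and
  \<open>gauss u * exp (z * u)\<close>; \<open>bump\<close> and \<open>wave\<close> are the combinations of the two whose value and slope
  at 0 are \<open>(1, 0)\<close> and \<open>(0, 1)\<close>.
\<close>

definition bump :: "real \<Rightarrow> real \<Rightarrow> real \<Rightarrow> real" where
  "bump x z u = interp_g x z u * gauss u"

definition bump1 :: "real \<Rightarrow> real \<Rightarrow> real \<Rightarrow> real" where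
  "bump1 x z u = (x * z * interp_h x z u - u * interp_g x z u) * gauss u"

definition bump2 :: "real \<Rightarrow> real \<Rightarrow> real \<Rightarrow> real" where
  "bump2 x z u = (x * z * interp_h1 x z u - 2 * u * (x * z * interp_h x z u)
     + (u\<^sup>2 - 1) * interp_g x z u) * gauss u"

definition wave :: "real \<Rightarrow> real \<Rightarrow> real \<Rightarrow> real" where
  "wave x z u = interp_h x z u * gauss u"

definition wave1 :: "real \<Rightarrow> real \<Rightarrow> real \<Rightarrow> real" where
  "wave1 x z u = (interp_h1 x z u - u * interp_h x z u) * gauss u"

definition wave2 :: "real \<Rightarrow> real \<Rightarrow> real \<Rightarrow> real" where
  "wave2 x z u = (interp_h2 x z u - 2 * u * interp_h1 x z u
     + (u\<^sup>2 - 1) * interp_h x z u) * gauss u"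

lemma interp_g_deriv: "(interp_g x z has_real_derivative x * z * interp_h x z u) (at u)"
proof -
  have "((\<lambda>u. z * exp (- x * u) + x * exp (z * u)) has_real_derivative
      x * z * (exp (z * u) - exp (- x * u))) (at u)"
    by (auto intro!: derivative_eq_intros simp: algebra_simps)
  from DERIV_cdivide[OF this, of "x + z"] show ?thesis
    unfolding interp_g_def interp_h_def by simp
qed

lemma interp_h_deriv: "(interp_h x z has_real_derivative interp_h1 x z u) (at u)"
proof -
  have "((\<lambda>u. exp (z * u) - exp (- x * u)) has_real_derivative
      z * exp (z * u) + x * exp (- x * u)) (at u)"
    by (auto intro!: derivative_eq_intros simp: algebra_simps)
  from DERIV_cdivide[OF this, of "x + z"] show ?thesis
    unfolding interp_h1_def interp_h_def .
qed

lemma interp_h1_deriv: "(interp_h1 x z has_real_derivative interp_h2 x z u) (at u)"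
proof -
  have "((\<lambda>u. z * exp (z * u) + x * exp (- x * u)) has_real_derivative
      z\<^sup>2 * exp (z * u) - x\<^sup>2 * exp (- x * u)) (at u)"
    by (auto intro!: derivative_eq_intros simp: algebra_simps power2_eq_square)
  from DERIV_cdivide[OF this, of "x + z"] show ?thesis
    unfolding interp_h1_def interp_h2_def .
qed

lemma bump_deriv: "(bump x z has_real_derivative bump1 x z u) (at u)"
  unfolding bump_def bump1_def
  by (auto intro!: derivative_eq_intros interp_g_deriv simp: gauss1_def algebra_simps)

lemma bump1_deriv: "(bump1 x z has_real_derivative bump2 x z u) (at u)"
  unfolding bump1_def bump2_def
  by (auto intro!: derivative_eq_intros interp_g_deriv interp_h_deriv
      simp: gauss1_def algebra_simps power2_eq_square)

lemma wave_deriv: "(wave x z has_real_derivative wave1 x z u) (at u)"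
  unfolding wave_def wave1_def
  by (auto intro!: derivative_eq_intros interp_h_deriv simp: gauss1_def algebra_simps)

lemma wave1_deriv: "(wave1 x z has_real_derivative wave2 x z u) (at u)"
  unfolding wave1_def wave2_def
  by (auto intro!: derivative_eq_intros interp_h1_deriv interp_h_deriv
      simp: gauss1_def algebra_simps power2_eq_square)

lemma interp_reflect:
  "interp_g x z (- u) = interp_g z x u" "interp_h x z (- u) = - interp_h z x u"
  "interp_h1 x z (- u) = interp_h1 z x u" "interp_h2 x z (- u) = - interp_h2 z x u"
  by (simp_all add: interp_g_def interp_h_def interp_h1_def interp_h2_def add.commute
      minus_divide_left)

lemma gauss_reflect: "gauss (- u) = gauss u"
  by (simp add: gauss_def)

text \<open>Reflection exchanges the two centres, so the estimates have to be proved for nonnegative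
  \<open>u\<close> only, as long as they are symmetric in \<open>x\<close> and
  \<open>z\<close>.\<close>

lemma atoms_reflect:
  "bump x z (- u) = bump z x u" "bump1 x z (- u) = - bump1 z x u" "bump2 x z (- u) = bump2 z x u"
  "wave x z (- u) = - wave z x u" "wave1 x z (- u) = wave1 z x u" "wave2 x z (- u) = - wave2 z x u"
  by (simp_all add: bump_def bump1_def bump2_def wave_def wave1_def wave2_def interp_reflect
      gauss_reflect algebra_simps)

lemma gauss_times_exp: "gauss u * exp y = exp (y - u\<^sup>2 / 2)"
  by (simp add: gauss_def add.commute flip: exp_add)

text \<open>
  Hoeffding's lemma for the two-point distribution on \<open>- x\<close> and \<open>z\<close> with mean 0.
\<close>

lemma interp_g_le:
  assumes "0 \<le> x" "0 \<le> z" "0 < x + z" "0 \<le> u"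
  shows "interp_g x z u \<le> exp (((x + z) * u)\<^sup>2 / 8)"
proof -
  define p where "p = x / (x + z)"
  define k where "k = 1 + p * (exp ((x + z) * u) - 1)"
  have p: "0 \<le> p" "p * (x + z) = x" "z = (1 - p) * (x + z)"
    using assms by (simp_all add: p_def field_simps)
  have "0 \<le> p * (exp ((x + z) * u) - 1)" using assms p by (intro mult_nonneg_nonneg) auto
  then have k: "0 < k" by (simp add: k_def)
  have "- ((x + z) * u) * p + ln k \<le> ((x + z) * u)\<^sup>2 / 8"
    unfolding k_def by (rule Hoeffdings_lemma_aux) (use assms p in auto)
  then have "exp (- ((x + z) * u) * p + ln k) \<le> exp (((x + z) * u)\<^sup>2 / 8)" by simp
  also have "exp (- ((x + z) * u) * p + ln k) = exp (- ((x + z) * u) * p) * k"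
    using k by (simp only: exp_add exp_ln)
  also have "- ((x + z) * u) * p = - x * u"
    using p(2) by (simp add: mult_ac)
  also have "exp (- x * u) * k = (1 - p) * exp (- x * u) + p * (exp (- x * u) * exp ((x + z) * u))"
    by (simp add: k_def algebra_simps)
  also have "exp (- x * u) * exp ((x + z) * u) = exp (z * u)"
    by (simp add: algebra_simps flip: exp_add)
  also have "(1 - p) * exp (- x * u) + p * exp (z * u) = interp_g x z u"
    using assms by (simp add: interp_g_def p_def diff_divide_eq_iff add_divide_distrib)
  finally show ?thesis .
qed

lemma exp_second_order:
  fixes y :: real
  assumes "0 \<le> y"
  shows "exp y \<le> 1 + y + y\<^sup>2 / 2 * exp y" and "exp (- y) \<le> 1 - y + y\<^sup>2 / 2"
proof -
  have "\<bar>exp y - exp 0 - exp 0 * (y - 0)\<bar> \<le> exp y * (y - 0)\<^sup>2 / 2"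
    by (rule taylor_second_order_bound[where f' = exp and f'' = exp])
      (use assms in \<open>auto intro!: derivative_eq_intros simp: closed_segment_eq_real_ivl\<close>)
  then have "2 * \<bar>exp y - 1 - y\<bar> \<le> y\<^sup>2 * exp y" by (simp add: mult.commute)
  then show "exp y \<le> 1 + y + y\<^sup>2 / 2 * exp y" by (simp add: field_simps)
  have "\<bar>exp (- y) - exp (- 0) - (- exp (- 0)) * (y - 0)\<bar> \<le> 1 * (y - 0)\<^sup>2 / 2"
    by (rule taylor_second_order_bound[where f = "\<lambda>y. exp (- y)" and f' = "\<lambda>y. - exp (- y)"
        and f'' = "\<lambda>y. exp (- y)"])
      (use assms in \<open>auto intro!: derivative_eq_intros simp: closed_segment_eq_real_ivl\<close>)
  then have "\<bar>exp (- y) - 1 + y\<bar> * 2 \<le> y\<^sup>2" by simp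
  then show "exp (- y) \<le> 1 - y + y\<^sup>2 / 2"
    using abs_ge_self[of "exp (- y) - 1 + y"] by argo
qed

lemma exp_29_1000: "exp (29/1000) \<le> (103/100 :: real)"
proof -
  have "1 - 29/1000 \<le> exp (- (29/1000) :: real)" using exp_ge_add_one_self[of "- (29/1000)"] by simp
  then show ?thesis by (simp add: exp_minus field_simps)
qed

lemma abs_mult_gauss_exp_le:
  assumes "\<bar>p\<bar> \<le> c * exp y"
  shows "\<bar>p * gauss u\<bar> \<le> c * exp (y - u\<^sup>2 / 2)"
proof -
  have "\<bar>p\<bar> * gauss u \<le> c * exp y * gauss u" by (rule mult_right_mono[OF assms gauss_nonneg])
  also have "\<dots> = c * exp (y - u\<^sup>2 / 2)" by (simp add: mult_ac flip: gauss_times_exp)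
  finally show ?thesis by (simp add: abs_mult)
qed

context
  fixes x z :: real
  assumes xz: "0 \<le> x" "0 \<le> z" "0 < x + z" "x + z \<le> 19/80"
begin

lemma interp_g_pos: "0 < interp_g x z u"
proof (cases "x = 0")
  case True
  then show ?thesis using xz by (simp add: interp_g_def)
next
  case False
  then have "0 < z * exp (- x * u) + x * exp (z * u)" using xz by (intro add_nonneg_pos) auto
  then show ?thesis using xz by (simp add: interp_g_def)
qed

lemma interp_half_line:
  assumes u: "0 \<le> u"
  shows "interp_g x z u \<le> exp (u\<^sup>2 / 100)"
    and "0 \<le> interp_h x z u" and "interp_h x z u \<le> u * exp (19/80 * u)"
    and "0 \<le> interp_h1 x z u" and "interp_h1 x z u \<le> exp (19/80 * u)"
    and "\<bar>interp_h2 x z u\<bar> \<le> 19/80 * exp (19/80 * u)"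
    and "\<bar>interp_h x z u - u\<bar> \<le> (19/80) / 2 * u\<^sup>2 * exp (19/80 * u)"
    and "0 \<le> x * z * interp_h x z u" and "x * z * interp_h x z u \<le> 19/80 * interp_g x z u"
    and "0 \<le> x * z * interp_h1 x z u" and "x * z * interp_h1 x z u \<le> 19/80 * interp_g x z u"
proof -
  have "((x + z) * u)\<^sup>2 \<le> (19/80 * u)\<^sup>2"
    using xz u by (intro power_mono mult_right_mono) auto
  also have "\<dots> = (19/80)\<^sup>2 * u\<^sup>2" by (rule power_mult_distrib)
  \<comment> \<open>This costs 1/100 of the 1/2 in the exponent of the Gaussian and is the origin of
    49/100 in all bounds for bumps.\<close>
  also have "\<dots> \<le> 8 / 100 * u\<^sup>2" by (intro mult_right_mono) (auto simp: power2_eq_square)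
  finally have "((x + z) * u)\<^sup>2 / 8 \<le> u\<^sup>2 / 100" by simp
  with interp_g_le[of x z u] xz u show "interp_g x z u \<le> exp (u\<^sup>2 / 100)"
    by (smt (verit) exp_le_cancel_iff)
  have zu: "z * u \<le> 19/80 * u" and xu: "- x * u \<le> z * u" "x * u \<le> 19/80 * u" "0 \<le> z * u" "0 \<le> x * u"
    using mult_right_mono[of z "19/80" u] mult_right_mono[of x "19/80" u]
      mult_nonneg_nonneg[of x u] mult_nonneg_nonneg[of z u] xz u by (simp_all del: mult_nonneg_nonneg)
  define e where "e = exp (19/80 * u)"
  have ez: "exp (z * u) \<le> e" and ex: "exp (- x * u) \<le> exp (z * u)" and e0: "0 < e"
    and ex1: "exp (- x * u) \<le> 1" "1 \<le> exp (z * u)"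
    using zu xu by (auto simp: e_def)
  show h0: "0 \<le> interp_h x z u" using xz ex by (simp add: interp_h_def)
  have lo: "(x + z) * u - (x + z) * (19/80) / 2 * u\<^sup>2 \<le> exp (z * u) - exp (- x * u)"
  proof -
    have "exp (- (x * u)) \<le> 1 - x * u + (x * u)\<^sup>2 / 2" using xu by (intro exp_second_order) auto
    moreover have "1 + z * u \<le> exp (z * u)" by (rule exp_ge_add_one_self)
    moreover have "(x * u)\<^sup>2 \<le> ((x + z) * (19/80)) * u\<^sup>2"
      unfolding power_mult_distrib power2_eq_square[of x] using xz
      by (intro mult_right_mono mult_mono) auto
    moreover have "(x + z) * (19/80) / 2 * u\<^sup>2 = ((x + z) * (19/80) * u\<^sup>2) / 2"
      "(x + z) * u = x * u + z * u" "exp (- x * u) = exp (- (x * u))" by (simp_all add: algebra_simps)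
    ultimately show ?thesis by linarith
  qed
  have hi: "exp (z * u) - exp (- x * u) \<le> (x + z) * u + (x + z) * (19/80) / 2 * u\<^sup>2 * e"
  proof -
    have "exp (z * u) \<le> 1 + z * u + (z * u)\<^sup>2 / 2 * exp (z * u)"
      using xu by (intro exp_second_order) auto
    moreover have "1 - x * u \<le> exp (- x * u)" using exp_ge_add_one_self[of "- x * u"] by simp
    moreover have "(z * u)\<^sup>2 * exp (z * u) \<le> (((x + z) * (19/80)) * u\<^sup>2) * e"
      unfolding power_mult_distrib power2_eq_square[of z] using xz ez
      by (intro mult_right_mono mult_mono) auto
    moreover have "(x + z) * (19/80) / 2 * u\<^sup>2 * e = ((x + z) * (19/80) * u\<^sup>2 * e) / 2"
      "(z * u)\<^sup>2 / 2 * exp (z * u) = ((z * u)\<^sup>2 * exp (z * u)) / 2"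
      "(x + z) * u = x * u + z * u" by (simp_all add: algebra_simps)
    ultimately show ?thesis by linarith
  qed
  show "\<bar>interp_h x z u - u\<bar> \<le> (19/80) / 2 * u\<^sup>2 * exp (19/80 * u)"
  proof -
    have "(19/80) / 2 * u\<^sup>2 * 1 \<le> (19/80) / 2 * u\<^sup>2 * e"
      using u by (intro mult_left_mono) (auto simp: e_def)
    then have "(x + z) * ((19/80) / 2 * u\<^sup>2 * 1) \<le> (x + z) * ((19/80) / 2 * u\<^sup>2 * e)"
      by (rule mult_left_mono) (use xz in simp)
    then have "(x + z) * (u - (19/80) / 2 * u\<^sup>2 * e) \<le> exp (z * u) - exp (- x * u)"
      using lo by (simp only: right_diff_distrib mult_1_right mult.assoc)
    moreover have "exp (z * u) - exp (- x * u) \<le> (x + z) * (u + (19/80) / 2 * u\<^sup>2 * e)"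
      using hi by (simp add: algebra_simps)
    ultimately have "u - (19/80) / 2 * u\<^sup>2 * e \<le> interp_h x z u" "interp_h x z u \<le> u + (19/80) / 2 * u\<^sup>2 * e"
      unfolding interp_h_def using xz by (simp_all add: pos_le_divide_eq pos_divide_le_eq mult_ac)
    then show ?thesis unfolding e_def[symmetric] by (simp only: abs_le_iff) linarith
  qed
  \<comment> \<open>Factoring out \<open>exp (z * u)\<close> leaves
    \<open>1 - exp (- (x + z) * u)\<close>, which is at most \<open>(x + z) * u\<close>, so the
    denominator cancels.\<close>
  show "interp_h x z u \<le> u * exp (19/80 * u)"
  proof -
    have "1 - (x + z) * u \<le> exp (- (x + z) * u)"
      using exp_ge_add_one_self[of "- ((x + z) * u)"] by (simp only: mult_minus_left diff_conv_add_uminus)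
    then have "(1 - exp (- (x + z) * u)) * exp (z * u) \<le> ((x + z) * u) * e"
      using ez xz u by (intro mult_mono) auto
    moreover have "exp (- (x + z) * u) * exp (z * u) = exp (- x * u)"
      by (simp add: algebra_simps flip: exp_add)
    ultimately have "exp (z * u) - exp (- x * u) \<le> (x + z) * (u * e)" by (simp add: algebra_simps)
    then show ?thesis unfolding interp_h_def e_def[symmetric] using xz
      by (simp add: pos_divide_le_eq mult_ac)
  qed
  show h10: "0 \<le> interp_h1 x z u" using xz by (simp add: interp_h1_def)
  show "interp_h1 x z u \<le> exp (19/80 * u)"
  proof -
    have "z * exp (z * u) + x * exp (- x * u) \<le> z * e + x * e"
      using xz ez order_trans[OF ex ez] by (intro add_mono mult_left_mono) auto
    then show ?thesis unfolding interp_h1_def e_def[symmetric] using xz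
      by (simp add: pos_divide_le_eq algebra_simps)
  qed
  show "\<bar>interp_h2 x z u\<bar> \<le> 19/80 * exp (19/80 * u)"
  proof -
    have "z\<^sup>2 * exp (z * u) \<le> (19/80 * (x + z)) * e"
      unfolding power2_eq_square using xz ez by (intro mult_mono) auto
    moreover have "x\<^sup>2 * exp (- x * u) \<le> (19/80 * (x + z)) * e"
      unfolding power2_eq_square using xz order_trans[OF ex ez] by (intro mult_mono) auto
    moreover have "0 \<le> z\<^sup>2 * exp (z * u)" "0 \<le> x\<^sup>2 * exp (- x * u)" by simp_all
    ultimately have "\<bar>z\<^sup>2 * exp (z * u) - x\<^sup>2 * exp (- x * u)\<bar> \<le> (19/80 * (x + z)) * e" by linarith
    then show ?thesis unfolding interp_h2_def e_def[symmetric] using xz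
      by (simp add: pos_divide_le_eq abs_divide algebra_simps)
  qed
  show "0 \<le> x * z * interp_h x z u" "0 \<le> x * z * interp_h1 x z u"
    using h0 h10 xz by auto
  have "x * z * (exp (z * u) - exp (- x * u)) \<le> z * (x * exp (z * u))"
    using xz by (simp add: algebra_simps)
  also have "\<dots> \<le> 19/80 * (z * exp (- x * u) + x * exp (z * u))"
    using xz by (intro mult_mono) auto
  finally show "x * z * interp_h x z u \<le> 19/80 * interp_g x z u"
    unfolding interp_h_def interp_g_def times_divide_eq_right
    by (rule divide_right_mono) (use xz in simp)
  have "x * z * (z * exp (z * u) + x * exp (- x * u)) = z\<^sup>2 * (x * exp (z * u)) + x\<^sup>2 * (z * exp (- x * u))"
    by (simp add: algebra_simps power2_eq_square)
  also have "\<dots> \<le> 19/80 * (x * exp (z * u)) + 19/80 * (z * exp (- x * u))"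
  proof (intro add_mono mult_right_mono)
    show "z\<^sup>2 \<le> 19/80" "x\<^sup>2 \<le> 19/80"
      using mult_mono[of z "19/80" z 1] mult_mono[of x "19/80" x 1] xz
      by (simp_all add: power2_eq_square)
  qed (use xz in auto)
  also have "\<dots> = 19/80 * (z * exp (- x * u) + x * exp (z * u))" by (simp add: algebra_simps)
  finally show "x * z * interp_h1 x z u \<le> 19/80 * interp_g x z u"
    unfolding interp_h1_def interp_g_def times_divide_eq_right
    by (rule divide_right_mono) (use xz in simp)
qed

text \<open>The bounds for derivatives start where the leading power of \<open>u\<close> dominates
  the other terms of the product rule; for \<open>wave2\<close> this is arranged from 3/2 on. The
  last bound is local: \<open>wave\<close> agrees with the identity to first order, and its
  quadratic error comes from the asymmetry of the two centres.\<close>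

lemma atom_bounds_half_line:
  assumes u: "0 \<le> u"
  shows "bump x z u \<le> exp (- (49/100 * u\<^sup>2))"
    and "1 \<le> u \<Longrightarrow> \<bar>bump1 x z u\<bar> \<le> u * exp (- (49/100 * u\<^sup>2))"
    and "1 \<le> u \<Longrightarrow> \<bar>bump2 x z u\<bar> \<le> u\<^sup>2 * exp (- (49/100 * u\<^sup>2))"
    and "\<bar>wave x z u\<bar> \<le> u * exp (19/80 * u - u\<^sup>2 / 2)"
    and "1 \<le> u \<Longrightarrow> \<bar>wave1 x z u\<bar> \<le> u\<^sup>2 * exp (19/80 * u - u\<^sup>2 / 2)"
    and "3/2 \<le> u \<Longrightarrow> \<bar>wave2 x z u\<bar> \<le> u ^ 3 * exp (19/80 * u - u\<^sup>2 / 2)"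
    and "\<bar>u - wave x z u\<bar> \<le> u\<^sup>2 / 2 * (u + 49/200)"
proof -
  note b = interp_half_line[OF u]
  have g: "interp_g x z u * gauss u \<le> exp (- (49/100 * u\<^sup>2))"
  proof -
    have "interp_g x z u * gauss u \<le> exp (u\<^sup>2 / 100) * gauss u"
      by (intro mult_right_mono b) auto
    also have "\<dots> = exp (u\<^sup>2 / 100 - u\<^sup>2 / 2)" by (simp add: mult.commute gauss_times_exp)
    also have "u\<^sup>2 / 100 - u\<^sup>2 / 2 = - (49/100 * u\<^sup>2)" by simp
    finally show ?thesis .
  qed
  show "bump x z u \<le> exp (- (49/100 * u\<^sup>2))" using g by (simp add: bump_def)
  show "\<bar>bump1 x z u\<bar> \<le> u * exp (- (49/100 * u\<^sup>2))" if "1 \<le> u"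
  proof -
    have "19/80 * interp_g x z u \<le> u * interp_g x z u"
      using that interp_g_pos[of u] by (intro mult_right_mono) auto
    then have "\<bar>x * z * interp_h x z u - u * interp_g x z u\<bar> \<le> u * interp_g x z u"
      using b that mult_nonneg_nonneg[OF u less_imp_le[OF interp_g_pos[of u]]] by linarith
    then have "\<bar>bump1 x z u\<bar> \<le> u * interp_g x z u * gauss u"
      unfolding bump1_def abs_mult by (simp add: mult_right_mono)
    also have "\<dots> \<le> u * exp (- (49/100 * u\<^sup>2))"
      using mult_left_mono[OF g u] by (simp add: mult_ac)
    finally show ?thesis .
  qed
  show "\<bar>bump2 x z u\<bar> \<le> u\<^sup>2 * exp (- (49/100 * u\<^sup>2))" if u1: "1 \<le> u"
  proof -
    have g0: "0 \<le> interp_g x z u" using interp_g_pos[of u] by simp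
    have u2: "u \<le> u\<^sup>2" "1 \<le> u\<^sup>2" using u1 using mult_mono[of 1 u 1 u] mult_left_mono[of 1 u u] u by (simp_all add: power2_eq_square)
    have "2 * u * (x * z * interp_h x z u) \<le> 2 * u * (19/80 * interp_g x z u)"
      using b u by (intro mult_left_mono) auto
    also have "\<dots> \<le> u\<^sup>2 * interp_g x z u"
      using mult_right_mono[OF u2(1) g0] mult_nonneg_nonneg[OF u g0] by (simp add: algebra_simps)
    finally have 1: "2 * u * (x * z * interp_h x z u) \<le> u\<^sup>2 * interp_g x z u" .
    have 2: "0 \<le> 2 * u * (x * z * interp_h x z u)" using b u by simp
    have 3: "0 \<le> (u\<^sup>2 - 1) * interp_g x z u" using u2 g0 by simp
    have 4: "(u\<^sup>2 - 1) * interp_g x z u = u\<^sup>2 * interp_g x z u - interp_g x z u"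
      by (simp add: algebra_simps)
    have "\<bar>x * z * interp_h1 x z u - 2 * u * (x * z * interp_h x z u)
        + (u\<^sup>2 - 1) * interp_g x z u\<bar> \<le> u\<^sup>2 * interp_g x z u"
      using b(10,11) 1 2 3 4 g0 by linarith
    then have "\<bar>bump2 x z u\<bar> \<le> u\<^sup>2 * interp_g x z u * gauss u"
      unfolding bump2_def abs_mult by (simp add: mult_right_mono)
    also have "\<dots> \<le> u\<^sup>2 * exp (- (49/100 * u\<^sup>2))"
      using mult_left_mono[OF g, of "u\<^sup>2"] by (simp add: mult_ac)
    finally show ?thesis .
  qed
  show "\<bar>wave x z u\<bar> \<le> u * exp (19/80 * u - u\<^sup>2 / 2)"
    unfolding wave_def by (rule abs_mult_gauss_exp_le) (use b in simp)
  show "\<bar>wave1 x z u\<bar> \<le> u\<^sup>2 * exp (19/80 * u - u\<^sup>2 / 2)" if u1: "1 \<le> u"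
    unfolding wave1_def
  proof (rule abs_mult_gauss_exp_le)
    have "1 \<le> u\<^sup>2" using u1 by simp
    then have "1 * exp (19/80 * u) \<le> u\<^sup>2 * exp (19/80 * u)" by (intro mult_right_mono) auto
    moreover have "u * interp_h x z u \<le> u * (u * exp (19/80 * u))"
      using b u by (intro mult_left_mono)
    moreover have "0 \<le> u * interp_h x z u" using b u by simp
    ultimately show "\<bar>interp_h1 x z u - u * interp_h x z u\<bar> \<le> u\<^sup>2 * exp (19/80 * u)"
      using b(4,5) unfolding power2_eq_square mult.assoc mult_1 by linarith
  qed
  show "\<bar>wave2 x z u\<bar> \<le> u ^ 3 * exp (19/80 * u - u\<^sup>2 / 2)" if u1: "3/2 \<le> u"
    unfolding wave2_def
  proof (rule abs_mult_gauss_exp_le)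
    have "(3/2)\<^sup>2 \<le> u\<^sup>2" using u1 by (intro power_mono) auto
    then have u2: "9/4 \<le> u\<^sup>2" by (simp add: power2_eq_square)
    then have "9/4 * u \<le> u ^ 3" using mult_right_mono[OF u2 u] by (simp add: power3_eq_cube power2_eq_square)
    moreover have "(u\<^sup>2 - 1) * u = u ^ 3 - u" by (simp add: power3_eq_cube power2_eq_square algebra_simps)
    ultimately have u3: "19/80 + 2 * u \<le> u ^ 3" "19/80 + (u\<^sup>2 - 1) * u \<le> u ^ 3"
      using u1 by linarith+
    define e where "e = exp (19/80 * u)"
    have e: "0 < e" by (simp add: e_def)
    have "2 * u * interp_h1 x z u \<le> 2 * u * e" using b u by (intro mult_left_mono) (auto simp: e_def)
    moreover have "0 \<le> 2 * u * interp_h1 x z u" using b u by simp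
    moreover have "(u\<^sup>2 - 1) * interp_h x z u \<le> (u\<^sup>2 - 1) * (u * e)"
      using b u2 by (intro mult_left_mono) (auto simp: e_def)
    moreover have "0 \<le> (u\<^sup>2 - 1) * interp_h x z u" using b u2 by simp
    moreover have "\<bar>interp_h2 x z u\<bar> \<le> 19/80 * e" using b by (simp add: e_def)
    moreover have "(19/80 + 2 * u) * e \<le> u ^ 3 * e" "(19/80 + (u\<^sup>2 - 1) * u) * e \<le> u ^ 3 * e"
      using u3 e by (auto intro!: mult_right_mono)
    then have "19/80 * e + 2 * u * e \<le> u ^ 3 * e" "19/80 * e + (u\<^sup>2 - 1) * (u * e) \<le> u ^ 3 * e"
      by (simp_all add: algebra_simps)
    ultimately have "\<bar>interp_h2 x z u - 2 * u * interp_h1 x z u + (u\<^sup>2 - 1) * interp_h x z u\<bar> \<le> u ^ 3 * e"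
      by linarith
    then show "\<bar>interp_h2 x z u - 2 * u * interp_h1 x z u + (u\<^sup>2 - 1) * interp_h x z u\<bar>
        \<le> u ^ 3 * exp (19/80 * u)" by (simp add: e_def)
  qed
  show "\<bar>u - wave x z u\<bar> \<le> u\<^sup>2 / 2 * (u + 49/200)"
  proof -
    have "1 - u\<^sup>2 / 2 \<le> gauss u" using exp_ge_add_one_self[of "- (u\<^sup>2 / 2)"] by (simp add: gauss_def)
    moreover have "gauss u \<le> 1" by (simp add: gauss_def)
    ultimately have 1: "0 \<le> u * (1 - gauss u)" "u * (1 - gauss u) \<le> u * (u\<^sup>2 / 2)"
      using u mult_left_mono[of "1 - gauss u" "u\<^sup>2 / 2" u] by auto
    have "\<bar>(interp_h x z u - u) * gauss u\<bar> \<le> (19/80) / 2 * u\<^sup>2 * exp (19/80 * u - u\<^sup>2 / 2)"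
      by (rule abs_mult_gauss_exp_le) (use b in simp)
    \<comment> \<open>The exponent is largest at \<open>u = 19/80\<close>, where it is
      \<open>(19/80)\<^sup>2 / 2\<close>, below 29/1000. The product of 19/80 and 103/100 is just
      below the 49/200 of the claim.\<close>
    also have "\<dots> \<le> (19/80) / 2 * u\<^sup>2 * (103/100)"
    proof (intro mult_left_mono)
      have "0 \<le> (u - (19/80))\<^sup>2" by simp
      then have "19/80 * u - u\<^sup>2 / 2 \<le> 29/1000" by (simp add: power2_eq_square field_simps)
      then have "exp (19/80 * u - u\<^sup>2 / 2) \<le> exp (29/1000)" by simp
      also have "exp (29/1000) \<le> (103/100::real)" by (rule exp_29_1000)
      finally show "exp (19/80 * u - u\<^sup>2 / 2) \<le> 103/100" .
    qed auto
    finally have 2: "\<bar>(interp_h x z u - u) * gauss u\<bar> \<le> (19/80) / 2 * u\<^sup>2 * (103/100)" .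
    have "u - wave x z u = u * (1 - gauss u) - (interp_h x z u - u) * gauss u"
      by (simp add: wave_def algebra_simps)
    moreover have "u * (u\<^sup>2 / 2) + (19/80) / 2 * u\<^sup>2 * (103/100) \<le> u\<^sup>2 / 2 * (u + 49/200)"
      by (simp add: algebra_simps)
    ultimately show ?thesis using 1 2 by linarith
  qed
qed

end

text \<open>The maximiser is near 1.13. Bounding \<open>ln u\<close> by its tangent at 11/10 leaves
  the exponential of a quadratic, maximised by completing the square at
  \<open>1009/880 = 10/11 + 19/80\<close>.\<close>

lemma exp_wave_envelope:
  fixes u :: real
  shows "u * exp (19/80 * u - u\<^sup>2 / 2) \<le> 4/5"
proof -
  have "u / (11/10) \<le> exp (u / (11/10) - 1)" using exp_ge_add_one_self[of "u / (11/10) - 1"] by simp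
  then have "u \<le> 11/10 * exp (u / (11/10) - 1)" by (simp add: field_simps)
  then have "u * exp (19/80 * u - u\<^sup>2 / 2)
      \<le> 11/10 * exp (u / (11/10) - 1) * exp (19/80 * u - u\<^sup>2 / 2)"
    by (intro mult_right_mono) auto
  also have "\<dots> = 11/10 * exp (u / (11/10) - 1 + (19/80 * u - u\<^sup>2 / 2))"
    by (simp only: exp_add mult.assoc)
  also have "\<dots> \<le> 11/10 * exp (- (17/50))"
  proof -
    have "0 \<le> (u - 1009/880)\<^sup>2" by simp
    then have "0 \<le> u\<^sup>2 - 1009/440 * u + 1009/880 * (1009/880)"
      by (simp add: power2_eq_square algebra_simps)
    moreover have "1009/880 * (1009/880) \<le> ((3287/2500)::real)" by simp
    moreover have "u / (11/10) = 10/11 * u" by simp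
    ultimately have "u / (11/10) - 1 + (19/80 * u - u\<^sup>2 / 2) \<le> - (17/50)" by argo
    then show ?thesis by simp
  qed
  also have "exp (- (17/50) :: real) \<le> 18/25"
    by (rule exp_minus_le[where y = "17/50" and d = "7/5" and m = 1]) (simp_all add: power_divide)
  finally show ?thesis by simp
qed

lemma atom_bounds:
  assumes "0 \<le> x" "0 \<le> z" "0 < x + z" "x + z \<le> 19/80"
  shows "0 \<le> bump x z u" and "bump x z u \<le> exp (- (49/100 * u\<^sup>2))"
    and "1 \<le> \<bar>u\<bar> \<Longrightarrow> \<bar>bump1 x z u\<bar> \<le> \<bar>u\<bar> * exp (- (49/100 * u\<^sup>2))"
    and "1 \<le> \<bar>u\<bar> \<Longrightarrow> \<bar>bump2 x z u\<bar> \<le> u\<^sup>2 * exp (- (49/100 * u\<^sup>2))"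
    and "\<bar>wave x z u\<bar> \<le> \<bar>u\<bar> * exp (19/80 * \<bar>u\<bar> - u\<^sup>2 / 2)"
    and "1 \<le> \<bar>u\<bar> \<Longrightarrow> \<bar>wave1 x z u\<bar> \<le> u\<^sup>2 * exp (19/80 * \<bar>u\<bar> - u\<^sup>2 / 2)"
    and "3/2 \<le> \<bar>u\<bar> \<Longrightarrow> \<bar>wave2 x z u\<bar> \<le> \<bar>u\<bar> ^ 3 * exp (19/80 * \<bar>u\<bar> - u\<^sup>2 / 2)"
    and "\<bar>u - wave x z u\<bar> \<le> u\<^sup>2 / 2 * (\<bar>u\<bar> + 49/200)"
    and "\<bar>wave x z u\<bar> \<le> 4/5"
proof -
  show "0 \<le> bump x z u" using interp_g_pos[OF assms, of u] by (simp add: bump_def)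
  have *: "bump x z u \<le> exp (- (49/100 * u\<^sup>2))
    \<and> (1 \<le> \<bar>u\<bar> \<longrightarrow> \<bar>bump1 x z u\<bar> \<le> \<bar>u\<bar> * exp (- (49/100 * u\<^sup>2)))
    \<and> (1 \<le> \<bar>u\<bar> \<longrightarrow> \<bar>bump2 x z u\<bar> \<le> u\<^sup>2 * exp (- (49/100 * u\<^sup>2)))
    \<and> \<bar>wave x z u\<bar> \<le> \<bar>u\<bar> * exp (19/80 * \<bar>u\<bar> - u\<^sup>2 / 2)
    \<and> (1 \<le> \<bar>u\<bar> \<longrightarrow> \<bar>wave1 x z u\<bar> \<le> u\<^sup>2 * exp (19/80 * \<bar>u\<bar> - u\<^sup>2 / 2))
    \<and> (3/2 \<le> \<bar>u\<bar> \<longrightarrow> \<bar>wave2 x z u\<bar> \<le> \<bar>u\<bar> ^ 3 * exp (19/80 * \<bar>u\<bar> - u\<^sup>2 / 2))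
    \<and> \<bar>u - wave x z u\<bar> \<le> u\<^sup>2 / 2 * (\<bar>u\<bar> + 49/200)"
  proof (cases "0 \<le> u")
    case True
    note b = atom_bounds_half_line[OF assms True]
    show ?thesis unfolding abs_of_nonneg[OF True] by (intro conjI impI b) assumption+
  next
    case False
    have u: "0 \<le> - u" and sw: "0 \<le> z" "0 \<le> x" "0 < z + x" "z + x \<le> 19/80"
      using False assms by auto
    note b = atom_bounds_half_line[OF sw u]
    have r: "bump z x (- u) = bump x z u" "bump1 z x (- u) = - bump1 x z u"
      "bump2 z x (- u) = bump2 x z u" "wave z x (- u) = - wave x z u"
      "wave1 z x (- u) = wave1 x z u" "wave2 z x (- u) = - wave2 x z u"
      by (simp_all add: atoms_reflect)
    have a: "\<bar>u\<bar> = - u" using False by simp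
    have d: "\<bar>- u - wave z x (- u)\<bar> = \<bar>u - wave x z u\<bar>" by (simp add: r abs_if)
    show ?thesis unfolding a
      by (intro conjI impI b[unfolded r abs_minus_cancel power2_minus d[unfolded r]]) assumption+
  qed
  then show "bump x z u \<le> exp (- (49/100 * u\<^sup>2))"
    "1 \<le> \<bar>u\<bar> \<Longrightarrow> \<bar>bump1 x z u\<bar> \<le> \<bar>u\<bar> * exp (- (49/100 * u\<^sup>2))"
    "1 \<le> \<bar>u\<bar> \<Longrightarrow> \<bar>bump2 x z u\<bar> \<le> u\<^sup>2 * exp (- (49/100 * u\<^sup>2))"
    "\<bar>wave x z u\<bar> \<le> \<bar>u\<bar> * exp (19/80 * \<bar>u\<bar> - u\<^sup>2 / 2)"
    "1 \<le> \<bar>u\<bar> \<Longrightarrow> \<bar>wave1 x z u\<bar> \<le> u\<^sup>2 * exp (19/80 * \<bar>u\<bar> - u\<^sup>2 / 2)"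
    "3/2 \<le> \<bar>u\<bar> \<Longrightarrow> \<bar>wave2 x z u\<bar> \<le> \<bar>u\<bar> ^ 3 * exp (19/80 * \<bar>u\<bar> - u\<^sup>2 / 2)"
    "\<bar>u - wave x z u\<bar> \<le> u\<^sup>2 / 2 * (\<bar>u\<bar> + 49/200)" by blast+
  show "\<bar>wave x z u\<bar> \<le> 4/5"
    using * exp_wave_envelope[of "\<bar>u\<bar>"] by (simp only: power2_abs) linarith
qed

section \<open>Sums over separated sets\<close>

definition separated :: "real \<Rightarrow> real set \<Rightarrow> bool" where
  "separated \<delta> A \<longleftrightarrow> (\<forall>a\<in>A. \<forall>b\<in>A. a \<noteq> b \<longrightarrow> \<delta> \<le> \<bar>a - b\<bar>)"

lemma separatedD: "separated \<delta> A \<Longrightarrow> a \<in> A \<Longrightarrow> b \<in> A \<Longrightarrow> a \<noteq> b \<Longrightarrow> \<delta> \<le> \<bar>a - b\<bar>"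
  by (auto simp: separated_def)

lemma separated_subset: "separated \<delta> A \<Longrightarrow> B \<subseteq> A \<Longrightarrow> separated \<delta> B"
  by (auto simp: separated_def)

text \<open>A geometric series with ratio 1/40 has sum 40/39; this is the origin of the factor
  103/100 in the sums below.\<close>

lemma exp_minus_15_4: "exp (- (15/4)) \<le> (1 / 40 :: real)"
  by (rule exp_minus_le[where y = "3/8" and d = "14549/10000" and m = 10]) (simp_all add: power_divide)

text \<open>Sorted from the left, the points are at least 15/4 apart, so a geometric series
  dominates. The induction varies the lower bound \<open>r1\<close> for the distances, since the
  tail has to be compared with the point just removed.\<close>

lemma sum_separated_right:
  fixes f :: "real \<Rightarrow> real"
  assumes "finite A" "separated (15/4) A" "\<And>a. a \<in> A \<Longrightarrow> r0 \<le> a - p" "0 \<le> F"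
    and f: "\<And>r. r0 \<le> r \<Longrightarrow> f r \<le> F * exp (- (r - r0))"
  shows "(\<Sum>a\<in>A. f (a - p)) \<le> 103/100 * F"
proof -
  have "(\<Sum>a\<in>A. f (a - p)) \<le> 103/100 * F * exp (- (r1 - r0))"
    if "\<forall>a\<in>A. r1 \<le> a - p" "r0 \<le> r1" for r1
    using assms(1,2) that
  proof (induction A arbitrary: r1 rule: finite_linorder_min_induct)
    case empty
    then show ?case using \<open>0 \<le> F\<close> by simp
  next
    case (insert b A)
    define g where "g = F * exp (- (b - p - r0))"
    have g: "0 \<le> g" using \<open>0 \<le> F\<close> by (simp add: g_def)
    have bp: "r1 \<le> b - p" using insert.prems by simp
    have "(\<Sum>a\<in>A. f (a - p)) \<le> 103/100 * F * exp (- (b - p + (15/4) - r0))"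
    proof (rule insert.IH)
      show "separated (15/4) A" using insert.prems by (auto simp: separated_def)
      show "\<forall>a\<in>A. b - p + 15/4 \<le> a - p"
      proof
        fix a assume a: "a \<in> A"
        then have "b < a" using insert.hyps by auto
        moreover have "15/4 \<le> \<bar>a - b\<bar>"
          by (rule separatedD[OF insert.prems(1)]) (use a \<open>b < a\<close> in auto)
        ultimately show "b - p + 15/4 \<le> a - p" by linarith
      qed
      show "r0 \<le> b - p + 15/4" using insert.prems bp by simp
    qed
    also have "- (b - p + (15/4) - r0) = - (b - p - r0) + - (15/4)" by simp
    also have "103/100 * F * exp (- (b - p - r0) + - (15/4)) = 103/100 * g * exp (- (15/4))"
      by (simp only: exp_add g_def mult.assoc)
    also have "\<dots> \<le> 103/100 * g * (1 / 40)"
      using g by (intro mult_left_mono exp_minus_15_4) auto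
    finally have "(\<Sum>a\<in>A. f (a - p)) \<le> 3/100 * g" using g by simp
    moreover have "f (b - p) \<le> g" unfolding g_def by (rule f) (use bp insert.prems in simp)
    moreover have "b \<notin> A" using insert.hyps by auto
    ultimately have "(\<Sum>a\<in>insert b A. f (a - p)) \<le> 103/100 * g" using insert.hyps by simp
    also have "g \<le> F * exp (- (r1 - r0))"
      unfolding g_def using bp \<open>0 \<le> F\<close> by (intro mult_left_mono) auto
    finally show ?case by simp
  qed
  from this[of r0] assms(3) show ?thesis by simp
qed

lemma sum_separated_two_sided:
  fixes f :: "real \<Rightarrow> real"
  assumes A: "finite A" "separated (15/4) A"
    and r: "\<And>a. a \<in> A \<Longrightarrow> p \<le> a \<Longrightarrow> r1 \<le> a - p"
    and l: "\<And>a. a \<in> A \<Longrightarrow> a < p \<Longrightarrow> r2 \<le> p - a"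
    and F1: "\<And>r. r1 \<le> r \<Longrightarrow> f r \<le> F1 * exp (- (r - r1))" "0 \<le> F1"
    and F2: "\<And>r. r2 \<le> r \<Longrightarrow> f r \<le> F2 * exp (- (r - r2))" "0 \<le> F2"
  shows "(\<Sum>a\<in>A. f \<bar>p - a\<bar>) \<le> 103/100 * (F1 + F2)"
proof -
  define R L where "R = {a\<in>A. p \<le> a}" and "L = {a\<in>A. a < p}"
  have "A = R \<union> L" "R \<inter> L = {}" "finite R" "finite L" using A by (auto simp: R_def L_def)
  then have "(\<Sum>a\<in>A. f \<bar>p - a\<bar>) = (\<Sum>a\<in>R. f \<bar>p - a\<bar>) + (\<Sum>a\<in>L. f \<bar>p - a\<bar>)"
    by (simp add: sum.union_disjoint)
  also have "(\<Sum>a\<in>R. f \<bar>p - a\<bar>) = (\<Sum>a\<in>R. f (a - p))"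
    by (rule sum.cong) (auto simp: R_def)
  also have "\<dots> \<le> 103/100 * F1"
    by (rule sum_separated_right[where ?r0.0 = r1])
      (use A r F1 \<open>finite R\<close> separated_subset[OF A(2), of R] in \<open>auto simp: R_def\<close>)
  also have "(\<Sum>a\<in>L. f \<bar>p - a\<bar>) = (\<Sum>a\<in>uminus ` L. f (a - (- p)))"
    by (subst sum.reindex) (auto simp: L_def intro!: sum.cong)
  also have "\<dots> \<le> 103/100 * F2"
  proof (rule sum_separated_right[where ?r0.0 = r2])
    show "separated (15/4) (uminus ` L)"
      using separated_subset[OF A(2), of L] by (auto simp: separated_def L_def abs_minus_commute)
    show "r2 \<le> a - (- p)" if "a \<in> uminus ` L" for a using that l by (auto simp: L_def)
  qed (use F2 \<open>finite L\<close> in auto)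
  finally show ?thesis by (simp add: algebra_simps)
qed

text \<open>
  At most one point of \<open>A\<close> is closer than \<open>15/8\<close> to \<open>p\<close>, and apart from the nearest neighbours on both
  sides all points have distance at least \<open>15/4\<close>.
\<close>

lemma sum_separated_bounded:
  fixes f :: "real \<Rightarrow> real"
  assumes A: "finite A" "separated (15/4) A"
    and M: "\<And>u. f u \<le> M" "0 \<le> M"
    and M': "\<And>u. (15/8) \<le> \<bar>u\<bar> \<Longrightarrow> f u \<le> M'" "0 \<le> M'"
    and F: "\<And>u. (15/4) \<le> \<bar>u\<bar> \<Longrightarrow> f u \<le> F * exp (- (\<bar>u\<bar> - (15/4)))" "0 \<le> F"
  shows "(\<Sum>a\<in>A. f (p - a)) \<le> M + M' + 103/50 * F"
proof -
  define R L where "R = {a\<in>A. p \<le> a}" and "L = {a\<in>A. a < p}"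
  have fin: "finite R" "finite L" using A by (auto simp: R_def L_def)
  define E where "E = (if R = {} then {} else {Min R}) \<union> (if L = {} then {} else {Max L})"
  have EA: "E \<subseteq> A" using Min_in[OF fin(1)] Max_in[OF fin(2)] by (auto simp: E_def R_def L_def)
  have "(\<Sum>a\<in>A. f (p - a)) = (\<Sum>a\<in>A - E. f (p - a)) + (\<Sum>a\<in>E. f (p - a))"
    by (rule sum.subset_diff[OF EA A(1)])
  moreover have "(\<Sum>a\<in>A - E. f (p - a)) \<le> (\<Sum>a\<in>A - E. F * exp (- (\<bar>p - a\<bar> - (15/4))))
      \<and> (\<Sum>a\<in>A - E. F * exp (- (\<bar>p - a\<bar> - (15/4)))) \<le> 103/100 * (F + F)"
  proof
    have right: "15/4 \<le> a - p" if a: "a \<in> A - E" "p \<le> a" for a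
    proof -
      have aR: "a \<in> R" using a by (auto simp: R_def)
      then have "R \<noteq> {}" by auto
      then have m: "Min R \<in> R" "Min R \<le> a" "a \<noteq> Min R" using fin a aR by (auto simp: E_def)
      then have "15/4 \<le> \<bar>a - Min R\<bar>" using a by (intro separatedD[OF A(2)]) (auto simp: R_def)
      then show ?thesis using m by (auto simp: R_def)
    qed
    have left: "15/4 \<le> p - a" if a: "a \<in> A - E" "a < p" for a
    proof -
      have aL: "a \<in> L" using a by (auto simp: L_def)
      then have "L \<noteq> {}" by auto
      then have m: "Max L \<in> L" "a \<le> Max L" "a \<noteq> Max L" using fin a aL by (auto simp: E_def)
      then have "15/4 \<le> \<bar>a - Max L\<bar>" using a by (intro separatedD[OF A(2)]) (auto simp: L_def)
      then show ?thesis using m by (auto simp: L_def)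
    qed
    show "(\<Sum>a\<in>A - E. f (p - a)) \<le> (\<Sum>a\<in>A - E. F * exp (- (\<bar>p - a\<bar> - (15/4))))"
    proof (rule sum_mono)
      fix a assume a: "a \<in> A - E"
      show "f (p - a) \<le> F * exp (- (\<bar>p - a\<bar> - (15/4)))"
        by (rule F(1)) (use left[OF a] right[OF a] in linarith)
    qed
    show "(\<Sum>a\<in>A - E. F * exp (- (\<bar>p - a\<bar> - (15/4)))) \<le> 103/100 * (F + F)"
      by (rule sum_separated_two_sided[where ?r1.0 = "15/4" and ?r2.0 = "15/4"])
        (use A F left right separated_subset[OF A(2), of "A - E"] in auto)
  qed
  moreover have "(\<Sum>a\<in>E. f (p - a)) \<le> M + M'"
  proof (cases "R = {} \<or> L = {}")
    case True
    then show ?thesis using M M'(2) by (auto simp: E_def intro: add_increasing2)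
  next
    case False
    then have m: "Min R \<in> R" "Max L \<in> L" using fin by auto
    then have ml: "Max L < Min R" "p \<le> Min R" "Max L < p" by (auto simp: R_def L_def)
    then have "15/4 \<le> \<bar>Min R - Max L\<bar>" using m by (intro separatedD[OF A(2)]) (auto simp: R_def L_def)
    then have "15/8 \<le> \<bar>p - Min R\<bar> \<or> (15/8) \<le> \<bar>p - Max L\<bar>" using ml by linarith
    then have "f (p - Min R) + f (p - Max L) \<le> M + M'"
      using M(1) M'(1) by (smt (verit))
    moreover have "(\<Sum>a\<in>E. f (p - a)) = f (p - Min R) + f (p - Max L)"
      using False ml by (simp add: E_def)
    ultimately show ?thesis by simp
  qed
  ultimately show ?thesis by simp
qed

text \<open>\<open>p\<close> lies on one side of its nearest point \<open>c\<close>. Every further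
  point on the side of \<open>c\<close> is at least 15/4 away from \<open>p\<close>; only on the
  opposite side can the distance drop to \<open>r0\<close>.\<close>

lemma sum_other_points:
  fixes f :: "real \<Rightarrow> real"
  assumes A: "finite A" "separated (15/4) A" "c \<in> A"
    and near: "\<And>k. k \<in> A \<Longrightarrow> \<bar>p - c\<bar> \<le> \<bar>p - k\<bar>"
    and r0: "\<And>k. k \<in> A - {c} \<Longrightarrow> r0 \<le> \<bar>p - k\<bar>"
    and F1: "\<And>r. r0 \<le> r \<Longrightarrow> f r \<le> F1 * exp (- (r - r0))" "0 \<le> F1"
    and F2: "\<And>r. (15/4) \<le> r \<Longrightarrow> f r \<le> F2 * exp (- (r - (15/4)))" "0 \<le> F2"
  shows "(\<Sum>k\<in>A - {c}. f \<bar>p - k\<bar>) \<le> 103/100 * (F1 + F2)"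
proof -
  have fin: "finite (A - {c})" "separated (15/4) (A - {c})"
    using A separated_subset[OF A(2), of "A - {c}"] by auto
  have sep: "15/4 \<le> \<bar>k - c\<bar>" if "k \<in> A - {c}" for k
    using that A by (intro separatedD[OF A(2)]) auto
  show ?thesis
  proof (cases "c \<le> p")
    case True
    have "15/4 \<le> p - k" if "k \<in> A - {c}" "k < p" for k
      using near[of k] sep[of k] that True by auto
    with sum_separated_two_sided[OF fin, of p r0 "15/4" f F1 F2] F1 F2 r0 show ?thesis
      by fastforce
  next
    case False
    have "15/4 \<le> k - p" if "k \<in> A - {c}" "p \<le> k" for k
      using near[of k] sep[of k] that False by auto
    with sum_separated_two_sided[OF fin, of p "15/4" r0 f F2 F1] F1 F2 r0 show ?thesis
      by (fastforce simp: add.commute)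
  qed
qed

text \<open>Iteration in the maximum norm: successive differences are at most
  \<open>\<beta> * (1/2) ^ n\<close>, so the iterates converge; at a component of maximal modulus
  \<open>m\<close> the limit equation gives \<open>m \<le> \<beta> + m / 2\<close>.\<close>

lemma contraction_fixpoint:
  fixes M :: "'i \<Rightarrow> 'i \<Rightarrow> real" and b :: "'i \<Rightarrow> real"
  assumes J: "finite J" and row: "\<And>j. j \<in> J \<Longrightarrow> (\<Sum>k\<in>J. \<bar>M j k\<bar>) \<le> 1/2"
    and b: "\<And>j. j \<in> J \<Longrightarrow> \<bar>b j\<bar> \<le> \<beta>"
  obtains x where "\<And>j. j \<in> J \<Longrightarrow> x j = b j + (\<Sum>k\<in>J. M j k * x k)"
    and "\<And>j. j \<in> J \<Longrightarrow> \<bar>x j\<bar> \<le> 2 * \<beta>"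
proof (cases "J = {}")
  case True
  then show ?thesis using that by auto
next
  case False
  then have \<beta>: "0 \<le> \<beta>" using b by (smt (verit) ex_in_conv abs_ge_zero)
  have step: "\<bar>\<Sum>k\<in>J. M j k * v k\<bar> \<le> 1/2 * D"
    if "j \<in> J" "\<And>k. k \<in> J \<Longrightarrow> \<bar>v k\<bar> \<le> D" "0 \<le> D" for j v D
  proof -
    have "\<bar>\<Sum>k\<in>J. M j k * v k\<bar> \<le> (\<Sum>k\<in>J. \<bar>M j k\<bar> * D)"
      using that by (intro order_trans[OF sum_abs] sum_mono) (auto simp: abs_mult intro: mult_left_mono)
    also have "\<dots> \<le> 1/2 * D"
      using row[OF that(1)] that(3) by (simp only: sum_distrib_right[symmetric] mult_right_mono)
    finally show ?thesis .
  qed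
  define X where "X = rec_nat b (\<lambda>_ v j. b j + (\<Sum>k\<in>J. M j k * v k))"
  have X: "X 0 = b" "X (Suc n) j = b j + (\<Sum>k\<in>J. M j k * X n k)" for n j
    by (simp_all add: X_def)
  have diff: "\<bar>X (Suc n) j - X n j\<bar> \<le> \<beta> * (1/2) ^ n" if "j \<in> J" for n j
    using that
  proof (induction n arbitrary: j)
    case 0
    then show ?case using step[of j b \<beta>] b \<beta> by (simp add: X)
  next
    case (Suc n)
    have "X (Suc (Suc n)) j - X (Suc n) j = (\<Sum>k\<in>J. M j k * (X (Suc n) k - X n k))"
      by (simp add: X(2)[of "Suc n"] X(2)[of n j] right_diff_distrib sum_subtractf)
    also have "\<bar>\<dots>\<bar> \<le> 1/2 * (\<beta> * (1/2) ^ n)"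
      by (rule step) (use Suc \<beta> in auto)
    finally show ?case by (simp add: mult_ac)
  qed
  have conv: "convergent (\<lambda>n. X n j)" if "j \<in> J" for j
  proof -
    have "summable (\<lambda>n. X (Suc n) j - X n j)"
      by (rule summable_comparison_test'[where g = "\<lambda>n. \<beta> * (1/2) ^ n" and N = 0])
        (use diff[OF that] in \<open>auto intro!: summable_mult summable_geometric\<close>)
    then have "convergent (\<lambda>n. \<Sum>i<n. X (Suc i) j - X i j)"
      by (simp add: summable_iff_convergent)
    then have "convergent (\<lambda>n. X n j - X 0 j)"
      by (simp add: sum_lessThan_telescope[of "\<lambda>n. X n j"])
    then have "convergent (\<lambda>n. (X n j - X 0 j) + X 0 j)"
      by (intro convergent_add convergent_const)
    then show ?thesis by simp
  qed
  define x where "x j = lim (\<lambda>n. X n j)" for j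
  have lim: "(\<lambda>n. X n j) \<longlonglongrightarrow> x j" if "j \<in> J" for j
    using conv[OF that] by (simp add: x_def convergent_LIMSEQ_iff)
  have eq: "x j = b j + (\<Sum>k\<in>J. M j k * x k)" if "j \<in> J" for j
  proof (rule LIMSEQ_unique)
    show "(\<lambda>n. X (Suc n) j) \<longlonglongrightarrow> x j" using lim[OF that] by (rule LIMSEQ_Suc)
    show "(\<lambda>n. X (Suc n) j) \<longlonglongrightarrow> b j + (\<Sum>k\<in>J. M j k * x k)"
      unfolding X by (intro tendsto_intros lim)
  qed
  define m where "m = Max ((\<lambda>j. \<bar>x j\<bar>) ` J)"
  have m: "\<bar>x j\<bar> \<le> m" if "j \<in> J" for j using that J by (simp add: m_def)
  have "m \<in> (\<lambda>j. \<bar>x j\<bar>) ` J" unfolding m_def using J False by (intro Max_in) auto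
  then obtain j where j: "j \<in> J" "m = \<bar>x j\<bar>" by auto
  have "\<bar>\<Sum>k\<in>J. M j k * x k\<bar> \<le> 1/2 * m" by (rule step) (use j m in auto)
  then have "m \<le> 2 * \<beta>" using eq[OF j(1)] b[OF j(1)] j(2) by linarith
  then show ?thesis using that[of x] eq m by force
qed

section \<open>The dual certificate\<close>

text \<open>A common bound at distance \<open>r\<close> for \<open>m\<close>-th derivatives of a
  bump with coefficient at most \<open>A\<close> and a wave with coefficient at most
  \<open>B\<close>; the wave costs one more power of \<open>r\<close>.\<close>

definition envelope :: "real \<Rightarrow> real \<Rightarrow> nat \<Rightarrow> real \<Rightarrow> real" where
  "envelope A B m r = r ^ m * (A * exp (- (49/100 * r\<^sup>2)) + B * (r * exp (19/80 * r - r\<^sup>2 / 2)))"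

lemma envelope_nonneg: "0 \<le> A \<Longrightarrow> 0 \<le> B \<Longrightarrow> 0 \<le> r \<Longrightarrow> 0 \<le> envelope A B m r"
  by (simp add: envelope_def)

lemma envelope_tail:
  assumes "0 < r0" "r0 \<le> r" "0 \<le> A" "0 \<le> B"
    and "real m / r0 + 1 \<le> 49/50 * r0" "real (Suc m) / r0 + 19/80 + 1 \<le> r0"
  shows "envelope A B m r \<le> envelope A B m r0 * exp (- (r - r0))"
proof -
  have split: "envelope A B m s = A * (s ^ m * exp (0 * s - (49/100) * s\<^sup>2))
      + B * (s ^ Suc m * exp (19/80 * s - 1/2 * s\<^sup>2))" for s
    by (simp add: envelope_def algebra_simps)
  have "s ^ m * exp (0 * s - (49/100) * s\<^sup>2) \<le> r0 ^ m * exp (0 * r0 - (49/100) * r0\<^sup>2) * exp (- (s - r0))"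
    if "r0 \<le> s" for s
    by (rule power_times_gaussian_tail) (use assms that in auto)
  moreover have "s ^ Suc m * exp (19/80 * s - 1/2 * s\<^sup>2)
      \<le> r0 ^ Suc m * exp (19/80 * r0 - 1/2 * r0\<^sup>2) * exp (- (s - r0))" if "r0 \<le> s" for s
    by (rule power_times_gaussian_tail) (use assms that in auto)
  ultimately have "envelope A B m r \<le> A * (r0 ^ m * exp (0 * r0 - (49/100) * r0\<^sup>2) * exp (- (r - r0)))
      + B * (r0 ^ Suc m * exp (19/80 * r0 - 1/2 * r0\<^sup>2) * exp (- (r - r0)))"
    unfolding split[of r] using assms by (intro add_mono mult_left_mono) auto
  also have "\<dots> = envelope A B m r0 * exp (- (r - r0))"
    unfolding split[of r0] by (simp only: distrib_right mult.assoc)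
  finally show ?thesis .
qed

lemma envelope_le:
  assumes "exp (- (49/100 * r\<^sup>2)) \<le> c" "exp (19/80 * r - r\<^sup>2 / 2) \<le> d" "0 \<le> A" "0 \<le> B" "0 \<le> r"
  shows "envelope A B m r \<le> r ^ m * (A * c + B * (r * d))"
  unfolding envelope_def using assms by (intro mult_left_mono add_mono) auto

lemma exp_le_rewrite: "exp (- a) \<le> c \<Longrightarrow> b = - a \<Longrightarrow> exp b \<le> (c :: real)"
  by simp

text \<open>The value at the full separation. The number 81/10000 is
  \<open>15/4 * (27/12500)\<close>, which includes the additional power of \<open>r\<close> of the
  wave.\<close>

lemma envelope_3_75:
  assumes "0 \<le> A" "0 \<le> B"
  shows "envelope A B m (15/4) \<le> (15/4) ^ m * (A * (51/50000) + B * (81/10000))"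
proof -
  have "exp (- (441/64)) \<le> ((51/50000) :: real)"
    by (rule exp_minus_le[where y = "2153/5000" and d = "38451/25000" and m = 16]) (simp_all add: power_divide)
  moreover have "exp (- (393/64)) \<le> ((27/12500) :: real)"
    by (rule exp_minus_le[where y = "5117/10000" and d = "8339/5000" and m = 12]) (simp_all add: power_divide)
  ultimately have "envelope A B m (15/4) \<le> (15/4) ^ m * (A * (51/50000) + B * (15/4 * (27/12500)))"
    using assms by (intro envelope_le) (auto elim!: exp_le_rewrite simp: power_divide)
  then show ?thesis by simp
qed

text \<open>The radii here and in the next three lemmas are \<open>15/4 - 4/5\<close>,
  \<open>15/4 - 1\<close>, \<open>15/4 - 13/10\<close> and \<open>15/8\<close>: least distances to
  the other spikes in four ranges around the nearest one. The numbers 11/10 and 7/50 are the bounds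
  on bump and wave coefficients that the linear system will yield.\<close>

lemma envelope_2_95: "envelope (11/10) (7/50) 2 (59/20) \<le> 457/2000"
proof -
  have "exp (- (170569/40000)) \<le> ((141/10000) :: real)"
    by (rule exp_minus_le[where y = "533/1000" and d = "4259/2500" and m = 8]) (simp_all add: power_divide)
  moreover have "exp (- (5841/1600)) \<le> ((13/500) :: real)"
    by (rule exp_minus_le[where y = "18253/50000" and d = "2881/2000" and m = 10]) (simp_all add: power_divide)
  ultimately have "envelope (11/10) (7/50) 2 (59/20) \<le> (59/20) ^ 2 * (11/10 * (141/10000) + 7/50 * (59/20 * (13/500)))"
    by (intro envelope_le) (auto elim!: exp_le_rewrite simp: power_divide)
  then show ?thesis by (simp add: power_divide)
qed

lemma envelope_2_75: "envelope (11/10) (7/50) 0 (11/4) \<le> 441/10000"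
proof -
  have "exp (- (5929/1600)) \<le> ((247/10000) :: real)"
    by (rule exp_minus_le[where y = "386/625" and d = "2317/1250" and m = 6]) (simp_all add: power_divide)
  moreover have "exp (- (1001/320)) \<le> ((439/10000) :: real)"
    by (rule exp_minus_le[where y = "5213/10000" and d = "8419/5000" and m = 6]) (simp_all add: power_divide)
  ultimately have "envelope (11/10) (7/50) 0 (11/4) \<le> (11/4) ^ 0 * (11/10 * (247/10000) + 7/50 * (11/4 * (439/10000)))"
    by (intro envelope_le) (auto elim!: exp_le_rewrite simp: power_divide)
  then show ?thesis by simp
qed

lemma envelope_2_45: "envelope (11/10) (7/50) 0 (49/20) \<le> 111/1250"
proof -
  have "exp (- (117649/40000)) \<le> ((529/10000) :: real)"
    by (rule exp_minus_le[where y = "7353/12500" and d = "11251/6250" and m = 5]) (simp_all add: power_divide)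
  moreover have "exp (- (3871/1600)) \<le> ((891/10000) :: real)"
    by (rule exp_minus_le[where y = "2419/5000" and d = "81099/50000" and m = 5]) (simp_all add: power_divide)
  ultimately have "envelope (11/10) (7/50) 0 (49/20) \<le> (49/20) ^ 0 * (11/10 * (529/10000) + 7/50 * (49/20 * (891/10000)))"
    by (intro envelope_le) (auto elim!: exp_le_rewrite simp: power_divide)
  then show ?thesis by simp
qed

lemma envelope_1_875: "envelope (11/10) (7/50) 0 (15/8) \<le> 107/400"
proof -
  have "exp (- (441/256)) \<le> ((447/2500) :: real)"
    by (rule exp_minus_le[where y = "2871/5000" and d = "17751/10000" and m = 3]) (simp_all add: power_divide)
  moreover have "exp (- (21/16)) \<le> ((2693/10000) :: real)"
    by (rule exp_minus_le[where y = "7/16" and d = "7743/5000" and m = 3]) (simp_all add: power_divide)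
  ultimately have "envelope (11/10) (7/50) 0 (15/8) \<le> (15/8) ^ 0 * (11/10 * (447/2500) + 7/50 * (15/8 * (2693/10000)))"
    by (intro envelope_le) (auto elim!: exp_le_rewrite simp: power_divide)
  then show ?thesis by simp
qed

text \<open>The Gaussian width is the unit of length; \<open>x k\<close> and \<open>z k\<close> are
  the distances from spike \<open>k\<close> to the samples on its left and right. No distance
  between \<open>T\<close> and \<open>N\<close> is assumed.\<close>

locale certificate_setup =
  fixes T N :: "real set" and x z :: "real \<Rightarrow> real" and \<tau> :: real and \<epsilon> \<delta> :: "real \<Rightarrow> real"
  assumes T: "finite T" "separated (15/4) T" and N: "finite N" "separated (15/4) N"
    and \<tau>: "13/200 \<le> \<tau>" "\<tau> \<le> 19/80"
    and xz: "\<And>k. k \<in> T \<Longrightarrow> 0 \<le> x k \<and> 0 \<le> z k \<and> x k + z k = \<tau>"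
    and \<epsilon>: "\<And>k. k \<in> T \<Longrightarrow> \<bar>\<epsilon> k\<bar> = 1" and \<delta>: "\<And>k. k \<in> N \<Longrightarrow> \<bar>\<delta> k\<bar> = 1"
begin

text \<open>Parametrised by \<open>f\<close> so that a derivative of the corruption part has the
  same form, with \<open>f\<close> replaced by its derivative; \<open>others\<close> is parametrised
  by its atoms for the same reason.\<close>

definition noise :: "(real \<Rightarrow> real) \<Rightarrow> real \<Rightarrow> real" where
  "noise f t = (\<Sum>k\<in>N. \<delta> k * second_diff \<tau> f (t - k))"

definition others :: "(real \<Rightarrow> real) \<Rightarrow> (real \<Rightarrow> real) \<Rightarrow> (real \<Rightarrow> real \<Rightarrow> real \<Rightarrow> real) \<Rightarrow>
    (real \<Rightarrow> real \<Rightarrow> real \<Rightarrow> real) \<Rightarrow> real \<Rightarrow> real \<Rightarrow> real" where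
  "others \<alpha> \<beta> \<phi> \<psi> c t = (\<Sum>k\<in>T - {c}. \<alpha> k * \<phi> (x k) (z k) (t - k) + \<beta> k * \<psi> (x k) (z k) (t - k))"

lemma x_plus_z: "k \<in> T \<Longrightarrow> 0 \<le> x k \<and> 0 \<le> z k \<and> 0 < x k + z k \<and> x k + z k \<le> 19/80"
  using xz[of k] \<tau> by linarith

lemma \<tau>_sq: "\<tau>\<^sup>2 \<le> 113/2000"
proof -
  have "\<tau>\<^sup>2 \<le> (19/80)\<^sup>2" using \<tau> by (intro power_mono) auto
  also have "\<dots> \<le> 113/2000" by (simp add: power2_eq_square)
  finally show ?thesis .
qed

lemma noise_le:
  assumes "\<And>u. \<bar>second_diff \<tau> f u\<bar> \<le> M * \<tau>\<^sup>2"
    and "\<And>u. (15/8) \<le> \<bar>u\<bar> \<Longrightarrow> \<bar>second_diff \<tau> f u\<bar> \<le> M' * \<tau>\<^sup>2"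
    and "\<And>u. (15/4) \<le> \<bar>u\<bar> \<Longrightarrow> \<bar>second_diff \<tau> f u\<bar> \<le> F * \<tau>\<^sup>2 * exp (- (\<bar>u\<bar> - (15/4)))"
    and "0 \<le> M" "0 \<le> M'" "0 \<le> F" "M + M' + 103/50 * F \<le> c"
  shows "\<bar>noise f t\<bar> \<le> c * \<tau>\<^sup>2"
proof -
  have "\<bar>noise f t\<bar> \<le> (\<Sum>k\<in>N. \<bar>second_diff \<tau> f (t - k)\<bar>)"
    unfolding noise_def using \<delta> by (intro order_trans[OF sum_abs] sum_mono) (simp add: abs_mult)
  also have "\<dots> \<le> M * \<tau>\<^sup>2 + M' * \<tau>\<^sup>2 + 103/50 * (F * \<tau>\<^sup>2)"
    by (rule sum_separated_bounded[OF N]) (use assms in auto)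
  also have "\<dots> = (M + M' + 103/50 * F) * \<tau>\<^sup>2" by (simp only: distrib_right mult.assoc)
  also have "\<dots> \<le> c * \<tau>\<^sup>2" using assms by (intro mult_right_mono) auto
  finally show ?thesis .
qed

text \<open>Each factor collects one corruption at arbitrary distance, one at distance at least
  15/8, and the tails on both sides. With \<open>\<tau>\<^sup>2 \<le> 113/2000\<close> the bounds
  become the 427/5000, 1187/10000 and 599/2000 used later.\<close>

lemma noise_bounds:
  "\<bar>noise gauss t\<bar> \<le> 151/100 * \<tau>\<^sup>2" "\<bar>noise gauss1 t\<bar> \<le> 21/10 * \<tau>\<^sup>2" "\<bar>noise gauss2 t\<bar> \<le> 53/10 * \<tau>\<^sup>2"
  by (rule noise_le[of gauss 1 "9/20" "27/1000"] noise_le[of gauss1 "3/2" "2/5" "23/250"]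
      noise_le[of gauss2 3 "8/5" "33/100"];
    use \<tau> second_diff_gauss_bounds[of \<tau>] second_diff_gauss1_bounds[of \<tau>]
      second_diff_gauss2_bounds[of \<tau>] in simp)+

lemma sum_others_le:
  assumes c: "c \<in> T"
    and \<phi>: "\<And>k u. k \<in> T \<Longrightarrow> (3/2) \<le> \<bar>u\<bar> \<Longrightarrow> \<bar>\<phi> (x k) (z k) u\<bar> \<le> \<bar>u\<bar> ^ m * exp (- (49/100 * u\<^sup>2))"
    and \<psi>: "\<And>k u. k \<in> T \<Longrightarrow> (3/2) \<le> \<bar>u\<bar> \<Longrightarrow>
      \<bar>\<psi> (x k) (z k) u\<bar> \<le> \<bar>u\<bar> ^ Suc m * exp (19/80 * \<bar>u\<bar> - u\<^sup>2 / 2)"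
    and near: "\<And>k. k \<in> T \<Longrightarrow> \<bar>t - c\<bar> \<le> \<bar>t - k\<bar>"
    and r0: "\<And>k. k \<in> T - {c} \<Longrightarrow> r0 \<le> \<bar>t - k\<bar>" "3/2 \<le> r0"
      "real m / r0 + 1 \<le> 49/50 * r0" "real (Suc m) / r0 + 19/80 + 1 \<le> r0" and "m \<le> 2"
    and AB: "0 \<le> A" "0 \<le> B"
  shows "(\<Sum>k\<in>T - {c}. A * \<bar>\<phi> (x k) (z k) (t - k)\<bar> + B * \<bar>\<psi> (x k) (z k) (t - k)\<bar>)
    \<le> 103/100 * (envelope A B m r0 + (15/4) ^ m * (A * (51/50000) + B * (81/10000)))"
proof -
  have "(\<Sum>k\<in>T - {c}. A * \<bar>\<phi> (x k) (z k) (t - k)\<bar> + B * \<bar>\<psi> (x k) (z k) (t - k)\<bar>)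
      \<le> (\<Sum>k\<in>T - {c}. envelope A B m \<bar>t - k\<bar>)"
  proof (rule sum_mono)
    fix k assume k: "k \<in> T - {c}"
    define u where "u = t - k"
    have u: "3/2 \<le> \<bar>u\<bar>" using r0(1)[OF k] r0(2) by (simp add: u_def)
    have "A * \<bar>\<phi> (x k) (z k) u\<bar> + B * \<bar>\<psi> (x k) (z k) u\<bar>
        \<le> A * (\<bar>u\<bar> ^ m * exp (- (49/100 * u\<^sup>2))) + B * (\<bar>u\<bar> ^ Suc m * exp (19/80 * \<bar>u\<bar> - u\<^sup>2 / 2))"
      using k u AB by (intro add_mono mult_left_mono \<phi> \<psi>) auto
    also have "\<dots> = envelope A B m \<bar>u\<bar>" by (simp add: envelope_def algebra_simps)
    finally show "A * \<bar>\<phi> (x k) (z k) (t - k)\<bar> + B * \<bar>\<psi> (x k) (z k) (t - k)\<bar>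
        \<le> envelope A B m \<bar>t - k\<bar>" by (simp add: u_def)
  qed
  also have "\<dots> \<le> 103/100 * (envelope A B m r0 + envelope A B m (15/4))"
  proof (rule sum_other_points[OF T c near r0(1)])
    have "m = 0 \<or> m = 1 \<or> m = 2" using \<open>m \<le> 2\<close> by auto
    then have m': "real m / (15/4) + 1 \<le> 49/50 * (15/4)"
      "real (Suc m) / (15/4) + 19/80 + 1 \<le> 15/4" by auto
    show "envelope A B m r \<le> envelope A B m r0 * exp (- (r - r0))" if "r0 \<le> r" for r
      using that r0 AB by (intro envelope_tail) auto
    show "envelope A B m r \<le> envelope A B m (15/4) * exp (- (r - (15/4)))" if "15/4 \<le> r" for r
      using that AB m' by (intro envelope_tail) auto
  qed (use AB r0 in \<open>auto intro!: envelope_nonneg\<close>)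
  also have "\<dots> \<le> 103/100 * (envelope A B m r0 + (15/4) ^ m * (A * (51/50000) + B * (81/10000)))"
    using envelope_3_75[OF AB, of m] by simp
  finally show ?thesis .
qed

lemma others_le:
  assumes c: "c \<in> T"
    and \<phi>: "\<And>k u. k \<in> T \<Longrightarrow> (3/2) \<le> \<bar>u\<bar> \<Longrightarrow> \<bar>\<phi> (x k) (z k) u\<bar> \<le> \<bar>u\<bar> ^ m * exp (- (49/100 * u\<^sup>2))"
    and \<psi>: "\<And>k u. k \<in> T \<Longrightarrow> (3/2) \<le> \<bar>u\<bar> \<Longrightarrow>
      \<bar>\<psi> (x k) (z k) u\<bar> \<le> \<bar>u\<bar> ^ Suc m * exp (19/80 * \<bar>u\<bar> - u\<^sup>2 / 2)"
    and near: "\<And>k. k \<in> T \<Longrightarrow> \<bar>t - c\<bar> \<le> \<bar>t - k\<bar>"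
    and r0: "\<And>k. k \<in> T - {c} \<Longrightarrow> r0 \<le> \<bar>t - k\<bar>" "3/2 \<le> r0"
      "real m / r0 + 1 \<le> 49/50 * r0" "real (Suc m) / r0 + 19/80 + 1 \<le> r0" and "m \<le> 2"
    and AB: "\<And>k. k \<in> T \<Longrightarrow> \<bar>\<alpha> k\<bar> \<le> A \<and> \<bar>\<beta> k\<bar> \<le> B"
  shows "\<bar>others \<alpha> \<beta> \<phi> \<psi> c t\<bar>
    \<le> 103/100 * (envelope A B m r0 + (15/4) ^ m * (A * (51/50000) + B * (81/10000)))"
proof -
  have "0 \<le> A" "0 \<le> B" using AB[OF c] by auto
  have "\<bar>others \<alpha> \<beta> \<phi> \<psi> c t\<bar>
      \<le> (\<Sum>k\<in>T - {c}. A * \<bar>\<phi> (x k) (z k) (t - k)\<bar> + B * \<bar>\<psi> (x k) (z k) (t - k)\<bar>)"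
    unfolding others_def
  proof (intro order_trans[OF sum_abs] sum_mono)
    fix k assume "k \<in> T - {c}"
    then have "\<bar>\<alpha> k\<bar> * \<bar>\<phi> (x k) (z k) (t - k)\<bar> \<le> A * \<bar>\<phi> (x k) (z k) (t - k)\<bar>"
      "\<bar>\<beta> k\<bar> * \<bar>\<psi> (x k) (z k) (t - k)\<bar> \<le> B * \<bar>\<psi> (x k) (z k) (t - k)\<bar>"
      using AB[of k] by (auto intro!: mult_right_mono)
    then show "\<bar>\<alpha> k * \<phi> (x k) (z k) (t - k) + \<beta> k * \<psi> (x k) (z k) (t - k)\<bar>
        \<le> A * \<bar>\<phi> (x k) (z k) (t - k)\<bar> + B * \<bar>\<psi> (x k) (z k) (t - k)\<bar>"
      by (intro order_trans[OF abs_triangle_ineq]) (simp add: abs_mult)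
  qed
  also have "\<dots> \<le> 103/100 * (envelope A B m r0 + (15/4) ^ m * (A * (51/50000) + B * (81/10000)))"
    by (rule sum_others_le) (use assms \<open>0 \<le> A\<close> \<open>0 \<le> B\<close> in auto)
  finally show ?thesis .
qed

lemma far_bounds:
  assumes "k \<in> T" "3/2 \<le> \<bar>u\<bar>"
  shows "\<bar>bump (x k) (z k) u\<bar> \<le> \<bar>u\<bar> ^ 0 * exp (- (49/100 * u\<^sup>2))"
    and "\<bar>bump1 (x k) (z k) u\<bar> \<le> \<bar>u\<bar> ^ 1 * exp (- (49/100 * u\<^sup>2))"
    and "\<bar>bump2 (x k) (z k) u\<bar> \<le> \<bar>u\<bar> ^ 2 * exp (- (49/100 * u\<^sup>2))"
    and "\<bar>wave (x k) (z k) u\<bar> \<le> \<bar>u\<bar> ^ Suc 0 * exp (19/80 * \<bar>u\<bar> - u\<^sup>2 / 2)"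
    and "\<bar>wave1 (x k) (z k) u\<bar> \<le> \<bar>u\<bar> ^ Suc 1 * exp (19/80 * \<bar>u\<bar> - u\<^sup>2 / 2)"
    and "\<bar>wave2 (x k) (z k) u\<bar> \<le> \<bar>u\<bar> ^ Suc 2 * exp (19/80 * \<bar>u\<bar> - u\<^sup>2 / 2)"
proof -
  have 2: "Suc 1 = 2" "Suc 2 = 3" by simp_all
  have 1: "1 \<le> \<bar>u\<bar>" using assms by simp
  from x_plus_z[OF assms(1)] have *: "0 \<le> x k" "0 \<le> z k" "0 < x k + z k" "x k + z k \<le> 19/80" by auto
  note b = atom_bounds[OF *, of u]
  show "\<bar>bump (x k) (z k) u\<bar> \<le> \<bar>u\<bar> ^ 0 * exp (- (49/100 * u\<^sup>2))" using b(1,2) by simp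
  show "\<bar>bump1 (x k) (z k) u\<bar> \<le> \<bar>u\<bar> ^ 1 * exp (- (49/100 * u\<^sup>2))" using b(3)[OF 1] by simp
  show "\<bar>bump2 (x k) (z k) u\<bar> \<le> \<bar>u\<bar> ^ 2 * exp (- (49/100 * u\<^sup>2))" using b(4)[OF 1] by simp
  show "\<bar>wave (x k) (z k) u\<bar> \<le> \<bar>u\<bar> ^ Suc 0 * exp (19/80 * \<bar>u\<bar> - u\<^sup>2 / 2)" using b(5) by simp
  show "\<bar>wave1 (x k) (z k) u\<bar> \<le> \<bar>u\<bar> ^ Suc 1 * exp (19/80 * \<bar>u\<bar> - u\<^sup>2 / 2)"
    using b(6)[OF 1] unfolding 2 by simp
  show "\<bar>wave2 (x k) (z k) u\<bar> \<le> \<bar>u\<bar> ^ Suc 2 * exp (19/80 * \<bar>u\<bar> - u\<^sup>2 / 2)"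
    using b(7)[OF assms(2)] unfolding 2 .
qed

lemma others_at_spike:
  assumes c: "c \<in> T" and AB: "\<And>k. k \<in> T \<Longrightarrow> \<bar>\<alpha> k\<bar> \<le> A \<and> \<bar>\<beta> k\<bar> \<le> B"
  shows "\<bar>others \<alpha> \<beta> bump wave c c\<bar> \<le> 103/50 * (A * (51/50000) + B * (81/10000))"
    and "\<bar>others \<alpha> \<beta> bump1 wave1 c c\<bar> \<le> 309/40 * (A * (51/50000) + B * (81/10000))"
proof -
  have 0: "0 \<le> A" "0 \<le> B" using AB[OF c] by auto
  have sep: "15/4 \<le> \<bar>c - k\<bar>" if "k \<in> T - {c}" for k
    using that c by (intro separatedD[OF T(2)]) auto
  have "\<bar>others \<alpha> \<beta> bump wave c c\<bar>
      \<le> 103/100 * (envelope A B 0 (15/4) + (15/4) ^ 0 * (A * (51/50000) + B * (81/10000)))"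
    by (rule others_le[where \<phi> = bump and \<psi> = wave and m = 0 and ?r0.0 = "15/4"],
        rule c, rule far_bounds(1), assumption+, rule far_bounds(4), assumption+)
      (use sep AB in auto)
  also have "\<dots> \<le> 103/50 * (A * (51/50000) + B * (81/10000))" using envelope_3_75[OF 0, of 0] by simp
  finally show "\<bar>others \<alpha> \<beta> bump wave c c\<bar> \<le> 103/50 * (A * (51/50000) + B * (81/10000))" .
  have "\<bar>others \<alpha> \<beta> bump1 wave1 c c\<bar>
      \<le> 103/100 * (envelope A B 1 (15/4) + (15/4) ^ 1 * (A * (51/50000) + B * (81/10000)))"
    by (rule others_le[where \<phi> = bump1 and \<psi> = wave1 and m = 1 and ?r0.0 = "15/4"],
        rule c, rule far_bounds(2), assumption+, rule far_bounds(5), assumption+)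
      (use sep AB in auto)
  also have "\<dots> \<le> 309/40 * (A * (51/50000) + B * (81/10000))"
    using envelope_3_75[OF 0, of 1] by (simp add: field_simps)
  finally show "\<bar>others \<alpha> \<beta> bump1 wave1 c c\<bar> \<le> 309/40 * (A * (51/50000) + B * (81/10000))" .
qed

lemma system_solution:
  "\<exists>\<alpha> \<beta>. (\<forall>j\<in>T. \<alpha> j = \<epsilon> j - noise gauss j - others \<alpha> \<beta> bump wave j j)
    \<and> (\<forall>j\<in>T. \<beta> j = - noise gauss1 j - others \<alpha> \<beta> bump1 wave1 j j)
    \<and> (\<forall>j\<in>T. \<bar>\<alpha> j\<bar> \<le> 109/50 \<and> \<bar>\<beta> j\<bar> \<le> 109/50)"
proof -
  \<comment> \<open>Unknowns and equations are indexed by a spike and a flag: \<open>False\<close>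
    for bump coefficient and value equation, \<open>True\<close> for wave coefficient and slope
    equation. The diagonal blocks are 0 because bump and wave are normalised at their own
    spike.\<close>
  define M where "M p q = (if fst q = fst p then 0 else
      (let u = fst p - fst q; k = fst q in
        - (if snd p then if snd q then wave1 (x k) (z k) u else bump1 (x k) (z k) u
           else if snd q then wave (x k) (z k) u else bump (x k) (z k) u)))"
    for p q :: "real \<times> bool"
  define b where "b p = (if snd p then - noise gauss1 (fst p) else \<epsilon> (fst p) - noise gauss (fst p))"
    for p :: "real \<times> bool"
  have pairs: "(\<Sum>q\<in>T \<times> UNIV. f q) = (\<Sum>k\<in>T. f (k, False) + f (k, True))"
    for f :: "real \<times> bool \<Rightarrow> real"
  proof -
    have "(\<Sum>q\<in>T \<times> UNIV. f q) = (\<Sum>k\<in>T. \<Sum>c\<in>UNIV. f (k, c))"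
      by (simp add: sum.cartesian_product)
    then show ?thesis by (simp add: UNIV_bool add.commute)
  qed
  have drop: "(\<Sum>k\<in>T. h k) = (\<Sum>k\<in>T - {j}. h k)" if "j \<in> T" "h j = 0" for j and h :: "real \<Rightarrow> real"
    using that T(1) by (simp add: sum.remove)
  have sep: "15/4 \<le> \<bar>c - k\<bar>" if "c \<in> T" "k \<in> T - {c}" for k c
    using that by (intro separatedD[OF T(2)]) auto
  have row: "(\<Sum>q\<in>T \<times> UNIV. \<bar>M p q\<bar>) \<le> 1/2" if p: "p \<in> T \<times> UNIV" for p
  proof -
    obtain j d where jd: "p = (j, d)" "j \<in> T" using p by auto
    have "(\<Sum>q\<in>T \<times> UNIV. \<bar>M p q\<bar>) = (\<Sum>k\<in>T - {j}. \<bar>M p (k, False)\<bar> + \<bar>M p (k, True)\<bar>)"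
      unfolding pairs by (rule drop) (use jd in \<open>auto simp: M_def\<close>)
    also have "\<dots> \<le> 1/2"
    proof (cases d)
      case True
      have "(\<Sum>k\<in>T - {j}. \<bar>M p (k, False)\<bar> + \<bar>M p (k, True)\<bar>)
          = (\<Sum>k\<in>T - {j}. 1 * \<bar>bump1 (x k) (z k) (j - k)\<bar> + 1 * \<bar>wave1 (x k) (z k) (j - k)\<bar>)"
        by (rule sum.cong) (auto simp: M_def jd True)
      also have "\<dots> \<le> 103/100 * (envelope 1 1 1 (15/4) + (15/4) ^ 1 * (1 * (51/50000) + 1 * (81/10000)))"
        by (rule sum_others_le[where \<phi> = bump1 and \<psi> = wave1 and m = 1 and ?r0.0 = "15/4"],
          rule jd(2), rule far_bounds(2), assumption+, rule far_bounds(5), assumption+)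
        (use sep jd in auto)
      also have "\<dots> \<le> 1/2" using envelope_3_75[of 1 1 1] by simp
      finally show ?thesis .
    next
      case False
      have "(\<Sum>k\<in>T - {j}. \<bar>M p (k, False)\<bar> + \<bar>M p (k, True)\<bar>)
          = (\<Sum>k\<in>T - {j}. 1 * \<bar>bump (x k) (z k) (j - k)\<bar> + 1 * \<bar>wave (x k) (z k) (j - k)\<bar>)"
        by (rule sum.cong) (auto simp: M_def jd False)
      also have "\<dots> \<le> 103/100 * (envelope 1 1 0 (15/4) + (15/4) ^ 0 * (1 * (51/50000) + 1 * (81/10000)))"
        by (rule sum_others_le[where \<phi> = bump and \<psi> = wave and m = 0 and ?r0.0 = "15/4"],
          rule jd(2), rule far_bounds(1), assumption+, rule far_bounds(4), assumption+)
        (use sep jd in auto)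
      also have "\<dots> \<le> 1/2" using envelope_3_75[of 1 1 0] by simp
      finally show ?thesis .
    qed
    finally show ?thesis .
  qed
  \<comment> \<open>One bound for both kinds of right-hand side, namely \<open>1 + 9/100\<close>
    from the value equations. The right-hand sides of the slope equations are much smaller, which
    this bound gives away for the moment.\<close>
  have b_le: "\<bar>b p\<bar> \<le> 109/100" if pT: "p \<in> T \<times> UNIV" for p
  proof -
    obtain j d where p: "p = (j, d)" "j \<in> T" using pT by auto
    have "\<bar>noise gauss j\<bar> \<le> 9/100" "\<bar>noise gauss1 j\<bar> \<le> 109/100"
      using noise_bounds(1,2)[of j] \<tau>_sq by linarith+
    moreover have "\<bar>\<epsilon> j - noise gauss j\<bar> \<le> \<bar>\<epsilon> j\<bar> + \<bar>noise gauss j\<bar>" by (rule abs_triangle_ineq4)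
    ultimately have "\<bar>\<epsilon> j - noise gauss j\<bar> \<le> 109/100" "\<bar>- noise gauss1 j\<bar> \<le> 109/100"
      using \<epsilon>[OF p(2)] by simp_all
    then show ?thesis by (cases d) (simp_all add: b_def p)
  qed
  have finJ: "finite (T \<times> (UNIV :: bool set))" using T by simp
  have "\<exists>v. (\<forall>p\<in>T \<times> UNIV. v p = b p + (\<Sum>q\<in>T \<times> UNIV. M p q * v q))
      \<and> (\<forall>p\<in>T \<times> UNIV. \<bar>v p\<bar> \<le> 2 * (109/100))"
    by (rule contraction_fixpoint[of "T \<times> UNIV" M b "109/100"], rule finJ, erule row, erule b_le, blast)
  then obtain v where v: "\<And>p. p \<in> T \<times> UNIV \<Longrightarrow> v p = b p + (\<Sum>q\<in>T \<times> UNIV. M p q * v q)"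
    and v_le: "\<And>p. p \<in> T \<times> UNIV \<Longrightarrow> \<bar>v p\<bar> \<le> 2 * (109/100)" by blast
  define \<alpha> \<beta> where "\<alpha> k = v (k, False)" and "\<beta> k = v (k, True)" for k
  show ?thesis
  proof (rule exI[of _ \<alpha>], rule exI[of _ \<beta>], intro conjI ballI)
    fix j assume j: "j \<in> T"
    have eq: "v (j, d) = b (j, d) + (\<Sum>k\<in>T - {j}. M (j, d) (k, False) * \<alpha> k + M (j, d) (k, True) * \<beta> k)"
      for d
    proof -
      have "v (j, d) = b (j, d) + (\<Sum>q\<in>T \<times> UNIV. M (j, d) q * v q)" using j by (intro v) auto
      also have "(\<Sum>q\<in>T \<times> UNIV. M (j, d) q * v q)
          = (\<Sum>k\<in>T - {j}. M (j, d) (k, False) * \<alpha> k + M (j, d) (k, True) * \<beta> k)"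
        unfolding pairs \<alpha>_def \<beta>_def by (rule drop) (use j in \<open>auto simp: M_def\<close>)
      finally show ?thesis .
    qed
    have "(\<Sum>k\<in>T - {j}. M (j, False) (k, False) * \<alpha> k + M (j, False) (k, True) * \<beta> k)
        = - others \<alpha> \<beta> bump wave j j"
      unfolding others_def sum_negf[symmetric] by (rule sum.cong) (auto simp: M_def)
    then show "\<alpha> j = \<epsilon> j - noise gauss j - others \<alpha> \<beta> bump wave j j"
      using eq[of False] by (simp add: b_def \<alpha>_def)
    have "(\<Sum>k\<in>T - {j}. M (j, True) (k, False) * \<alpha> k + M (j, True) (k, True) * \<beta> k)
        = - others \<alpha> \<beta> bump1 wave1 j j"
      unfolding others_def sum_negf[symmetric] by (rule sum.cong) (auto simp: M_def)
    then show "\<beta> j = - noise gauss1 j - others \<alpha> \<beta> bump1 wave1 j j"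
      using eq[of True] by (simp add: b_def \<beta>_def)
    show "\<bar>\<alpha> j\<bar> \<le> 109/50" "\<bar>\<beta> j\<bar> \<le> 109/50" using v_le[of "(j, False)"] v_le[of "(j, True)"] j
      by (simp_all add: \<alpha>_def \<beta>_def)
  qed
qed

text \<open>The crude bound of the fixed point theorem is improved by reinserting it into the system.\<close>

lemma system_bounds:
  assumes \<alpha>: "\<And>j. j \<in> T \<Longrightarrow> \<alpha> j = \<epsilon> j - noise gauss j - others \<alpha> \<beta> bump wave j j"
    and \<beta>: "\<And>j. j \<in> T \<Longrightarrow> \<beta> j = - noise gauss1 j - others \<alpha> \<beta> bump1 wave1 j j"
    and AB: "\<And>j. j \<in> T \<Longrightarrow> \<bar>\<alpha> j\<bar> \<le> 109/50 \<and> \<bar>\<beta> j\<bar> \<le> 109/50" and j: "j \<in> T"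
  shows "\<bar>\<alpha> j - \<epsilon> j\<bar> \<le> 91/1000" and "\<bar>\<beta> j\<bar> \<le> 273/2000" and "\<bar>\<beta> j\<bar> \<le> 21/10 * \<tau>\<^sup>2 + 9/500"
    and "\<bar>\<alpha> j\<bar> \<le> 11/10"
proof -
  \<comment> \<open>The bound for \<beta> keeps its dependence on \<tau>, because these coefficients
    are divided by \<tau> in the end.\<close>
  have improve: "\<bar>\<alpha> k - \<epsilon> k\<bar> \<le> 427/5000 + 103/50 * (A * (51/50000) + B * (81/10000))
      \<and> \<bar>\<beta> k\<bar> \<le> 21/10 * \<tau>\<^sup>2 + 309/40 * (A * (51/50000) + B * (81/10000))"
    if k: "k \<in> T" and AB: "\<forall>j\<in>T. \<bar>\<alpha> j\<bar> \<le> A \<and> \<bar>\<beta> j\<bar> \<le> B" for k A B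
  proof
    have "\<bar>\<alpha> k - \<epsilon> k\<bar> \<le> \<bar>noise gauss k\<bar> + \<bar>others \<alpha> \<beta> bump wave k k\<bar>"
      unfolding \<alpha>[OF k] by (simp add: abs_triangle_ineq4[of "- noise gauss k", simplified])
    moreover have "\<bar>others \<alpha> \<beta> bump wave k k\<bar> \<le> 103/50 * (A * (51/50000) + B * (81/10000))"
      by (rule others_at_spike(1)[OF k]) (use AB in blast)
    moreover have "\<bar>noise gauss k\<bar> \<le> 427/5000" using noise_bounds(1)[of k] \<tau>_sq by linarith
    ultimately show "\<bar>\<alpha> k - \<epsilon> k\<bar> \<le> 427/5000 + 103/50 * (A * (51/50000) + B * (81/10000))"
      by linarith
    have "\<bar>\<beta> k\<bar> \<le> \<bar>noise gauss1 k\<bar> + \<bar>others \<alpha> \<beta> bump1 wave1 k k\<bar>"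
      unfolding \<beta>[OF k] by (simp add: abs_triangle_ineq4[of "- noise gauss1 k", simplified])
    moreover have "\<bar>others \<alpha> \<beta> bump1 wave1 k k\<bar> \<le> 309/40 * (A * (51/50000) + B * (81/10000))"
      by (rule others_at_spike(2)[OF k]) (use AB in blast)
    ultimately show "\<bar>\<beta> k\<bar> \<le> 21/10 * \<tau>\<^sup>2 + 309/40 * (A * (51/50000) + B * (81/10000))"
      using noise_bounds(2)[of k] by linarith
  qed
  have le: "\<bar>\<alpha> k\<bar> \<le> \<bar>\<alpha> k - \<epsilon> k\<bar> + 1" if "k \<in> T" for k
    using \<epsilon>[OF that] abs_triangle_ineq[of "\<alpha> k - \<epsilon> k" "\<epsilon> k"] by simp
  have 0: "\<forall>k\<in>T. \<bar>\<alpha> k\<bar> \<le> 109/50 \<and> \<bar>\<beta> k\<bar> \<le> 109/50" using AB by blast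
  have 1: "\<forall>k\<in>T. \<bar>\<alpha> k\<bar> \<le> 1127/1000 \<and> \<bar>\<beta> k\<bar> \<le> 273/1000"

  proof
    fix k assume k: "k \<in> T"
    show "\<bar>\<alpha> k\<bar> \<le> 1127/1000 \<and> \<bar>\<beta> k\<bar> \<le> 273/1000" using improve[OF k 0] le[OF k] \<tau>_sq by auto
  qed
  have 2: "\<forall>k\<in>T. \<bar>\<alpha> k\<bar> \<le> 1093/1000 \<and> \<bar>\<beta> k\<bar> \<le> 29/200"

  proof
    fix k assume k: "k \<in> T"
    show "\<bar>\<alpha> k\<bar> \<le> 1093/1000 \<and> \<bar>\<beta> k\<bar> \<le> 29/200" using improve[OF k 1] le[OF k] \<tau>_sq by auto
  qed
  show 3: "\<bar>\<alpha> j - \<epsilon> j\<bar> \<le> 91/1000" "\<bar>\<beta> j\<bar> \<le> 21/10 * \<tau>\<^sup>2 + 9/500"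
    and "\<bar>\<beta> j\<bar> \<le> 273/2000" "\<bar>\<alpha> j\<bar> \<le> 11/10"
    using improve[OF j 2] le[OF j] \<tau>_sq by auto
qed

definition certificate :: "(real \<Rightarrow> real) \<Rightarrow> (real \<Rightarrow> real) \<Rightarrow> real \<Rightarrow> real" where
  "certificate \<alpha> \<beta> t = (\<Sum>k\<in>T. \<alpha> k * bump (x k) (z k) (t - k) + \<beta> k * wave (x k) (z k) (t - k))
     + noise gauss t"

lemma certificate_split:
  assumes "c \<in> T"
  shows "certificate \<alpha> \<beta> t = \<alpha> c * bump (x c) (z c) (t - c) + \<beta> c * wave (x c) (z c) (t - c)
    + others \<alpha> \<beta> bump wave c t + noise gauss t"
  unfolding certificate_def others_def using assms T(1) by (simp add: sum.remove)

lemma noise_deriv: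
  assumes "\<And>u. (f has_real_derivative f' u) (at u)"
  shows "(noise f has_real_derivative noise f' t) (at t)"
  unfolding noise_def
proof (rule DERIV_sum)
  fix k
  have "((\<lambda>t. second_diff \<tau> f (t - k)) has_real_derivative second_diff \<tau> f' (t - k) * 1) (at t)"
    by (rule DERIV_chain2[OF second_diff_deriv[OF assms]]) (auto intro!: derivative_eq_intros)
  then show "((\<lambda>t. \<delta> k * second_diff \<tau> f (t - k)) has_real_derivative
      \<delta> k * second_diff \<tau> f' (t - k)) (at t)" by (auto intro!: derivative_eq_intros)
qed

lemma others_deriv:
  assumes "\<And>x z u. (\<phi> x z has_real_derivative \<phi>' x z u) (at u)"
    and "\<And>x z u. (\<psi> x z has_real_derivative \<psi>' x z u) (at u)"
  shows "(others \<alpha> \<beta> \<phi> \<psi> c has_real_derivative others \<alpha> \<beta> \<phi>' \<psi>' c t) (at t)"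
  unfolding others_def
proof (rule DERIV_sum)
  fix k
  have "((\<lambda>t. \<phi> (x k) (z k) (t - k)) has_real_derivative \<phi>' (x k) (z k) (t - k) * 1) (at t)"
    "((\<lambda>t. \<psi> (x k) (z k) (t - k)) has_real_derivative \<psi>' (x k) (z k) (t - k) * 1) (at t)"
    by (rule DERIV_chain2[OF assms(1)] DERIV_chain2[OF assms(2)]; auto intro!: derivative_eq_intros)+
  then show "((\<lambda>t. \<alpha> k * \<phi> (x k) (z k) (t - k) + \<beta> k * \<psi> (x k) (z k) (t - k)) has_real_derivative
      \<alpha> k * \<phi>' (x k) (z k) (t - k) + \<beta> k * \<psi>' (x k) (z k) (t - k)) (at t)"
    by (auto intro!: derivative_eq_intros)
qed

context
  fixes \<alpha> \<beta> :: "real \<Rightarrow> real"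
  assumes \<alpha>: "\<And>j. j \<in> T \<Longrightarrow> \<alpha> j = \<epsilon> j - noise gauss j - others \<alpha> \<beta> bump wave j j"
    and \<beta>: "\<And>j. j \<in> T \<Longrightarrow> \<beta> j = - noise gauss1 j - others \<alpha> \<beta> bump1 wave1 j j"
    and AB: "\<And>j. j \<in> T \<Longrightarrow> \<bar>\<alpha> j\<bar> \<le> 109/50 \<and> \<bar>\<beta> j\<bar> \<le> 109/50"
begin

lemma coefficient_bounds: "j \<in> T \<Longrightarrow> \<bar>\<alpha> j\<bar> \<le> 11/10 \<and> \<bar>\<beta> j\<bar> \<le> 7/50"
  using system_bounds(2-4)[of \<alpha> \<beta> j] \<alpha> \<beta> AB by force

lemma certificate_at_spike:
  assumes "j \<in> T"
  shows "certificate \<alpha> \<beta> j = \<epsilon> j"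
proof -
  have "bump (x j) (z j) 0 = 1" "wave (x j) (z j) 0 = 0"
    using x_plus_z[OF assms] by (simp_all add: bump_def wave_def interp_g_def interp_h_def gauss_def add.commute)
  then show ?thesis
    unfolding certificate_split[OF assms] using \<alpha>[OF assms] by simp
qed

text \<open>
  Up to distance \<open>4/5\<close> from the nearest spike \<open>c\<close>, the noise part and the other spikes are both expanded
  to second order at \<open>c\<close>; between \<open>4/5\<close> and 1 only the noise part is; beyond 1 all terms are bounded
  separately.
\<close>

lemma certificate_between_spikes:
  assumes c: "c \<in> T" and t: "t \<noteq> c" and near: "\<And>k. k \<in> T \<Longrightarrow> \<bar>t - c\<bar> \<le> \<bar>t - k\<bar>"
  shows "\<bar>certificate \<alpha> \<beta> t\<bar> < 1"
proof -
  define u where "u = t - c"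
  define s where "s = 49/100 * u\<^sup>2"
  define y where "y = u\<^sup>2 / 2"
  define r where "r = y * (\<bar>u\<bar> + 49/200)"
  define B where "B = bump (x c) (z c) u"
  define B' where "B' = 1 - B"
  define W where "W = wave (x c) (z c) u"
  define n0 n1 o0 o1 where "n0 = noise gauss c" and "n1 = noise gauss1 c"
    and "o0 = others \<alpha> \<beta> bump wave c c" and "o1 = others \<alpha> \<beta> bump1 wave1 c c"
  have u0: "u \<noteq> 0" using t by (simp add: u_def)
  have y0: "0 < y" using u0 by (simp add: y_def)
  have sy: "s = 49/50 * y" by (simp add: s_def y_def)
  from x_plus_z[OF c] have xz: "0 \<le> x c" "0 \<le> z c" "0 < x c + z c" "x c + z c \<le> 19/80" by auto
  have B: "0 \<le> B" "B \<le> exp (- s)" and W: "\<bar>W\<bar> \<le> 4/5" and uW: "\<bar>u - W\<bar> \<le> r"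
    using atom_bounds[OF xz, of u] by (simp_all add: B_def W_def s_def y_def r_def)
  have s0: "0 \<le> s" by (simp add: s_def)
  have B1: "B \<le> 1" using B s0 by (smt (verit) exp_le_one_iff)
  have B2: "B \<le> 1 - s + s\<^sup>2 / 2" using exp_second_order(2)[OF s0] B by linarith
  have sep: "15/4 \<le> \<bar>c - k\<bar>" if "k \<in> T - {c}" for k
    using that c by (intro separatedD[OF T(2)]) auto
  have n: "\<bar>n0\<bar> \<le> 427/5000" "\<bar>n1\<bar> \<le> 1187/10000" "\<bar>noise gauss t\<bar> \<le> 427/5000"
    using noise_bounds(1,2)[of c] noise_bounds(1)[of t] \<tau>_sq unfolding n0_def n1_def by linarith+
  have "\<bar>o0\<bar> \<le> 103/50 * (11/10 * (51/50000) + 7/50 * (81/10000))"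
    unfolding o0_def by (rule others_at_spike(1)[OF c], rule coefficient_bounds, assumption)
  moreover have "\<bar>o1\<bar> \<le> 309/40 * (11/10 * (51/50000) + 7/50 * (81/10000))"
    unfolding o1_def by (rule others_at_spike(2)[OF c], rule coefficient_bounds, assumption)
  ultimately have o: "\<bar>o0\<bar> \<le> 47/10000" "\<bar>o1\<bar> \<le> 7/400" by simp_all
  have e: "\<bar>n0 + o0\<bar> \<le> 91/1000" "\<bar>n1 + o1\<bar> \<le> 273/2000"
  proof -
    have "\<bar>\<alpha> c - \<epsilon> c\<bar> \<le> 91/1000" "\<bar>\<beta> c\<bar> \<le> 273/2000"
      by (rule system_bounds(1,2)[of \<alpha> \<beta>], rule \<alpha>, assumption, rule \<beta>, assumption, rule AB, assumption, rule c)+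
    moreover have "\<alpha> c - \<epsilon> c = - (n0 + o0)" "\<beta> c = - (n1 + o1)"
      using \<alpha>[OF c] \<beta>[OF c] by (simp_all add: n0_def n1_def o0_def o1_def)
    ultimately show "\<bar>n0 + o0\<bar> \<le> 91/1000" "\<bar>n1 + o1\<bar> \<le> 273/2000"
      by (simp_all only: abs_minus_cancel)
  qed
  have Q: "certificate \<alpha> \<beta> t = \<epsilon> c * B - (n0 + o0) * B - (n1 + o1) * W
      + others \<alpha> \<beta> bump wave c t + noise gauss t"
    unfolding certificate_split[OF c] \<alpha>[OF c] \<beta>[OF c] u_def[symmetric] B_def[symmetric]
      W_def[symmetric] n0_def[symmetric] n1_def[symmetric] o0_def[symmetric] o1_def[symmetric]
    by (simp add: algebra_simps)
  have \<epsilon>B: "\<bar>\<epsilon> c * B\<bar> = B" using \<epsilon>[OF c] B by (simp add: abs_mult)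
  have others_t: "\<bar>others \<alpha> \<beta> bump wave c t\<bar> \<le> 103/100 * (envelope (11/10) (7/50) 0 r0 + 23/10000)"
    if "\<And>k. k \<in> T - {c} \<Longrightarrow> r0 \<le> \<bar>t - k\<bar>" "15/8 \<le> r0" for r0
  proof -
    have "1 / r0 \<le> 1 / (15/8)" using that(2) by (intro divide_left_mono) auto
    then have r0: "1 / r0 \<le> 267/500" by simp
    have "\<bar>others \<alpha> \<beta> bump wave c t\<bar>
        \<le> 103/100 * (envelope (11/10) (7/50) 0 r0 + (15/4) ^ 0 * (11/10 * (51/50000) + 7/50 * (81/10000)))"
      by (rule others_le[where \<phi> = bump and \<psi> = wave and m = 0 and ?r0.0 = r0],
          rule c, rule far_bounds(1), assumption+, rule far_bounds(4), assumption+)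
        (use near that r0 coefficient_bounds in auto)
    then show ?thesis by simp
  qed
  have far: "15/8 \<le> \<bar>t - k\<bar>" if "k \<in> T - {c}" for k
  proof -
    have "k \<in> T" using that by simp
    then show ?thesis using sep[OF that] near[of k] by linarith
  qed
  \<comment> \<open>The factor 1091/1000 is \<open>1 + 91/1000\<close>, a bound for the bump
    coefficient; 273/2500 covers the wave and 427/5000 the corruption part.\<close>
  have direct: "\<bar>certificate \<alpha> \<beta> t\<bar> \<le> 1091/1000 * b + 273/2500 + 427/5000 + d"
    if b: "exp (- s) \<le> b" and d: "\<bar>others \<alpha> \<beta> bump wave c t\<bar> \<le> d" for b d
  proof -
    have "\<bar>(n0 + o0) * B\<bar> \<le> 91/1000 * B" using mult_right_mono[OF e(1) B(1)] B by (simp add: abs_mult)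
    moreover have "\<bar>(n1 + o1) * W\<bar> \<le> 273/2000 * (4/5)"
      unfolding abs_mult using e W by (intro mult_mono) auto
    ultimately show ?thesis unfolding Q using \<epsilon>B B b d n by linarith
  qed
  have taylor_noise: "\<bar>noise gauss t - n0 - n1 * u\<bar> \<le> 599/2000 * y"
  proof -
    have "\<bar>noise gauss t - noise gauss c - noise gauss1 c * (t - c)\<bar> \<le> 599/2000 * (t - c)\<^sup>2 / 2"
    proof (rule taylor_second_order_bound)
      show "(noise gauss has_real_derivative noise gauss1 p) (at p)" for p
        by (rule noise_deriv[OF gauss_has_deriv])
      show "(noise gauss1 has_real_derivative noise gauss2 p) (at p)" for p
        by (rule noise_deriv[OF gauss1_has_deriv])
      show "\<bar>noise gauss2 p\<bar> \<le> 599/2000" for p using noise_bounds(3)[of p] \<tau>_sq by linarith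
    qed
    then show ?thesis by (simp add: n0_def n1_def u_def y_def)
  qed
  have shape: "\<bar>v0 * B'\<bar> \<le> v * B'" "\<bar>v1 * (u - W)\<bar> \<le> w * r"
    if "\<bar>v0\<bar> \<le> v" "\<bar>v1\<bar> \<le> w" for v0 v1 v w
    unfolding abs_mult using that B1 uW by (auto simp: B'_def intro!: mult_mono mult_right_mono)
  consider "\<bar>u\<bar> \<le> 4/5" | "4/5 < \<bar>u\<bar>" "\<bar>u\<bar> \<le> 1" | "1 < \<bar>u\<bar>" "\<bar>u\<bar> \<le> 13/10" | "13/10 < \<bar>u\<bar>" by linarith
  then show ?thesis
  proof cases
    case 1
    have taylor_others: "\<bar>others \<alpha> \<beta> bump wave c t - o0 - o1 * u\<bar> \<le> 27/100 * y"
    proof -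
      have "\<bar>others \<alpha> \<beta> bump wave c t - others \<alpha> \<beta> bump wave c c - others \<alpha> \<beta> bump1 wave1 c c * (t - c)\<bar>
          \<le> 27/100 * (t - c)\<^sup>2 / 2"
      proof (rule taylor_second_order_bound[where f = "others \<alpha> \<beta> bump wave c"
            and f' = "others \<alpha> \<beta> bump1 wave1 c" and f'' = "others \<alpha> \<beta> bump2 wave2 c"])
        show "(others \<alpha> \<beta> bump wave c has_real_derivative others \<alpha> \<beta> bump1 wave1 c p) (at p)" for p
          by (rule others_deriv[OF bump_deriv wave_deriv])
        show "(others \<alpha> \<beta> bump1 wave1 c has_real_derivative others \<alpha> \<beta> bump2 wave2 c p) (at p)" for p
          by (rule others_deriv[OF bump1_deriv wave1_deriv])
        fix p assume "p \<in> closed_segment c t"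
        then have p: "\<bar>p - c\<bar> \<le> 4/5"
          using 1 by (auto simp: u_def closed_segment_eq_real_ivl split: if_splits)
        have far_p: "59/20 \<le> \<bar>p - k\<bar>" if "k \<in> T - {c}" for k using sep[OF that] p by linarith
        have near_p: "\<bar>p - c\<bar> \<le> \<bar>p - k\<bar>" if "k \<in> T" for k
          using far_p[of k] that p by (cases "k = c") auto
        have "\<bar>others \<alpha> \<beta> bump2 wave2 c p\<bar>
            \<le> 103/100 * (envelope (11/10) (7/50) 2 (59/20) + (15/4) ^ 2 * (11/10 * (51/50000) + 7/50 * (81/10000)))"
          by (rule others_le[where \<phi> = bump2 and \<psi> = wave2 and m = 2 and ?r0.0 = "59/20"],
              rule c, rule far_bounds(3), assumption+, rule far_bounds(6), assumption+)
            (use near_p far_p coefficient_bounds in auto)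
        also have "\<dots> \<le> 27/100" using envelope_2_95 by (simp add: power2_eq_square)
        finally show "\<bar>others \<alpha> \<beta> bump2 wave2 c p\<bar> \<le> 27/100" .
      qed
      then show ?thesis by (simp add: o0_def o1_def u_def y_def)
    qed
    have y1: "y \<le> 8/25"
    proof -
      have "\<bar>u\<bar>\<^sup>2 \<le> (4/5)\<^sup>2" using 1 by (intro power_mono) auto
      then show ?thesis by (simp add: y_def power2_eq_square)
    qed
    \<comment> \<open>By the equations for the coefficients, bump and wave cancel the value and
      slope at \<open>c\<close> of everything else, up to the factors \<open>1 - B\<close> and
      \<open>u - W\<close>, both of second order in \<open>u\<close>.\<close>
    have "certificate \<alpha> \<beta> t = \<epsilon> c * B + (noise gauss t - n0 - n1 * u)
        + (others \<alpha> \<beta> bump wave c t - o0 - o1 * u) + (n0 + o0) * B' + (n1 + o1) * (u - W)"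
      unfolding Q B'_def by (simp add: algebra_simps)
    then have "\<bar>certificate \<alpha> \<beta> t\<bar> \<le> B + 599/2000 * y + 27/100 * y + 91/1000 * B'
        + 273/2000 * r"
      using \<epsilon>B taylor_noise taylor_others shape[OF e] by linarith
    moreover have "r \<le> y * (209/200)" unfolding r_def using 1 y0 by (intro mult_left_mono) auto
    moreover have "s \<le> 196/625" using y1 sy by simp
    from mult_right_mono[OF this s0] have "s\<^sup>2 \<le> 196/625 * s" by (simp add: power2_eq_square)
    \<comment> \<open>The bump, even with the share \<open>91/1000 * B'\<close> added, stays below 1
      by about \<open>0.75 * y\<close>, while the remaining terms amount to about
      \<open>0.71 * y\<close>.\<close>
    ultimately show ?thesis using B2 sy y0 B'_def by linarith
  next
    case 2
    have far_t: "11/4 \<le> \<bar>t - k\<bar>" if "k \<in> T - {c}" for k using sep[OF that] 2 unfolding u_def by linarith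
    have oth: "\<bar>others \<alpha> \<beta> bump wave c t\<bar> \<le> 6/125"
      using others_t[OF far_t] envelope_2_75 by simp
    have y1: "8/25 \<le> y" "y \<le> 1/2"
    proof -
      have "(4/5)\<^sup>2 \<le> \<bar>u\<bar>\<^sup>2" "\<bar>u\<bar>\<^sup>2 \<le> 1\<^sup>2" using 2 by (intro power_mono; simp)+
      then show "8/25 \<le> y" "y \<le> 1/2" by (simp_all add: y_def power2_eq_square)
    qed
    \<comment> \<open>Only the corruption part is matched against bump and wave; the shares
      \<open>o0\<close> and \<open>o1\<close> of the other spikes are estimated by their size. This
      costs a constant, which is affordable since \<open>y\<close> is at least 8/25.\<close>
    have "certificate \<alpha> \<beta> t = \<epsilon> c * B + (noise gauss t - n0 - n1 * u)
        + n0 * B' + n1 * (u - W) + others \<alpha> \<beta> bump wave c t - o0 * B - o1 * W"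
      unfolding Q B'_def by (simp add: algebra_simps)
    moreover have "\<bar>o0 * B\<bar> \<le> 47/10000 * 1" "\<bar>o1 * W\<bar> \<le> 7/400 * (4/5)"
      unfolding abs_mult using o B B1 W by (intro mult_mono; simp)+
    ultimately have "\<bar>certificate \<alpha> \<beta> t\<bar> \<le> B + 599/2000 * y + 427/5000 * B'
        + 1187/10000 * r + 6/125 + 47/10000 + 7/500"
      using \<epsilon>B taylor_noise oth shape[OF n(1,2)] by linarith
    moreover have "r \<le> y * (249/200)" unfolding r_def using 2 y0 by (intro mult_left_mono) auto
    moreover have "s \<le> 49/100" using y1 sy by simp
    from mult_right_mono[OF this s0] have "s\<^sup>2 \<le> 49/100 * s" by (simp add: power2_eq_square)
    ultimately show ?thesis using B2 sy y1 B'_def by linarith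
  next
    case 3
    have far_t: "49/20 \<le> \<bar>t - k\<bar>" if "k \<in> T - {c}" for k using sep[OF that] 3 unfolding u_def by linarith
    have oth: "\<bar>others \<alpha> \<beta> bump wave c t\<bar> \<le> 47/500"
      using others_t[OF far_t] envelope_2_45 by simp
    have "1\<^sup>2 \<le> \<bar>u\<bar>\<^sup>2" using 3 by (intro power_mono) auto
    then have s: "49/100 \<le> s" by (simp add: s_def)
    have "exp (- s) \<le> 613/1000"
      by (rule exp_minus_le[where y = "49/100" and d = "16319/10000" and m = 1]) (use s in \<open>simp_all add: power_divide\<close>)
    from direct[OF this oth] show ?thesis by simp
  next
    case 4
    have oth: "\<bar>others \<alpha> \<beta> bump wave c t\<bar> \<le> 139/500"
      using others_t[OF far] envelope_1_875 by simp
    have "(13/10)\<^sup>2 \<le> \<bar>u\<bar>\<^sup>2" using 4 by (intro power_mono) auto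
    then have s: "207/250 \<le> s" by (simp add: s_def power2_eq_square)
    have "exp (- s) \<le> 219/500"
      by (rule exp_minus_le[where y = "207/500" and d = "15127/10000" and m = 2]) (use s in \<open>simp_all add: power_divide\<close>)
    from direct[OF this oth] show ?thesis by simp
  qed
qed

lemma certificate_off_spikes:
  assumes "t \<notin> T"
  shows "\<bar>certificate \<alpha> \<beta> t\<bar> < 1"
proof (cases "T = {}")
  case True
  then show ?thesis using noise_bounds(1)[of t] \<tau>_sq unfolding certificate_def by (simp add: True)
next
  case False
  obtain c where "c \<in> T" "\<And>k. k \<in> T \<Longrightarrow> \<bar>t - c\<bar> \<le> \<bar>t - k\<bar>"
    using ex_min_if_finite[of "(\<lambda>k. \<bar>t - k\<bar>) ` T"] T(1) False
    by (auto simp: not_less)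
  then show ?thesis using assms by (intro certificate_between_spikes[of c]) auto
qed

end

end

section \<open>From bumps and waves back to Gaussians centred at samples\<close>

lemma gauss_times_exp_shift: "gauss u * exp (- x * u) = exp (x\<^sup>2 / 2) * gauss (u + x)"
proof -
  have "- (u\<^sup>2 / 2) + (- x * u) = x\<^sup>2 / 2 + (- ((u + x)\<^sup>2 / 2))"
    by (simp add: power2_eq_square field_simps)
  then show ?thesis by (simp only: gauss_def exp_add[symmetric])
qed

text \<open>The points \<open>k - x k\<close> and \<open>k - x k + \<tau>\<close> are the samples
  surrounding spike \<open>k\<close>; thus \<open>c k\<close> and \<open>d k\<close> are going to be
  entries of the dual vector, which explains the bound 2.\<close>

lemma dual_certificate_exists:
  fixes T N :: "real set" and x :: "real \<Rightarrow> real"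
  assumes T: "finite T" "separated (15/4) T" and N: "finite N" "separated (15/4) N"
    and \<tau>: "13/200 \<le> \<tau>" "\<tau> \<le> 19/80"
    and x: "\<And>k. k \<in> T \<Longrightarrow> 0 \<le> x k \<and> x k \<le> \<tau>"
    and \<epsilon>: "\<And>k. k \<in> T \<Longrightarrow> \<bar>\<epsilon> k\<bar> = 1" and \<delta>: "\<And>k. k \<in> N \<Longrightarrow> \<bar>\<delta> k\<bar> = 1"
  obtains c d where "\<And>k. k \<in> T \<Longrightarrow> \<bar>c k\<bar> < 2 \<and> \<bar>d k\<bar> < 2"
    and "\<And>t. t \<in> T \<Longrightarrow> (\<Sum>k\<in>T. c k * gauss (t - k + x k) + d k * gauss (t - k + x k - \<tau>))
        + (\<Sum>k\<in>N. \<delta> k * second_diff \<tau> gauss (t - k)) = \<epsilon> t"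
    and "\<And>t. t \<notin> T \<Longrightarrow> \<bar>(\<Sum>k\<in>T. c k * gauss (t - k + x k) + d k * gauss (t - k + x k - \<tau>))
        + (\<Sum>k\<in>N. \<delta> k * second_diff \<tau> gauss (t - k))\<bar> < 1"
proof -
  define z where "z k = \<tau> - x k" for k
  interpret certificate_setup T N x z \<tau> \<epsilon> \<delta>
    by unfold_locales (use assms in \<open>auto simp: z_def\<close>)
  from system_solution obtain \<alpha> \<beta>
    where *: "\<forall>j\<in>T. \<alpha> j = \<epsilon> j - noise gauss j - others \<alpha> \<beta> bump wave j j"
      "\<forall>j\<in>T. \<beta> j = - noise gauss1 j - others \<alpha> \<beta> bump1 wave1 j j"
      "\<forall>j\<in>T. \<bar>\<alpha> j\<bar> \<le> 109/50 \<and> \<bar>\<beta> j\<bar> \<le> 109/50"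
    by (elim exE conjE)
  note \<alpha> = *(1)[rule_format] and \<beta> = *(2)[rule_format] and AB = *(3)[rule_format]
  \<comment> \<open>The quotients are the weights of the two exponentials in the combination of bump
    and wave; the exponential factors arise from completing the square.\<close>
  define c where "c k = (\<alpha> k * z k - \<beta> k) / \<tau> * exp ((x k)\<^sup>2 / 2)" for k
  define d where "d k = (\<alpha> k * x k + \<beta> k) / \<tau> * exp ((z k)\<^sup>2 / 2)" for k
  have atoms: "\<alpha> k * bump (x k) (z k) (t - k) + \<beta> k * wave (x k) (z k) (t - k)
      = c k * gauss (t - k + x k) + d k * gauss (t - k + x k - \<tau>)" for t k
  proof -
    define u where "u = t - k"
    have xz: "x k + z k = \<tau>" by (simp add: z_def)
    have "\<alpha> k * bump (x k) (z k) u + \<beta> k * wave (x k) (z k) u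
        = (\<alpha> k * z k - \<beta> k) / \<tau> * (gauss u * exp (- x k * u))
          + (\<alpha> k * x k + \<beta> k) / \<tau> * (gauss u * exp (- (- z k) * u))"
      unfolding bump_def wave_def interp_g_def interp_h_def xz
      by (simp add: algebra_simps add_divide_distrib diff_divide_distrib)
    also have "\<dots> = c k * gauss (u + x k) + d k * gauss (u + - z k)"
      unfolding gauss_times_exp_shift by (simp add: c_def d_def)
    also have "u + - z k = u + x k - \<tau>" by (simp add: z_def)
    finally show ?thesis by (simp add: u_def)
  qed
  have cert: "(\<Sum>k\<in>T. c k * gauss (t - k + x k) + d k * gauss (t - k + x k - \<tau>))
      + (\<Sum>k\<in>N. \<delta> k * second_diff \<tau> gauss (t - k)) = certificate \<alpha> \<beta> t" for t
    unfolding certificate_def noise_def by (simp add: atoms)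
  have coeff: "\<bar>(\<alpha> k * p + r) / \<tau> * exp (p'\<^sup>2 / 2)\<bar> < 2"
    if k: "k \<in> T" and p: "0 \<le> p" "p \<le> \<tau>" "0 \<le> p'" "p' \<le> \<tau>" "\<bar>r\<bar> = \<bar>\<beta> k\<bar>" for k p p' r
  proof -
    have \<tau>0: "0 < \<tau>" using \<tau> by simp
    have "\<bar>\<beta> k\<bar> \<le> 21/10 * \<tau>\<^sup>2 + 9/500" "\<bar>\<alpha> k\<bar> \<le> 11/10"
      by (rule system_bounds(3,4)[of \<alpha> \<beta>], rule \<alpha>, assumption, rule \<beta>, assumption, rule AB,
        assumption, rule k)+
    moreover have "\<bar>\<alpha> k * p + r\<bar> \<le> \<bar>\<alpha> k\<bar> * \<bar>p\<bar> + \<bar>r\<bar>" unfolding abs_mult[symmetric] by (rule abs_triangle_ineq)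
    moreover have "\<bar>\<alpha> k\<bar> * \<bar>p\<bar> \<le> 11/10 * \<tau>" using \<open>\<bar>\<alpha> k\<bar> \<le> (11/10)\<close> p by (intro mult_mono) auto
    moreover have "21/10 * \<tau>\<^sup>2 \<le> 21/10 * (19/80 * \<tau>)"
      unfolding power2_eq_square using \<tau> \<tau>0 by (intro mult_left_mono mult_right_mono) auto
    \<comment> \<open>The lower bound on \<tau> enters here: 9/500 is at most
      \<open>0.277 * \<tau>\<close>, and \<open>11/10 + 21/10 * 19/80 + 0.277\<close> is below
      47/25. Multiplied by 103/100 for the exponential factor, this is still below 2.\<close>
    ultimately have "\<bar>\<alpha> k * p + r\<bar> \<le> 47/25 * \<tau>" using p(5) \<tau> by linarith
    then have 1: "\<bar>(\<alpha> k * p + r) / \<tau>\<bar> \<le> 47/25" using \<tau>0 by (simp add: abs_divide pos_divide_le_eq)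
    have "p'\<^sup>2 \<le> (19/80)\<^sup>2" using p \<tau> by (intro power_mono) auto
    then have "p'\<^sup>2 / 2 \<le> 29/1000" by (simp add: power2_eq_square)
    then have "exp (p'\<^sup>2 / 2) \<le> exp (29/1000)" by simp
    also have "exp (29/1000) \<le> (103/100::real)" by (rule exp_29_1000)
    finally have "\<bar>(\<alpha> k * p + r) / \<tau>\<bar> * exp (p'\<^sup>2 / 2) \<le> 47/25 * (103/100)" using 1 by (intro mult_mono) auto
    also have "\<dots> < 2" by simp
    finally show ?thesis unfolding abs_mult by simp
  qed
  show ?thesis
  proof (rule that[of c d])
    fix k assume k: "k \<in> T"
    show "\<bar>c k\<bar> < 2 \<and> \<bar>d k\<bar> < 2"
      using coeff[of k "z k" "x k" "- \<beta> k"] coeff[of k "x k" "z k" "\<beta> k"] x[OF k] k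
      by (simp add: c_def d_def z_def)
  next
    fix t assume "t \<in> T"
    then show "(\<Sum>k\<in>T. c k * gauss (t - k + x k) + d k * gauss (t - k + x k - \<tau>))
        + (\<Sum>k\<in>N. \<delta> k * second_diff \<tau> gauss (t - k)) = \<epsilon> t"
      unfolding cert by (rule certificate_at_spike[of \<alpha> \<beta>, rotated -1]) (rule \<alpha> \<beta> AB; assumption)+
  next
    fix t assume "t \<notin> T"
    then show "\<bar>(\<Sum>k\<in>T. c k * gauss (t - k + x k) + d k * gauss (t - k + x k - \<tau>))
        + (\<Sum>k\<in>N. \<delta> k * second_diff \<tau> gauss (t - k))\<bar> < 1"
      unfolding cert by (rule certificate_off_spikes[of \<alpha> \<beta>, rotated -1]) (rule \<alpha> \<beta> AB; assumption)+
  qed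
qed

section \<open>Signed measures\<close>

lemma signed_measure_empty: "signed_borel_measure \<nu> \<Longrightarrow> \<nu> {} = 0"
  by (simp add: signed_borel_measure_def)

lemma signed_measure_Un:
  assumes \<nu>: "signed_borel_measure \<nu>" and "B \<in> sets borel" "C \<in> sets borel" "B \<inter> C = {}"
  shows "\<nu> (B \<union> C) = \<nu> B + \<nu> C"
proof -
  have "range (binaryset B C) \<subseteq> sets borel" "disjoint_family (binaryset B C)"
    using assms by (auto simp: range_binaryset_eq disjoint_family_on_def binaryset_def)
  then have "(\<lambda>i. \<nu> (binaryset B C i)) sums \<nu> (\<Union>i. binaryset B C i)"
    using \<nu> by (simp add: signed_borel_measure_def)
  moreover have "(\<lambda>i. \<nu> (binaryset B C i)) sums (\<nu> B + \<nu> C)"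
    using binaryset_sums[of \<nu> B C] signed_measure_empty[OF \<nu>] by simp
  ultimately show ?thesis by (simp add: UN_binaryset_eq sums_unique2)
qed

lemma signed_measure_Diff:
  assumes \<nu>: "signed_borel_measure \<nu>" and "A \<in> sets borel" "B \<in> sets borel" "B \<subseteq> A"
  shows "\<nu> (A - B) = \<nu> A - \<nu> B"
proof -
  have "\<nu> (B \<union> (A - B)) = \<nu> B + \<nu> (A - B)" by (rule signed_measure_Un) (use assms in auto)
  moreover have "B \<union> (A - B) = A" using assms by auto
  ultimately show ?thesis by simp
qed

lemma signed_measure_finite:
  assumes \<nu>: "signed_borel_measure \<nu>" and "finite T"
  shows "\<nu> T = (\<Sum>t\<in>T. \<nu> {t})"
  using assms(2)
proof (induction T)
  case empty
  then show ?case by (simp add: signed_measure_empty[OF \<nu>])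
next
  case (insert t T)
  have "\<nu> ({t} \<union> T) = \<nu> {t} + \<nu> T"
    by (rule signed_measure_Un[OF \<nu>]) (use insert in \<open>auto intro: borel_closed finite_imp_closed\<close>)
  then show ?case using insert by simp
qed

lemma signed_measure_uminus: "signed_borel_measure \<nu> \<Longrightarrow> signed_borel_measure (\<lambda>A. - \<nu> A)"
  by (auto simp: signed_borel_measure_def intro: sums_minus)

lemma tv_norm_pair_ge:
  assumes \<nu>: "signed_borel_measure \<nu>" and B: "B \<in> sets borel" and C: "C \<in> sets borel" and BC: "B \<inter> C = {}"
  shows "ereal (\<bar>\<nu> B\<bar> + \<bar>\<nu> C\<bar>) \<le> tv_norm \<nu>"
proof -
  \<comment> \<open>The blocks of a partition are nonempty, hence the removal of the empty
    set.\<close>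
  define P where "P = {B, C, - (B \<union> C)} - {{}}"
  have "ereal (\<Sum>A\<in>P. \<bar>\<nu> A\<bar>) \<le> tv_norm \<nu>"
    unfolding tv_norm_def
    by (rule SUP_upper) (use B C BC in \<open>auto simp: P_def partition_on_def disjoint_def\<close>)
  moreover have "\<bar>\<nu> B\<bar> + \<bar>\<nu> C\<bar> \<le> (\<Sum>A\<in>P. \<bar>\<nu> A\<bar>)"
  proof -
    have "\<bar>\<nu> B\<bar> + \<bar>\<nu> C\<bar> = (\<Sum>A\<in>{B, C} - {{}}. \<bar>\<nu> A\<bar>)"
    proof (cases "B = {} \<or> C = {}")
      case True
      then show ?thesis using signed_measure_empty[OF \<nu>] by (auto simp: insert_Diff_if)
    next
      case False
      then have "{B, C} - {{}} = {B, C}" "B \<noteq> C" using BC by auto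
      then show ?thesis by simp
    qed
    also have "\<dots> \<le> (\<Sum>A\<in>P. \<bar>\<nu> A\<bar>)" unfolding P_def by (rule sum_mono2) auto
    finally show ?thesis .
  qed
  ultimately show ?thesis by (meson ereal_less_eq(3) order_trans)
qed

lemma sets_upper_variation [measurable_cong, simp]: "sets (upper_variation \<nu>) = sets borel"
  using sets.sigma_sets_eq[of "borel :: real measure"] by (simp add: upper_variation_def)

lemma space_upper_variation [simp]: "space (upper_variation \<nu>) = UNIV"
  by (simp add: upper_variation_def)

text \<open>The suprema in the two variations run over unrelated sets \<open>B\<close> and
  \<open>C\<close>. Their intersection contributes equally to \<open>\<nu> B\<close> and
  \<open>\<nu> C\<close>, so the difference of these values only involves the disjoint sets
  \<open>B - C\<close> and \<open>C - B\<close>, to which the partition bound applies.\<close>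

lemma upper_variation_UNIV_add_le:
  assumes \<nu>: "signed_borel_measure \<nu>" and V: "tv_norm \<nu> \<le> ereal V"
  shows "emeasure (upper_variation \<nu>) UNIV + emeasure (upper_variation (\<lambda>A. - \<nu> A)) UNIV \<le> ennreal V"
proof -
  have pair: "ennreal (\<nu> B) + ennreal (- \<nu> C) \<le> ennreal V" if B: "B \<in> sets borel" and C: "C \<in> sets borel" for B C
  proof -
    have le: "\<bar>\<nu> X\<bar> + \<bar>\<nu> Y\<bar> \<le> V" if "X \<in> sets borel" "Y \<in> sets borel" "X \<inter> Y = {}" for X Y
      using order_trans[OF tv_norm_pair_ge[OF \<nu> that] V] by simp
    have "\<nu> (B - C) = \<nu> B - \<nu> (B \<inter> C)" "\<nu> (C - B) = \<nu> C - \<nu> (B \<inter> C)"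
      using signed_measure_Diff[OF \<nu> B, of "B \<inter> C"] signed_measure_Diff[OF \<nu> C, of "B \<inter> C"] B C
      by (simp_all add: Diff_Int)
    moreover have "\<bar>\<nu> (B - C)\<bar> + \<bar>\<nu> (C - B)\<bar> \<le> V" using B C by (intro le) auto
    \<comment> \<open>Pairs with the empty set cover the cases in which one of the two values is
      negative and \<open>ennreal\<close> truncates it to 0.\<close>
    moreover have "\<bar>\<nu> B\<bar> + \<bar>\<nu> {}\<bar> \<le> V" "\<bar>\<nu> C\<bar> + \<bar>\<nu> {}\<bar> \<le> V" using B C by (auto intro!: le)
    ultimately have "max 0 (\<nu> B) + max 0 (- \<nu> C) \<le> V"
      using signed_measure_empty[OF \<nu>] unfolding max_def by (smt (verit))
    then have "ennreal (max 0 (\<nu> B) + max 0 (- \<nu> C)) \<le> ennreal V" by (rule ennreal_leI)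
    then show ?thesis by (simp add: ennreal_plus ennreal_max_0' max_def ennreal_neg split: if_splits)
  qed
  have UNIV_borel: "(UNIV :: real set) \<in> sets borel" by simp
  have ne: "{B\<in>sets borel. B \<subseteq> (UNIV :: real set)} \<noteq> {}" by blast
  have "emeasure (upper_variation \<nu>) UNIV + ennreal (- \<nu> C) \<le> ennreal V" if C: "C \<in> sets borel" for C
  proof -
    have "emeasure (upper_variation \<nu>) UNIV + ennreal (- \<nu> C)
        = (SUP B\<in>{B\<in>sets borel. B \<subseteq> UNIV}. ennreal (\<nu> B) + ennreal (- \<nu> C))"
      unfolding emeasure_upper_variation[OF \<nu> UNIV_borel]
      by (rule ennreal_SUP_add_left[OF ne, symmetric])
    also have "\<dots> \<le> ennreal V" by (intro SUP_least pair) (use C in auto)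
    finally show ?thesis .
  qed
  then have "(SUP C\<in>{C\<in>sets borel. C \<subseteq> UNIV}. ennreal (- \<nu> C) + emeasure (upper_variation \<nu>) UNIV) \<le> ennreal V"
    by (intro SUP_least) (auto simp: add.commute)
  then show ?thesis
    unfolding emeasure_upper_variation[OF signed_measure_uminus[OF \<nu>] UNIV_borel]
      ennreal_SUP_add_left[OF ne] by (simp add: add.commute)
qed

section \<open>Jordan decomposition of a signed measure of finite variation\<close>

locale finite_variation =
  fixes \<nu> :: "real set \<Rightarrow> real" and V :: real
  assumes \<nu>: "signed_borel_measure \<nu>" and V: "tv_norm \<nu> \<le> ereal V"
begin

abbreviation "pos \<equiv> upper_variation \<nu>"
abbreviation "neg \<equiv> upper_variation (\<lambda>A. - \<nu> A)"

sublocale pos: finite_measure pos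
proof
  have "emeasure pos UNIV \<le> emeasure pos UNIV + emeasure neg UNIV" by simp
  then show "emeasure pos (space pos) \<noteq> \<infinity>"
    using upper_variation_UNIV_add_le[OF \<nu> V] by (auto simp: top_unique)
qed

sublocale neg: finite_measure neg
proof
  have "emeasure neg UNIV \<le> emeasure pos UNIV + emeasure neg UNIV" by simp
  then show "emeasure neg (space neg) \<noteq> \<infinity>"
    using upper_variation_UNIV_add_le[OF \<nu> V] by (auto simp: top_unique)
qed

lemma V_nonneg: "0 \<le> V"
  using order_trans[OF tv_norm_pair_ge[OF \<nu>, of "{}" "{}"] V] by (simp add: signed_measure_empty[OF \<nu>])

lemma mass_le: "measure pos UNIV + measure neg UNIV \<le> V"
proof -
  have "ennreal (measure pos UNIV + measure neg UNIV) = emeasure pos UNIV + emeasure neg UNIV"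
    by (simp add: pos.emeasure_eq_measure neg.emeasure_eq_measure)
  also have "\<dots> \<le> ennreal V" by (rule upper_variation_UNIV_add_le[OF \<nu> V])
  finally show ?thesis using V_nonneg by (simp only: ennreal_le_iff)
qed

lemma measure_ge:
  assumes "A \<in> sets borel" "B \<in> sets borel" "B \<subseteq> A"
  shows "\<nu> B \<le> measure pos A" "- \<nu> B \<le> measure neg A"
proof -
  have "ennreal (\<nu> B) \<le> emeasure pos A"
    unfolding emeasure_upper_variation[OF \<nu> assms(1)] using assms by (intro SUP_upper) auto
  then show "\<nu> B \<le> measure pos A" by (simp add: pos.emeasure_eq_measure)
  have "ennreal (- \<nu> B) \<le> emeasure neg A"
    unfolding emeasure_upper_variation[OF signed_measure_uminus[OF \<nu>] assms(1)]
    using assms by (intro SUP_upper) auto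
  then show "- \<nu> B \<le> measure neg A" by (simp add: neg.emeasure_eq_measure)
qed

lemma measure_le:
  assumes "A \<in> sets borel"
  shows "(\<And>B. B \<in> sets borel \<Longrightarrow> B \<subseteq> A \<Longrightarrow> \<nu> B \<le> r) \<Longrightarrow> measure pos A \<le> r"
    and "(\<And>B. B \<in> sets borel \<Longrightarrow> B \<subseteq> A \<Longrightarrow> - \<nu> B \<le> r) \<Longrightarrow> measure neg A \<le> r"
proof -
  have \<nu>0: "\<nu> {} = 0" by (rule signed_measure_empty[OF \<nu>])
  show "measure pos A \<le> r" if r: "\<And>B. B \<in> sets borel \<Longrightarrow> B \<subseteq> A \<Longrightarrow> \<nu> B \<le> r"
  proof -
    have "emeasure pos A \<le> ennreal r"
      unfolding emeasure_upper_variation[OF \<nu> assms(1)] using r by (intro SUP_least ennreal_leI) auto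
    moreover have "0 \<le> r" using r[of "{}"] \<nu>0 by simp
    ultimately show ?thesis by (simp add: pos.emeasure_eq_measure)
  qed
  show "measure neg A \<le> r" if r: "\<And>B. B \<in> sets borel \<Longrightarrow> B \<subseteq> A \<Longrightarrow> - \<nu> B \<le> r"
  proof -
    have "emeasure neg A \<le> ennreal r"
      unfolding emeasure_upper_variation[OF signed_measure_uminus[OF \<nu>] assms(1)]
      using r by (intro SUP_least ennreal_leI) auto
    moreover have "0 \<le> r" using r[of "{}"] \<nu>0 by simp
    ultimately show ?thesis by (simp add: neg.emeasure_eq_measure)
  qed
qed

text \<open>For \<open>B \<subseteq> A\<close>, the value
  \<open>\<nu> B = \<nu> A - \<nu> (A - B)\<close> is at most \<open>\<nu> A\<close> plus the lower
  variation of \<open>A\<close>. The supremum over \<open>B\<close> gives one inequality, and the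
  same argument for \<open>- \<nu>\<close> the other.\<close>

lemma jordan_decomposition:
  assumes A: "A \<in> sets borel"
  shows "\<nu> A = measure pos A - measure neg A"
proof (rule antisym)
  have d: "\<nu> (A - B) = \<nu> A - \<nu> B" if "B \<in> sets borel" "B \<subseteq> A" for B
    by (rule signed_measure_Diff[OF \<nu> A that])
  have "measure pos A \<le> \<nu> A + measure neg A"
  proof (rule measure_le(1)[OF A])
    fix B assume B: "B \<in> sets borel" "B \<subseteq> A"
    show "\<nu> B \<le> \<nu> A + measure neg A" using measure_ge(2)[OF A, of "A - B"] A B d[OF B] by simp
  qed
  then show "measure pos A - measure neg A \<le> \<nu> A" by simp
  have "measure neg A \<le> measure pos A - \<nu> A"
  proof (rule measure_le(2)[OF A])
    fix B assume B: "B \<in> sets borel" "B \<subseteq> A"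
    show "- \<nu> B \<le> measure pos A - \<nu> A" using measure_ge(1)[OF A, of "A - B"] A B d[OF B] by simp
  qed
  then show "\<nu> A \<le> measure pos A - measure neg A" by simp
qed

lemma abs_le_variation: "A \<in> sets borel \<Longrightarrow> \<bar>\<nu> A\<bar> \<le> measure pos A + measure neg A"
  using jordan_decomposition[of A] measure_nonneg[of pos A] measure_nonneg[of neg A] by linarith

end

lemma measurable_upper_variation:
  "f \<in> borel_measurable borel \<Longrightarrow> f \<in> borel_measurable (upper_variation \<nu>)"
  by (simp cong: measurable_cong_sets)

lemma finite_borel: "finite T \<Longrightarrow> T \<in> sets borel" for T :: "real set"
  by (intro borel_closed finite_imp_closed)

lemma integral_finite_part:
  fixes p :: "real measure" and f :: "real \<Rightarrow> real"
  assumes fin: "finite_measure p" and sets: "sets p = sets borel" and T: "finite T"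
    and f: "integrable p f"
  shows "(\<integral>t. f t \<partial>p) = (\<Sum>t\<in>T. f t * measure p {t}) + (\<integral>t. f t * indicator (- T) t \<partial>p)"
proof -
  interpret finite_measure p by fact
  have Tm: "{t} \<in> sets p" "- T \<in> sets p" for t
    unfolding sets using T by (simp, intro borel_comp borel_closed finite_imp_closed)
  have "f t = (\<Sum>k\<in>T. f k * indicator {k} t) + f t * indicator (- T) t" for t
  proof (cases "t \<in> T")
    case True
    then have "(\<Sum>k\<in>T. f k * indicator {k} t) = f t"
      using T by (simp add: indicator_def sum.remove[of T t])
    then show ?thesis using True by simp
  next
    case False
    then have "(\<Sum>k\<in>T. f k * indicator {k} t) = 0" by (intro sum.neutral) (auto simp: indicator_def)
    then show ?thesis using False by simp
  qed
  then have "(\<integral>t. f t \<partial>p) = (\<integral>t. (\<Sum>k\<in>T. f k * indicator {k} t) + f t * indicator (- T) t \<partial>p)"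
    by (rule Bochner_Integration.integral_cong[OF refl])
  also have "\<dots> = (\<integral>t. (\<Sum>k\<in>T. f k * indicator {k} t) \<partial>p) + (\<integral>t. f t * indicator (- T) t \<partial>p)"
    using Tm f by (intro Bochner_Integration.integral_add Bochner_Integration.integrable_sum
      integrable_mult_right integrable_real_indicator integrable_real_mult_indicator)
      (auto simp: emeasure_eq_measure)
  also have "(\<integral>t. (\<Sum>k\<in>T. f k * indicator {k} t) \<partial>p) = (\<Sum>k\<in>T. f k * measure p {k})"
    using Tm by (subst Bochner_Integration.integral_sum) (auto simp: emeasure_eq_measure)
  finally show ?thesis .
qed

text \<open>Strictness comes from a pointwise strict inequality on a set of positive measure; no
  uniform gap between \<open>\<bar>f\<bar>\<close> and 1 is involved.\<close>

lemma integral_off_support_bound: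
  fixes p :: "real measure" and f :: "real \<Rightarrow> real"
  assumes fin: "finite_measure p" and sets: "sets p = sets borel" and A: "A \<in> sets borel"
    and f: "integrable p f" and f1: "\<And>t. t \<in> A \<Longrightarrow> \<bar>f t\<bar> < 1"
  shows "\<bar>\<integral>t. f t * indicator A t \<partial>p\<bar> \<le> measure p A"
    and "measure p A \<noteq> 0 \<Longrightarrow> \<bar>\<integral>t. f t * indicator A t \<partial>p\<bar> < measure p A"
proof -
  interpret finite_measure p by fact
  have Am: "A \<in> sets p" using A sets by simp
  have int: "integrable p (\<lambda>t. f t * indicator A t)"
    using f Am by (rule integrable_real_mult_indicator[rotated])
  have ind: "integrable p (indicator A :: real \<Rightarrow> real)" "(\<integral>t. indicator A t \<partial>p) = measure p A"
    using Am by (auto simp: emeasure_eq_measure)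
  have le: "\<bar>\<integral>t. f t * indicator A t \<partial>p\<bar> \<le> (\<integral>t. \<bar>f t * indicator A t\<bar> \<partial>p)"
    by (rule integral_abs_bound)
  also have "\<dots> \<le> (\<integral>t. indicator A t \<partial>p)"
    using int ind f1 by (intro integral_mono) (auto simp: less_imp_le split: split_indicator)
  finally show "\<bar>\<integral>t. f t * indicator A t \<partial>p\<bar> \<le> measure p A" using ind by simp
  assume "measure p A \<noteq> 0"
  then have "emeasure p A \<noteq> 0" by (simp add: emeasure_eq_measure)
  then have "(\<integral>t. \<bar>f t * indicator A t\<bar> \<partial>p) < (\<integral>t. indicator A t \<partial>p)"
    by (intro integral_less_AE[where A = A])
      (use int ind Am f1 in \<open>auto simp: less_imp_le less_imp_neq intro!: AE_I2 split: split_indicator\<close>)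
  from this[unfolded ind(2)] le show "\<bar>\<integral>t. f t * indicator A t \<partial>p\<bar> < measure p A" by linarith
qed

section \<open>Dirac combs and the mass outside a finite set\<close>

lemma signed_measure_dirac_comb:
  assumes "finite T"
  shows "signed_borel_measure (dirac_comb T a)"
proof -
  have notin: "measure (return borel t) A = 0" if "A \<notin> sets borel" for t :: real and A
    using that by (simp add: measure_notin_sets)
  have "(\<lambda>i. measure (return borel t) (F i)) sums measure (return borel t) (\<Union>i. F i)"
    if "range F \<subseteq> sets borel" "disjoint_family F" for F :: "nat \<Rightarrow> real set" and t
  proof -
    interpret prob_space "return borel t" by (rule prob_space_return) simp
    show ?thesis by (rule finite_measure_UNION) (use that in auto)
  qed
  then show ?thesis
    unfolding signed_borel_measure_def dirac_comb_def
    by (auto simp: notin intro!: sums_sum sums_mult)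
qed

lemma dirac_comb_borel:
  assumes "finite T" "A \<in> sets borel"
  shows "dirac_comb T a A = (\<Sum>t\<in>T \<inter> A. a t)"
proof -
  have "dirac_comb T a A = (\<Sum>t\<in>T. if t \<in> A then a t else 0)"
    unfolding dirac_comb_def using assms by (intro sum.cong) (auto simp: measure_return indicator_def)
  then show ?thesis using assms by (simp add: sum.If_cases Int_commute)
qed

lemma dirac_comb_singleton: "finite T \<Longrightarrow> t \<in> T \<Longrightarrow> dirac_comb T a {t} = a t"
  by (simp add: dirac_comb_borel)

lemma tv_norm_dirac_comb:
  assumes T: "finite T"
  shows "tv_norm (dirac_comb T a) \<le> ereal (\<Sum>t\<in>T. \<bar>a t\<bar>)"
  unfolding tv_norm_def
proof (rule SUP_least)
  fix P :: "real set set" assume "P \<in> {P. finite P \<and> P \<subseteq> sets borel \<and> partition_on UNIV P}"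
  then have P: "finite P" "P \<subseteq> sets borel" "partition_on UNIV P" by auto
  have "(\<Sum>A\<in>P. \<bar>dirac_comb T a A\<bar>) \<le> (\<Sum>A\<in>P. \<Sum>t\<in>T \<inter> A. \<bar>a t\<bar>)"
    using P T by (intro sum_mono) (auto simp: dirac_comb_borel subset_iff intro: sum_abs)
  also have "\<dots> = sum (\<lambda>t. \<bar>a t\<bar>) (\<Union>A\<in>P. T \<inter> A)"
  proof (rule sum.UNION_disjoint[symmetric])
    have "A \<inter> B = {}" if "A \<in> P" "B \<in> P" "A \<noteq> B" for A B
      using disjointD[OF partition_onD2[OF P(3)] that] .
    then show "\<forall>A\<in>P. \<forall>B\<in>P. A \<noteq> B \<longrightarrow> T \<inter> A \<inter> (T \<inter> B) = {}" by blast
  qed (use P T in auto)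
  also have "(\<Union>A\<in>P. T \<inter> A) = T" using P(3) by (auto simp: partition_on_def)
  finally show "ereal (\<Sum>A\<in>P. \<bar>dirac_comb T a A\<bar>) \<le> ereal (\<Sum>t\<in>T. \<bar>a t\<bar>)" by simp
qed

context finite_variation
begin

text \<open>The variation mass outside \<open>T\<close>: the quantity that absorbs, with a strict
  inequality unless it is 0, the integral of a function of modulus below 1 off
  \<open>T\<close>.\<close>

definition rest :: "real set \<Rightarrow> real" where
  "rest T = measure pos (- T) + measure neg (- T)"

lemma integrable_bounded:
  fixes f :: "real \<Rightarrow> real"
  assumes "f \<in> borel_measurable borel" "\<And>t. \<bar>f t\<bar> \<le> C"
  shows "integrable pos f" "integrable neg f"
  using assms
  by (auto intro!: pos.integrable_const_bound[of _ C] neg.integrable_const_bound[of _ C]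
      measurable_upper_variation)

lemma sum_atoms_le:
  assumes T: "finite T"
  shows "(\<Sum>t\<in>T. \<bar>\<nu> {t}\<bar>) + rest T \<le> V"
proof -
  have "- T \<in> sets borel" "T \<in> sets borel"
    using finite_borel[OF T] by auto
  have "measure M UNIV = (\<Sum>t\<in>T. measure M {t}) + measure M (- T)"
    if M: "finite_measure M" "sets M = sets borel" for M
  proof -
    interpret finite_measure M by (rule M)
    have "measure M (T \<union> - T) = measure M T + measure M (- T)"
      by (rule finite_measure_Union) (use M \<open>- T \<in> sets borel\<close> \<open>T \<in> sets borel\<close> in auto)
    moreover have "measure M T = (\<Sum>t\<in>T. measure M {t})"
      using T M by (intro finite_measure_eq_sum_singleton) auto
    ultimately show ?thesis by simp
  qed
  from this[of pos] this[of neg] have "(\<Sum>t\<in>T. measure pos {t} + measure neg {t}) + rest T \<le> V"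
    using mass_le by (simp add: pos.finite_measure_axioms neg.finite_measure_axioms rest_def sum.distrib)
  moreover have "(\<Sum>t\<in>T. \<bar>\<nu> {t}\<bar>) \<le> (\<Sum>t\<in>T. measure pos {t} + measure neg {t})"
    by (intro sum_mono abs_le_variation) simp
  ultimately show ?thesis by simp
qed

lemma signed_integral_atoms:
  assumes T: "finite T" and f: "f \<in> borel_measurable borel" "\<And>t. \<bar>f t\<bar> \<le> C"
    and f1: "\<And>t. t \<notin> T \<Longrightarrow> \<bar>f t\<bar> < 1"
  shows "\<bar>signed_integral \<nu> f - (\<Sum>t\<in>T. f t * \<nu> {t})\<bar> \<le> rest T"
    and "rest T \<noteq> 0 \<Longrightarrow> \<bar>signed_integral \<nu> f - (\<Sum>t\<in>T. f t * \<nu> {t})\<bar> < rest T"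
proof -
  note int = integrable_bounded[OF f]
  have Tc: "- T \<in> sets borel" using finite_borel[OF T] by auto
  define P where "P = (\<integral>t. f t * indicator (- T) t \<partial>pos)"
  define N where "N = (\<integral>t. f t * indicator (- T) t \<partial>neg)"
  have "signed_integral \<nu> f = (\<Sum>t\<in>T. f t * measure pos {t}) - (\<Sum>t\<in>T. f t * measure neg {t}) + (P - N)"
    unfolding signed_integral_def P_def N_def
      integral_finite_part[OF pos.finite_measure_axioms sets_upper_variation T int(1)]
      integral_finite_part[OF neg.finite_measure_axioms sets_upper_variation T int(2)] by simp
  also have "(\<Sum>t\<in>T. f t * measure pos {t}) - (\<Sum>t\<in>T. f t * measure neg {t}) = (\<Sum>t\<in>T. f t * \<nu> {t})"
    unfolding sum_subtractf[symmetric] by (rule sum.cong) (simp_all add: jordan_decomposition algebra_simps)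
  finally have eq: "signed_integral \<nu> f - (\<Sum>t\<in>T. f t * \<nu> {t}) = P - N" by simp
  have f1': "\<bar>f t\<bar> < 1" if "t \<in> - T" for t using f1 that by simp
  note bp = integral_off_support_bound[OF pos.finite_measure_axioms sets_upper_variation Tc int(1) f1', folded P_def]
  note bn = integral_off_support_bound[OF neg.finite_measure_axioms sets_upper_variation Tc int(2) f1', folded N_def]
  show "\<bar>signed_integral \<nu> f - (\<Sum>t\<in>T. f t * \<nu> {t})\<bar> \<le> rest T"
    unfolding eq rest_def using bp(1) bn(1) by simp
  show "\<bar>signed_integral \<nu> f - (\<Sum>t\<in>T. f t * \<nu> {t})\<bar> < rest T" if "rest T \<noteq> 0"
  proof -
    have "measure pos (- T) \<noteq> 0 \<or> measure neg (- T) \<noteq> 0" using that by (auto simp: rest_def)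
    then show ?thesis unfolding eq rest_def
      using bp(1) bn(1) bp(2) bn(2) by (auto simp: abs_less_iff abs_le_iff)
  qed
qed

lemma signed_integral_sum:
  assumes "\<And>i. i \<in> I \<Longrightarrow> f i \<in> borel_measurable borel" "\<And>i t. i \<in> I \<Longrightarrow> \<bar>f i t\<bar> \<le> C"
  shows "signed_integral \<nu> (\<lambda>t. \<Sum>i\<in>I. q i * f i t) = (\<Sum>i\<in>I. q i * signed_integral \<nu> (f i))"
proof -
  have int: "integrable pos (f i)" "integrable neg (f i)" if "i \<in> I" for i
    using integrable_bounded[of "f i" C] assms that by auto
  have "(\<integral>t. (\<Sum>i\<in>I. q i * f i t) \<partial>pos) = (\<Sum>i\<in>I. q i * (\<integral>t. f i t \<partial>pos))"
    "(\<integral>t. (\<Sum>i\<in>I. q i * f i t) \<partial>neg) = (\<Sum>i\<in>I. q i * (\<integral>t. f i t \<partial>neg))"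
    using int by (subst Bochner_Integration.integral_sum; simp)+
  then show ?thesis by (simp add: signed_integral_def sum_subtractf right_diff_distrib)
qed

lemma rest_nonneg: "0 \<le> rest T" by (simp add: rest_def)

lemma concentrated_eq_dirac_comb:
  assumes T: "finite T" and r: "rest T = 0"
  shows "\<nu> = dirac_comb T (\<lambda>t. \<nu> {t})"
proof
  fix A
  show "\<nu> A = dirac_comb T (\<lambda>t. \<nu> {t}) A"
  proof (cases "A \<in> sets borel")
    case False
    then have "measure (return borel t) A = 0" for t by (simp add: measure_notin_sets)
    then show ?thesis using \<nu> False by (simp add: dirac_comb_def signed_borel_measure_def)
  next
    case True
    have Tb: "T \<in> sets borel" by (rule finite_borel[OF T])
    have zero: "measure pos (- T) = 0" "measure neg (- T) = 0"
      using r measure_nonneg[of pos "- T"] measure_nonneg[of neg "- T"] unfolding rest_def by linarith+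
    have "measure pos (A - T) \<le> measure pos (- T)" "measure neg (A - T) \<le> measure neg (- T)"
      using Tb True by (auto intro!: pos.finite_measure_mono neg.finite_measure_mono)
    then have "measure pos (A - T) \<le> 0" "measure neg (A - T) \<le> 0" using zero by simp_all
    then have "\<nu> (A - T) = 0" using abs_le_variation[of "A - T"] True Tb by simp
    moreover have "\<nu> ((A - T) \<union> (T \<inter> A)) = \<nu> (A - T) + \<nu> (T \<inter> A)"
      using True Tb by (intro signed_measure_Un[OF \<nu>]) auto
    moreover have "(A - T) \<union> (T \<inter> A) = A" by auto
    moreover have "\<nu> (T \<inter> A) = (\<Sum>t\<in>T \<inter> A. \<nu> {t})" using T by (intro signed_measure_finite[OF \<nu>]) auto
    ultimately show ?thesis using True T by (simp add: dirac_comb_borel)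
  qed
qed

end

lemma tv_norm_nonneg: "signed_borel_measure \<nu> \<Longrightarrow> 0 \<le> tv_norm \<nu>"
  using tv_norm_pair_ge[of \<nu> "{}" "{}"] by (simp add: signed_measure_empty zero_ereal_def)

text \<open>Let \<open>b\<close> and \<open>e\<close> be the differences of spikes and noise between
  competitor and truth. Pairing the constraints with \<open>q\<close> shows that the mass of
  \<open>b\<close> on \<open>T\<close>, plus \<open>l\<close> times that of \<open>e\<close> on the
  corrupted samples, is strictly smaller than what the competitor spends off these supports; the
  triangle inequality transfers this gain to the objective.\<close>

theorem unique_minimizer_if_dual_vectors:
  fixes K :: "real \<Rightarrow> real" and s w y :: "nat \<Rightarrow> real"
  assumes T: "finite T" "T \<subseteq> X" and K: "continuous_on UNIV K" "\<And>u. \<bar>K u\<bar> \<le> C"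
    and w: "w \<in> {1..n} \<rightarrow>\<^sub>E UNIV" and l: "0 < l"
    and y: "\<And>i. i \<in> {1..n} \<Longrightarrow> y i = conv_measure K (dirac_comb T a) (s i) + w i"
    and dual: "\<And>\<epsilon> \<delta> :: _ \<Rightarrow> real. (\<And>t. \<bar>\<epsilon> t\<bar> = 1) \<Longrightarrow> (\<And>i. \<bar>\<delta> i\<bar> = 1) \<Longrightarrow>
      \<exists>q. (\<forall>t\<in>T. (\<Sum>i\<in>{1..n}. q i * K (s i - t)) = \<epsilon> t)
        \<and> (\<forall>t. t \<notin> T \<longrightarrow> \<bar>\<Sum>i\<in>{1..n}. q i * K (s i - t)\<bar> < 1)
        \<and> (\<forall>i\<in>{1..n}. if w i \<noteq> 0 then q i = l * \<delta> i else \<bar>q i\<bar> < l)"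
  shows "is_arg_min (objective l n) (feasible K n s y X) p \<longleftrightarrow> p = (dirac_comb T a, w)"
proof -
  define \<mu> where "\<mu> = dirac_comb T a"
  have \<mu>: "signed_borel_measure \<mu>" unfolding \<mu>_def by (rule signed_measure_dirac_comb[OF T(1)])
  have tv_\<mu>: "tv_norm \<mu> \<le> ereal (\<Sum>t\<in>T. \<bar>a t\<bar>)" unfolding \<mu>_def by (rule tv_norm_dirac_comb[OF T(1)])
  have \<mu>_atom: "\<mu> {t} = a t" if "t \<in> T" for t unfolding \<mu>_def by (rule dirac_comb_singleton[OF T(1) that])
  have feas: "feasible K n s y X (\<mu>, w)"
    using \<mu> w y T by (auto simp: feasible_def supported_on_def \<mu>_def dirac_comb_borel intro!: sum.neutral)
  have Km: "(\<lambda>t. K (s i - t)) \<in> borel_measurable borel" for i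
    using borel_measurable_continuous_onI[OF K(1)] by (rule measurable_compose[rotated]) simp
  have strict: "objective l n (\<mu>, w) < objective l n (\<nu>, v)"
    if f: "feasible K n s y X (\<nu>, v)" and ne: "(\<nu>, v) \<noteq> (\<mu>, w)" for \<nu> v
  proof -
    have \<nu>: "signed_borel_measure \<nu>" and v: "v \<in> {1..n} \<rightarrow>\<^sub>E UNIV"
      and eq: "\<And>i. i \<in> {1..n} \<Longrightarrow> conv_measure K \<nu> (s i) + v i = conv_measure K \<mu> (s i) + w i"
      using f y by (auto simp: feasible_def \<mu>_def)
    define l\<^sub>w l\<^sub>v where "l\<^sub>w = l * (\<Sum>i\<in>{1..n}. \<bar>w i\<bar>)" and "l\<^sub>v = l * (\<Sum>i\<in>{1..n}. \<bar>v i\<bar>)"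
    have obj: "objective l n (\<mu>, w) \<le> ereal ((\<Sum>t\<in>T. \<bar>a t\<bar>) + l\<^sub>w)" "objective l n (\<nu>, v) = tv_norm \<nu> + ereal l\<^sub>v"
      using add_right_mono[OF tv_\<mu>, of "ereal l\<^sub>w"] by (simp_all add: objective_def l\<^sub>w_def l\<^sub>v_def)
    show ?thesis
    proof (cases "tv_norm \<nu>")
      case PInf
      then have "objective l n (\<nu>, v) = \<infinity>" by (simp add: obj)
      moreover have "objective l n (\<mu>, w) < \<infinity>" by (rule le_less_trans[OF obj(1)]) simp
      ultimately show ?thesis by simp
    next
      case MInf
      then show ?thesis using tv_norm_nonneg[OF \<nu>] by simp
    next
      case (real V)
      interpret \<nu>: finite_variation \<nu> V by unfold_locales (use \<nu> real in auto)
      interpret \<mu>: finite_variation \<mu> "\<Sum>t\<in>T. \<bar>a t\<bar>" by unfold_locales (use \<mu> tv_\<mu> in auto)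
      define b where "b t = \<nu> {t} - a t" for t
      define e where "e i = v i - w i" for i
      \<comment> \<open>The convention \<open>sg 0 = 1\<close> yields the full sign patterns that
        \<open>dual\<close> asks for, and \<open>sg r * r = \<bar>r\<bar>\<close> also holds at
        0.\<close>
      define sg :: "real \<Rightarrow> real" where "sg r = (if 0 \<le> r then 1 else - 1)" for r
      have sg: "\<bar>sg r\<bar> = 1" "sg r * r = \<bar>r\<bar>" for r by (auto simp: sg_def)
      have "\<exists>q. (\<forall>t\<in>T. (\<Sum>i\<in>{1..n}. q i * K (s i - t)) = sg (b t))
          \<and> (\<forall>t. t \<notin> T \<longrightarrow> \<bar>\<Sum>i\<in>{1..n}. q i * K (s i - t)\<bar> < 1)
          \<and> (\<forall>i\<in>{1..n}. if w i \<noteq> 0 then q i = l * sg (e i) else \<bar>q i\<bar> < l)"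
        by (rule dual) (rule sg(1))+
      then obtain q where qT: "\<And>t. t \<in> T \<Longrightarrow> (\<Sum>i\<in>{1..n}. q i * K (s i - t)) = sg (b t)"
        and q1: "\<And>t. t \<notin> T \<Longrightarrow> \<bar>\<Sum>i\<in>{1..n}. q i * K (s i - t)\<bar> < 1"
        and qN: "\<And>i. i \<in> {1..n} \<Longrightarrow> if w i \<noteq> 0 then q i = l * sg (e i) else \<bar>q i\<bar> < l"
        by (elim exE conjE) blast
      define Q where "Q t = (\<Sum>i\<in>{1..n}. q i * K (s i - t))" for t
      have Qm: "Q \<in> borel_measurable borel" unfolding Q_def using Km by measurable
      have QC: "\<bar>Q t\<bar> \<le> (\<Sum>i\<in>{1..n}. \<bar>q i\<bar> * C)" for t
        unfolding Q_def using K(2) by (intro order_trans[OF sum_abs] sum_mono) (simp add: abs_mult mult_left_mono)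
      have Q1: "\<bar>Q t\<bar> < 1" if "t \<notin> T" for t using q1[OF that] by (simp add: Q_def)
      have pair_\<nu>: "signed_integral \<nu> Q = (\<Sum>i\<in>{1..n}. q i * conv_measure K \<nu> (s i))"
        unfolding Q_def conv_measure_def by (rule \<nu>.signed_integral_sum[where C = C]) (use Km K in auto)
      have pair_\<mu>: "signed_integral \<mu> Q = (\<Sum>i\<in>{1..n}. q i * conv_measure K \<mu> (s i))"
        unfolding Q_def conv_measure_def by (rule \<mu>.signed_integral_sum[where C = C]) (use Km K in auto)
      \<comment> \<open>The atoms in \<open>T\<close> already exhaust the bound on the norm of
        \<open>\<mu>\<close>.\<close>
      have "\<mu>.rest T = 0"
        using \<mu>.sum_atoms_le[OF T(1)] \<mu>.rest_nonneg[of T] \<mu>_atom by simp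
      then have int_\<mu>: "signed_integral \<mu> Q = (\<Sum>t\<in>T. Q t * a t)"
        using \<mu>.signed_integral_atoms(1)[OF T(1) Qm QC Q1] \<mu>_atom by simp
      define R where "R = signed_integral \<nu> Q - (\<Sum>t\<in>T. Q t * \<nu> {t})"
      have R: "\<bar>R\<bar> \<le> \<nu>.rest T" "\<nu>.rest T \<noteq> 0 \<Longrightarrow> \<bar>R\<bar> < \<nu>.rest T"
        unfolding R_def using \<nu>.signed_integral_atoms[OF T(1) Qm QC Q1] by blast+
      define S S' where "S = {i\<in>{1..n}. w i \<noteq> 0}" and "S' = {i\<in>{1..n}. w i = 0}"
      have split: "(\<Sum>i\<in>{1..n}. g i) = (\<Sum>i\<in>S. g i) + (\<Sum>i\<in>S'. g i)" for g :: "nat \<Rightarrow> real"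
        unfolding S_def S'_def by (subst sum.union_disjoint[symmetric]) (auto intro!: sum.cong)
      have "(\<Sum>i\<in>{1..n}. q i * conv_measure K \<nu> (s i)) + (\<Sum>i\<in>{1..n}. q i * e i)
          = (\<Sum>i\<in>{1..n}. q i * conv_measure K \<mu> (s i))"
        unfolding sum.distrib[symmetric] e_def
      proof (rule sum.cong)
        fix i assume "i \<in> {1..n}"
        from eq[OF this] have "conv_measure K \<nu> (s i) + (v i - w i) = conv_measure K \<mu> (s i)" by simp
        then show "q i * conv_measure K \<nu> (s i) + q i * (v i - w i) = q i * conv_measure K \<mu> (s i)"
          by (simp only: distrib_left[symmetric])
      qed simp
      then have "(\<Sum>t\<in>T. Q t * \<nu> {t}) + R + (\<Sum>i\<in>{1..n}. q i * e i) = (\<Sum>t\<in>T. Q t * a t)"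
        using pair_\<nu> pair_\<mu> int_\<mu> by (simp add: R_def)
      moreover have "(\<Sum>t\<in>T. Q t * \<nu> {t}) - (\<Sum>t\<in>T. Q t * a t) = (\<Sum>t\<in>T. \<bar>b t\<bar>)"
        unfolding sum_subtractf[symmetric]
      proof (rule sum.cong)
        fix t assume "t \<in> T"
        then have "Q t = sg (b t)" unfolding Q_def by (rule qT)
        then show "Q t * \<nu> {t} - Q t * a t = \<bar>b t\<bar>" by (simp add: b_def flip: sg(2) right_diff_distrib)
      qed simp
      moreover have "(\<Sum>i\<in>{1..n}. q i * e i) = l * (\<Sum>i\<in>S. \<bar>e i\<bar>) + (\<Sum>i\<in>S'. q i * v i)"
        unfolding split[of "\<lambda>i. q i * e i"] sum_distrib_left
        using qN by (intro arg_cong2[of _ _ _ _ "(+)"] sum.cong) (auto simp: S_def S'_def e_def mult.assoc sg(2))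
      ultimately have key: "(\<Sum>t\<in>T. \<bar>b t\<bar>) + l * (\<Sum>i\<in>S. \<bar>e i\<bar>) = - R - (\<Sum>i\<in>S'. q i * v i)" by linarith
      have le: "- (q i * v i) \<le> l * \<bar>v i\<bar>" if "i \<in> S'" for i
      proof -
        have "\<bar>q i\<bar> \<le> l" using qN[of i] that by (auto simp: S'_def)
        then have "\<bar>q i\<bar> * \<bar>v i\<bar> \<le> l * \<bar>v i\<bar>" by (rule mult_right_mono) simp
        then show ?thesis using abs_ge_minus_self[of "q i * v i"] by (simp add: abs_mult)
      qed
      then have off: "- (\<Sum>i\<in>S'. q i * v i) \<le> (\<Sum>i\<in>S'. l * \<bar>v i\<bar>)"
        unfolding sum_negf[symmetric] by (rule sum_mono)
      have off_strict: "- (\<Sum>i\<in>S'. q i * v i) < (\<Sum>i\<in>S'. l * \<bar>v i\<bar>)" if k: "k \<in> S'" "v k \<noteq> 0" for k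
      proof -
        have "\<bar>q k\<bar> < l" using qN[of k] k by (auto simp: S'_def)
        then have "\<bar>q k\<bar> * \<bar>v k\<bar> < l * \<bar>v k\<bar>" using k by (intro mult_strict_right_mono) auto
        then have "- (q k * v k) < l * \<bar>v k\<bar>" using abs_ge_minus_self[of "q k * v k"] by (simp add: abs_mult)
        then show ?thesis unfolding sum_negf[symmetric]
          using k le by (intro sum_strict_mono_ex1) (auto simp: S'_def)
      qed
      \<comment> \<open>Each off-support estimate is strict unless the corresponding mass is 0.
        Failure of the strict inequality thus makes all of these masses vanish, then
        \<open>b\<close> and \<open>e\<close> as well, and the competitor is
        \<open>(\<mu>, w)\<close>.\<close>
      have slack: "(\<Sum>t\<in>T. \<bar>b t\<bar>) + l * (\<Sum>i\<in>S. \<bar>e i\<bar>) < \<nu>.rest T + (\<Sum>i\<in>S'. l * \<bar>v i\<bar>)"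
      proof (rule ccontr)
        assume "\<not> ?thesis"
        then have ge: "\<nu>.rest T + (\<Sum>i\<in>S'. l * \<bar>v i\<bar>) \<le> - R - (\<Sum>i\<in>S'. q i * v i)" using key by simp
        have r0: "\<nu>.rest T = 0" using R off ge by linarith
        then have R0: "R = 0" using R by simp
        have v0: "v i = 0" if "i \<in> S'" for i using off_strict[OF that] ge r0 R0 by fastforce
        then have z: "(\<Sum>t\<in>T. \<bar>b t\<bar>) + l * (\<Sum>i\<in>S. \<bar>e i\<bar>) = 0" using key R0 by simp
        have "0 \<le> (\<Sum>t\<in>T. \<bar>b t\<bar>)" "0 \<le> l * (\<Sum>i\<in>S. \<bar>e i\<bar>)" using l by (auto intro!: sum_nonneg)
        then have zb: "(\<Sum>t\<in>T. \<bar>b t\<bar>) = 0" and ze: "l * (\<Sum>i\<in>S. \<bar>e i\<bar>) = 0" using z by linarith+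
        have "\<nu> {t} = a t" if "t \<in> T" for t
          using zb that T(1) by (simp add: sum_nonneg_eq_0_iff b_def)
        then have "\<nu> = \<mu>"
          using \<nu>.concentrated_eq_dirac_comb[OF T(1) r0] unfolding \<mu>_def dirac_comb_def by fastforce
        moreover have "v = w"
        proof (rule PiE_ext[OF v w])
          fix i assume i: "i \<in> {1..n}"
          have "(\<Sum>i\<in>S. \<bar>e i\<bar>) = 0" using ze l by simp
          then have "e i = 0" if "i \<in> S" using that by (simp add: sum_nonneg_eq_0_iff S_def)
          then show "v i = w i" using v0[of i] i
            by (cases "w i = 0") (auto simp: S_def S'_def e_def)
        qed
        ultimately show False using ne by simp
      qed
      have "(\<Sum>t\<in>T. \<bar>a t\<bar>) \<le> (\<Sum>t\<in>T. \<bar>\<nu> {t}\<bar> + \<bar>b t\<bar>)" by (intro sum_mono) (simp add: b_def)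
      then have "(\<Sum>t\<in>T. \<bar>a t\<bar>) - (\<Sum>t\<in>T. \<bar>b t\<bar>) + \<nu>.rest T \<le> V"
        using \<nu>.sum_atoms_le[OF T(1)] by (simp add: sum.distrib)
      moreover have "l\<^sub>w \<le> l * (\<Sum>i\<in>S. \<bar>v i\<bar>) + l * (\<Sum>i\<in>S. \<bar>e i\<bar>)"
      proof -
        have "(\<Sum>i\<in>{1..n}. \<bar>w i\<bar>) = (\<Sum>i\<in>S. \<bar>w i\<bar>)" unfolding split[of "\<lambda>i. \<bar>w i\<bar>"] by (simp add: S'_def)
        also have "\<dots> \<le> (\<Sum>i\<in>S. \<bar>v i\<bar> + \<bar>e i\<bar>)" by (intro sum_mono) (simp add: e_def)
        finally show ?thesis unfolding l\<^sub>w_def using l by (simp add: sum.distrib mult_left_mono flip: distrib_left)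
      qed
      moreover have "l\<^sub>v = l * (\<Sum>i\<in>S. \<bar>v i\<bar>) + (\<Sum>i\<in>S'. l * \<bar>v i\<bar>)"
        unfolding l\<^sub>v_def split[of "\<lambda>i. \<bar>v i\<bar>"] by (simp add: distrib_left sum_distrib_left)
      ultimately have "(\<Sum>t\<in>T. \<bar>a t\<bar>) + l\<^sub>w < V + l\<^sub>v" using slack by linarith
      then show ?thesis using obj real by (simp add: le_less_trans)
    qed
  qed
  show ?thesis
  proof
    assume p: "is_arg_min (objective l n) (feasible K n s y X) p"
    show "p = (dirac_comb T a, w)"
    proof (rule ccontr)
      assume "p \<noteq> (dirac_comb T a, w)"
      then have "objective l n (\<mu>, w) < objective l n p"
        using strict[of "fst p" "snd p"] p by (auto simp: is_arg_min_def \<mu>_def)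
      then show False using p feas by (auto simp: is_arg_min_def)
    qed
  next
    assume "p = (dirac_comb T a, w)"
    then show "is_arg_min (objective l n) (feasible K n s y X) p"
      using strict feas order.asym[of "objective l n (\<mu>, w)"] unfolding is_arg_min_def \<mu>_def[symmetric]
      by fastforce
  qed
qed

section \<open>Samples on a grid\<close>

lemma min_separation_ge:
  assumes "ereal r \<le> min_separation A" "a \<in> A" "b \<in> A" "a \<noteq> b"
  shows "r \<le> \<bar>a - b\<bar>"
proof -
  have "min_separation A \<le> ereal \<bar>a - b\<bar>"
    unfolding min_separation_def using assms by (intro INF_lower2[of "(a, b)"]) auto
  then have "ereal r \<le> ereal \<bar>a - b\<bar>" using assms(1) by (rule order_trans[rotated])
  then show ?thesis by simp
qed

lemma gaussian_kernel_eq: "gaussian_kernel \<sigma> u = gauss (u / \<sigma>)"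
  by (simp add: gaussian_kernel_def gauss_def power_divide field_simps)

text \<open>All locations are divided by \<sigma>, and signs are transported back by multiplication
  with \<sigma>. Evenness of the kernel permits the argument sample minus point that the convolution
  produces.\<close>

lemma scaled_certificate_exists:
  fixes T N :: "real set" and u :: "real \<Rightarrow> real"
  assumes \<sigma>: "0 < \<sigma>" and T: "finite T" "separated (15/4 * \<sigma>) T" and N: "finite N" "separated (15/4 * \<sigma>) N"
    and \<tau>: "13/200 * \<sigma> \<le> \<tau>" "\<tau> \<le> 19/80 * \<sigma>"
    and u: "\<And>k. k \<in> T \<Longrightarrow> u k \<le> k \<and> k \<le> u k + \<tau>"
    and \<epsilon>: "\<And>k. \<bar>\<epsilon> k\<bar> = 1" and \<delta>: "\<And>k. \<bar>\<delta> k\<bar> = 1"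
  defines "Q \<equiv> \<lambda>c d t. (\<Sum>k\<in>T. c k * gaussian_kernel \<sigma> (u k - t) + d k * gaussian_kernel \<sigma> (u k + \<tau> - t))
      + (\<Sum>k\<in>N. \<delta> k * (2 * gaussian_kernel \<sigma> (k - t) - gaussian_kernel \<sigma> (k + \<tau> - t)
          - gaussian_kernel \<sigma> (k - \<tau> - t)))"
  shows "\<exists>c d. (\<forall>k\<in>T. \<bar>c k\<bar> < 2 \<and> \<bar>d k\<bar> < 2) \<and> (\<forall>t\<in>T. Q c d t = \<epsilon> t)
    \<and> (\<forall>t. t \<notin> T \<longrightarrow> \<bar>Q c d t\<bar> < 1)"
proof -
  define S where "S A = (\<lambda>a. a / \<sigma>) ` A" for A :: "real set"
  define x where "x k = k - u (\<sigma> * k) / \<sigma>" for k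
  have inj: "inj_on (\<lambda>a. a / \<sigma>) A" for A using \<sigma> by (auto simp: inj_on_def)
  have mem: "t / \<sigma> \<in> S A \<longleftrightarrow> t \<in> A" for t A using \<sigma> by (auto simp: S_def)
  have sep: "separated (15/4) (S A)" if "separated (15/4 * \<sigma>) A" for A
    unfolding separated_def S_def
  proof (intro ballI impI)
    fix p q assume "p \<in> (\<lambda>a. a / \<sigma>) ` A" "q \<in> (\<lambda>a. a / \<sigma>) ` A" "p \<noteq> q"
    then obtain a b where ab: "a \<in> A" "b \<in> A" "p = a / \<sigma>" "q = b / \<sigma>" "a \<noteq> b" by auto
    have "15/4 * \<sigma> \<le> \<bar>a - b\<bar>" by (rule separatedD[OF that]) (use ab in auto)
    then show "15/4 \<le> \<bar>p - q\<bar>" using \<sigma>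
      by (simp add: ab pos_le_divide_eq abs_divide flip: diff_divide_distrib)
  qed
  have cancel: "\<sigma> * (a / \<sigma>) = a" for a using \<sigma> by simp
  obtain c d where c: "\<And>k. k \<in> S T \<Longrightarrow> \<bar>c k\<bar> < 2 \<and> \<bar>d k\<bar> < 2"
    and cT: "\<And>t. t \<in> S T \<Longrightarrow> (\<Sum>k\<in>S T. c k * gauss (t - k + x k) + d k * gauss (t - k + x k - \<tau> / \<sigma>))
        + (\<Sum>k\<in>S N. \<delta> (\<sigma> * k) * second_diff (\<tau> / \<sigma>) gauss (t - k)) = \<epsilon> (\<sigma> * t)"
    and c1: "\<And>t. t \<notin> S T \<Longrightarrow> \<bar>(\<Sum>k\<in>S T. c k * gauss (t - k + x k) + d k * gauss (t - k + x k - \<tau> / \<sigma>))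
        + (\<Sum>k\<in>S N. \<delta> (\<sigma> * k) * second_diff (\<tau> / \<sigma>) gauss (t - k))\<bar> < 1"
  proof (rule dual_certificate_exists[of "S T" "S N" "\<tau> / \<sigma>" x "\<lambda>k. \<epsilon> (\<sigma> * k)" "\<lambda>k. \<delta> (\<sigma> * k)"])
    show "finite (S T)" "finite (S N)" using T N by (simp_all add: S_def)
    show "separated (15/4) (S T)" "separated (15/4) (S N)" using T N sep by auto
    show "13/200 \<le> \<tau> / \<sigma>" "\<tau> / \<sigma> \<le> 19/80" using \<tau> \<sigma> by (simp_all add: pos_le_divide_eq pos_divide_le_eq)
    show "0 \<le> x k \<and> x k \<le> \<tau> / \<sigma>" if k: "k \<in> S T" for k
    proof -
      obtain t where t: "t \<in> T" "k = t / \<sigma>" using k by (auto simp: S_def)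
      have "x k = (t - u t) / \<sigma>" by (simp add: x_def t cancel diff_divide_distrib)
      then show ?thesis using u[OF t(1)] \<sigma> by (simp add: divide_right_mono)
    qed
  qed (use \<epsilon> \<delta> in auto)
  have Q: "(\<Sum>k\<in>S T. c k * gauss (t / \<sigma> - k + x k) + d k * gauss (t / \<sigma> - k + x k - \<tau> / \<sigma>))
        + (\<Sum>k\<in>S N. \<delta> (\<sigma> * k) * second_diff (\<tau> / \<sigma>) gauss (t / \<sigma> - k))
      = Q (\<lambda>k. c (k / \<sigma>)) (\<lambda>k. d (k / \<sigma>)) t" for t
  proof -
    have g: "gauss (p / \<sigma>) = gaussian_kernel \<sigma> (- p)" for p by (simp add: gaussian_kernel_eq gauss_reflect)
    have 1: "p / \<sigma> - r / \<sigma> = (p - r) / \<sigma>" "p / \<sigma> + r / \<sigma> = (p + r) / \<sigma>" for p r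
      by (simp_all add: diff_divide_distrib add_divide_distrib)
    have 2: "(t - k) / \<sigma> + x (k / \<sigma>) = (t - u k) / \<sigma>" for k
      by (simp add: x_def cancel diff_divide_distrib)
    have 3: "- (t - u k) = u k - t" "- (t - u k - \<tau>) = u k + \<tau> - t" "- (t - k) = k - t"
      "- (t - k - \<tau>) = k + \<tau> - t" "- (t - k + \<tau>) = k - \<tau> - t" for k by simp_all
    show ?thesis
      unfolding Q_def S_def sum.reindex[OF inj] o_def second_diff_def cancel 1 2 g 3 ..
  qed
  show ?thesis
  proof (rule exI[of _ "\<lambda>k. c (k / \<sigma>)"], rule exI[of _ "\<lambda>k. d (k / \<sigma>)"], intro conjI ballI allI impI)
    fix t assume "t \<in> T"
    then show "Q (\<lambda>k. c (k / \<sigma>)) (\<lambda>k. d (k / \<sigma>)) t = \<epsilon> t"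
      using cT[of "t / \<sigma>"] by (simp only: Q mem cancel)
  next
    fix t assume "t \<notin> T"
    then show "\<bar>Q (\<lambda>k. c (k / \<sigma>)) (\<lambda>k. d (k / \<sigma>)) t\<bar> < 1"
      using c1[of "t / \<sigma>"] by (simp only: Q mem not_False_eq_True)
  qed (use c mem in auto)
qed

text \<open>
  The cardinality hypotheses on the clean neighbours only serve, through the next lemma, to provide
  two of them for every spike and every corruption.
\<close>

lemma card_Union_pairs:
  assumes "finite A" "\<And>a. a \<in> A \<Longrightarrow> finite (F a) \<and> card (F a) \<le> 2" "card (\<Union>a\<in>A. F a) = 2 * card A"
    and "a \<in> A"
  shows "card (F a) = 2"
proof (rule ccontr)
  assume "card (F a) \<noteq> 2"
  then have "card (F a) < 2" using assms(2)[OF \<open>a \<in> A\<close>] by simp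
  then have "(\<Sum>a\<in>A. card (F a)) < (\<Sum>a\<in>A. 2)"
    using assms by (intro sum_strict_mono_ex1) auto
  moreover have "card (\<Union>a\<in>A. F a) \<le> (\<Sum>a\<in>A. card (F a))" using assms by (intro card_UN_le) auto
  ultimately show False using assms(3) by simp
qed

lemma sum_single:
  fixes f :: "'a \<Rightarrow> real"
  assumes "finite A" "a \<in> A" "\<And>b. b \<in> A \<Longrightarrow> b \<noteq> a \<Longrightarrow> f b = 0"
  shows "sum f A = f a"
proof -
  have "sum f A = sum f {a}" by (rule sum.mono_neutral_right) (use assms in auto)
  then show ?thesis by simp
qed

lemma sum_indicator_index:
  fixes f :: "nat \<Rightarrow> real"
  assumes "j \<in> {1..n}"
  shows "(\<Sum>i\<in>{1..n}. (if i = j then r else 0) * f i) = r * f j"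
proof -
  have "(\<Sum>i\<in>{1..n}. (if i = j then r else 0) * f i) = (\<Sum>i\<in>{1..n}. if i = j then r * f i else 0)"
    by (rule sum.cong) auto
  then show ?thesis using assms by (simp add: sum.delta)
qed

section \<open>Clean neighbours and the dual vector on the grid\<close>

locale sampling_grid =
  fixes n :: nat and s w :: "nat \<Rightarrow> real" and T :: "real set" and \<sigma> \<tau> :: real
  assumes \<sigma>: "0 < \<sigma>" and T: "finite T" and \<tau>: "13/200 * \<sigma> \<le> \<tau>" "\<tau> \<le> 19/80 * \<sigma>"
    and step: "\<And>i. i \<in> {1..n} \<Longrightarrow> i + 1 \<in> {1..n} \<Longrightarrow> s (i + 1) = s i + \<tau>"
    and cardI: "card (spike_neighbors n s w T) = 2 * card T"
    and cardC: "card (noise_neighbors n s w) = 2 * card (noise_locations n s w)"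
    and disj: "noise_neighbors n s w \<inter> spike_neighbors n s w T = {}"
    and sepT: "separated (15/4 * \<sigma>) T" and sepN: "separated (15/4 * \<sigma>) (noise_locations n s w)"
begin

text \<open>Two spikes, or two corruptions, contributing to the same sample would be at most two
  steps apart; the second inequality rules this out.\<close>

lemma \<tau>0: "0 < \<tau>" and \<tau>_small: "2 * \<tau> < 15/4 * \<sigma>"
  using \<sigma> \<tau> by linarith+

lemma s_eq: "i \<in> {1..n} \<Longrightarrow> s i = s 1 + (real i - 1) * \<tau>"
proof (induction i)
  case (Suc i)
  show ?case
  proof (cases "i = 0")
    case False
    have "s (i + 1) = s i + \<tau>" by (rule step) (use Suc.prems False in auto)
    moreover have "s i = s 1 + (real i - 1) * \<tau>" by (rule Suc.IH) (use Suc.prems False in auto)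
    ultimately show ?thesis by (simp add: algebra_simps)
  qed simp
qed simp

lemma s_eq_iff: "i \<in> {1..n} \<Longrightarrow> j \<in> {1..n} \<Longrightarrow> s i = s j \<longleftrightarrow> i = j"
  using \<tau>0 by (simp add: s_eq[of i] s_eq[of j])

lemma s_mono: "i \<in> {1..n} \<Longrightarrow> j \<in> {1..n} \<Longrightarrow> s i < s j \<longleftrightarrow> i < j"
  using \<tau>0 by (simp add: s_eq[of i] s_eq[of j])

definition corrupted :: "nat set" where
  "corrupted = {k \<in> {1..n}. w k \<noteq> 0}"

lemma noise_locations_eq: "noise_locations n s w = s ` corrupted"
  by (auto simp: noise_locations_def corrupted_def)

lemma in_noise_iff: "i \<in> {1..n} \<Longrightarrow> s i \<in> noise_locations n s w \<longleftrightarrow> i \<in> corrupted"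
  using s_eq_iff by (auto simp: noise_locations_eq corrupted_def)

lemma finite_corrupted: "finite corrupted" by (simp add: corrupted_def)

lemma inj_s: "inj_on s {1..n}" using s_eq_iff by (auto simp: inj_on_def)

lemma corrupted_neighbors:
  assumes k: "k \<in> corrupted"
  shows "k - 1 \<in> {1..n}" "k + 1 \<in> {1..n}" "k - 1 \<notin> corrupted" "k + 1 \<notin> corrupted"
    and "s (k - 1) \<in> noise_neighbors n s w" "s (k + 1) \<in> noise_neighbors n s w"
proof -
  \<comment> \<open>The intersection with \<open>{1..n}\<close> discards the index 0, which is
    \<open>k - 1\<close> for \<open>k = 1\<close>, and the index \<open>n + 1\<close>. Two elements
    in \<open>F k\<close> therefore also keep corruptions away from both ends of the grid.\<close>
  define F where "F k = s ` ({k - 1, k + 1} \<inter> {1..n} - corrupted)" for k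
  have eq: "noise_neighbors n s w = (\<Union>k\<in>corrupted. F k)"
  proof (intro set_eqI iffI)
    fix r assume "r \<in> noise_neighbors n s w"
    then obtain i j where ij: "i \<in> {1..n}" "j \<in> {1..n}" "j = i - 1 \<or> j = i + 1" "r = s j"
      "s j \<notin> noise_locations n s w" "s i \<in> noise_locations n s w"
      unfolding noise_neighbors_def by blast
    then have "i \<in> corrupted" "j \<notin> corrupted" using in_noise_iff by auto
    with ij show "r \<in> (\<Union>k\<in>corrupted. F k)" unfolding F_def by blast
  next
    fix r assume "r \<in> (\<Union>k\<in>corrupted. F k)"
    then obtain i j where ij: "i \<in> corrupted" "j \<in> {1..n}" "j \<notin> corrupted" "r = s j" "j = i - 1 \<or> j = i + 1"
      unfolding F_def by blast
    then have "i \<in> {1..n}" "s i \<in> noise_locations n s w" "s j \<in> grid_points n s - noise_locations n s w"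
      using in_noise_iff by (auto simp: corrupted_def grid_points_def)
    with ij show "r \<in> noise_neighbors n s w" unfolding noise_neighbors_def by blast
  qed
  have cF: "finite (F k) \<and> card (F k) \<le> 2" for k
  proof
    show "finite (F k)" by (simp add: F_def)
    have "card (F k) \<le> card {k - 1, k + 1}" unfolding F_def
      by (rule order_trans[OF card_image_le card_mono]) auto
    also have "\<dots> \<le> 2" by (simp add: card_insert_if)
    finally show "card (F k) \<le> 2" .
  qed
  have "card (noise_locations n s w) = card corrupted"
    unfolding noise_locations_eq by (rule card_image) (rule inj_on_subset[OF inj_s], auto simp: corrupted_def)
  then have "card (F k) = 2" using cardC k by (intro card_Union_pairs[OF finite_corrupted cF]) (simp_all add: eq)
  moreover have "card (F k) \<le> card ({k - 1, k + 1} \<inter> {1..n} - corrupted)"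
    unfolding F_def by (rule card_image_le) simp
  ultimately have c2: "2 \<le> card ({k - 1, k + 1} \<inter> {1..n} - corrupted)" by simp
  have "{k - 1, k + 1} \<inter> {1..n} - corrupted = {k - 1, k + 1}"
    by (rule card_seteq) (use c2 in \<open>auto simp: card_insert_if\<close>)
  then show *: "k - 1 \<in> {1..n}" "k + 1 \<in> {1..n}" "k - 1 \<notin> corrupted" "k + 1 \<notin> corrupted" by blast+
  have "s (k - 1) \<in> F k" "s (k + 1) \<in> F k" unfolding F_def using * by blast+
  then show "s (k - 1) \<in> noise_neighbors n s w" "s (k + 1) \<in> noise_neighbors n s w"
    unfolding eq using k by blast+
qed

lemma spike_cell:
  assumes t: "t \<in> T"
  shows "\<exists>i. i \<in> {1..n} \<and> i + 1 \<in> {1..n} \<and> s i \<le> t \<and> t < s (i + 1) \<and> i \<notin> corrupted \<and> i + 1 \<notin> corrupted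
    \<and> s i \<in> spike_neighbors n s w T \<and> s (i + 1) \<in> spike_neighbors n s w T"
proof -
  define P where "P t i \<longleftrightarrow> i \<in> {1..n} \<and> i + 1 \<in> {1..n} \<and> s i \<le> t \<and> t < s (i + 1)" for t i
  define F where "F t = s ` ({i. P t i} \<union> Suc ` {i. P t i} - corrupted)" for t
  have eq: "spike_neighbors n s w T = (\<Union>t\<in>T. F t)"
  proof -
    have clean: "s i \<in> grid_points n s - noise_locations n s w \<longleftrightarrow> i \<notin> corrupted" if "i \<in> {1..n}" for i
      using that in_noise_iff[OF that] by (simp add: grid_points_def)
    show ?thesis
    proof (intro set_eqI iffI)
      fix r assume "r \<in> spike_neighbors n s w T"
      then obtain t i j where "t \<in> T" "P t i" and ij: "j = i \<or> j = i + 1" "r = s j"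
        "s j \<in> grid_points n s - noise_locations n s w"
        unfolding spike_neighbors_def P_def by blast
      then have "j \<notin> corrupted" using clean[of j] by (auto simp: P_def)
      with ij \<open>t \<in> T\<close> \<open>P t i\<close> show "r \<in> (\<Union>t\<in>T. F t)" unfolding F_def by (auto intro!: bexI[of _ t])
    next
      fix r assume "r \<in> (\<Union>t\<in>T. F t)"
      then obtain t i j where "t \<in> T" "P t i" "j = i \<or> j = i + 1" "j \<notin> corrupted" "r = s j"
        unfolding F_def by auto
      moreover from this have "s j \<in> grid_points n s - noise_locations n s w"
        using clean[of j] by (auto simp: P_def)
      ultimately show "r \<in> spike_neighbors n s w T" unfolding spike_neighbors_def P_def by blast
    qed
  qed
  \<comment> \<open>The half-open cells are disjoint, so a spike contributes at most the two ends of
    a single cell.\<close>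
  have uniq: "i = j" if "P t i" "P t j" for t i j
  proof (rule ccontr)
    assume "i \<noteq> j"
    then consider "i + 1 \<le> j" | "j + 1 \<le> i" by linarith
    then show False
    proof cases
      case 1
      then have "s (i + 1) \<le> s j" using that s_mono[of j "i + 1"] by (auto simp: P_def not_less)
      then show False using that by (simp add: P_def)
    next
      case 2
      then have "s (j + 1) \<le> s i" using that s_mono[of i "j + 1"] by (auto simp: P_def not_less)
      then show False using that by (simp add: P_def)
    qed
  qed
  have sub: "{i. P t i} \<union> Suc ` {i. P t i} \<subseteq> {i, i + 1}" if "P t i" for t i
    using uniq[OF _ that] by auto
  have cF: "finite (F t) \<and> card (F t) \<le> 2" for t
  proof (cases "\<exists>i. P t i")
    case True
    then obtain i where i: "P t i" by blast
    have fs: "F t \<subseteq> s ` {i, i + 1}" unfolding F_def using sub[OF i] by (intro image_mono) blast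
    then have "card (F t) \<le> card {i, i + 1}"
      by (rule order_trans[OF card_mono[rotated] card_image_le]) auto
    moreover have "finite (F t)" by (rule finite_subset[OF fs]) simp
    ultimately show ?thesis by simp
  qed (simp add: F_def)
  have c2: "card (F t) = 2" by (rule card_Union_pairs[OF T cF _ t]) (use cardI in \<open>simp add: eq\<close>)
  \<comment> \<open>If no cell contained \<open>t\<close>, the set \<open>F t\<close> would be
    empty: the counting hypothesis also places every spike inside the sampled range.\<close>
  then obtain i where i: "P t i" by (cases "\<exists>i. P t i") (auto simp: F_def)
  have Fi: "{i. P t i} \<union> Suc ` {i. P t i} - corrupted \<subseteq> {i, i + 1}" using sub[OF i] by blast
  have "card (F t) \<le> card ({i. P t i} \<union> Suc ` {i. P t i} - corrupted)"
    unfolding F_def by (rule card_image_le) (rule finite_subset[OF Fi], simp)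
  then have e: "{i. P t i} \<union> Suc ` {i. P t i} - corrupted = {i, i + 1}"
    by (intro card_seteq[OF _ Fi]) (use c2 in auto)
  then have "i \<notin> corrupted" "i + 1 \<notin> corrupted" by blast+
  moreover have "s i \<in> F t" "s (i + 1) \<in> F t" unfolding F_def e by auto
  then have "s i \<in> spike_neighbors n s w T" "s (i + 1) \<in> spike_neighbors n s w T"
    unfolding eq using t by blast+
  ultimately show ?thesis using i unfolding P_def by blast
qed

lemma dual_vector_exists:
  assumes \<epsilon>: "\<And>t. \<bar>\<epsilon> t\<bar> = 1" and \<delta>: "\<And>i :: nat. \<bar>\<delta> i\<bar> = 1"
  shows "\<exists>q. (\<forall>t\<in>T. (\<Sum>i\<in>{1..n}. q i * gaussian_kernel \<sigma> (s i - t)) = \<epsilon> t)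
    \<and> (\<forall>t. t \<notin> T \<longrightarrow> \<bar>\<Sum>i\<in>{1..n}. q i * gaussian_kernel \<sigma> (s i - t)\<bar> < 1)
    \<and> (\<forall>i\<in>{1..n}. if w i \<noteq> 0 then q i = 2 * \<delta> i else \<bar>q i\<bar> < 2)"
proof -
  obtain \<iota> where \<iota>: "\<And>t. t \<in> T \<Longrightarrow> \<iota> t \<in> {1..n} \<and> \<iota> t + 1 \<in> {1..n} \<and> s (\<iota> t) \<le> t \<and> t < s (\<iota> t + 1)
      \<and> \<iota> t \<notin> corrupted \<and> \<iota> t + 1 \<notin> corrupted
      \<and> s (\<iota> t) \<in> spike_neighbors n s w T \<and> s (\<iota> t + 1) \<in> spike_neighbors n s w T"
    using bchoice[of T] spike_cell by metis
  have \<iota>_step: "s (\<iota> t + 1) = s (\<iota> t) + \<tau>" if "t \<in> T" for t using \<iota>[OF that] by (intro step) auto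
  have inj: "inj_on s corrupted" by (rule inj_on_subset[OF inj_s]) (auto simp: corrupted_def)
  \<comment> \<open>The certificate expects signs at locations, while the dual vector has them at
    indices.\<close>
  define \<delta>' where "\<delta>' r = \<delta> (inv_into corrupted s r)" for r
  have \<delta>': "\<delta>' (s k) = \<delta> k" if "k \<in> corrupted" for k using that inj by (simp add: \<delta>'_def)
  let ?K = "gaussian_kernel \<sigma>"
  have "\<exists>c d. (\<forall>k\<in>T. \<bar>c k\<bar> < 2 \<and> \<bar>d k\<bar> < 2)
      \<and> (\<forall>t\<in>T. (\<Sum>k\<in>T. c k * ?K (s (\<iota> k) - t) + d k * ?K (s (\<iota> k) + \<tau> - t))
        + (\<Sum>k\<in>s ` corrupted. \<delta>' k * (2 * ?K (k - t) - ?K (k + \<tau> - t) - ?K (k - \<tau> - t))) = \<epsilon> t)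
      \<and> (\<forall>t. t \<notin> T \<longrightarrow> \<bar>(\<Sum>k\<in>T. c k * ?K (s (\<iota> k) - t) + d k * ?K (s (\<iota> k) + \<tau> - t))
        + (\<Sum>k\<in>s ` corrupted. \<delta>' k * (2 * ?K (k - t) - ?K (k + \<tau> - t) - ?K (k - \<tau> - t)))\<bar> < 1)"
  proof (rule scaled_certificate_exists[OF \<sigma> T sepT _ _ \<tau>])
    show "s (\<iota> k) \<le> k \<and> k \<le> s (\<iota> k) + \<tau>" if "k \<in> T" for k using \<iota>[OF that] \<iota>_step[OF that] by simp
    show "separated (15/4 * \<sigma>) (s ` corrupted)" using sepN by (simp add: noise_locations_eq)
  qed (use \<epsilon> \<delta> finite_corrupted in \<open>auto simp: \<delta>'_def\<close>)
  then obtain c d where cd: "\<And>k. k \<in> T \<Longrightarrow> \<bar>c k\<bar> < 2 \<and> \<bar>d k\<bar> < 2"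
    and QT: "\<And>t. t \<in> T \<Longrightarrow> (\<Sum>k\<in>T. c k * ?K (s (\<iota> k) - t) + d k * ?K (s (\<iota> k) + \<tau> - t))
        + (\<Sum>k\<in>s ` corrupted. \<delta>' k * (2 * ?K (k - t) - ?K (k + \<tau> - t) - ?K (k - \<tau> - t))) = \<epsilon> t"
    and Q1: "\<And>t. t \<notin> T \<Longrightarrow> \<bar>(\<Sum>k\<in>T. c k * ?K (s (\<iota> k) - t) + d k * ?K (s (\<iota> k) + \<tau> - t))
        + (\<Sum>k\<in>s ` corrupted. \<delta>' k * (2 * ?K (k - t) - ?K (k + \<tau> - t) - ?K (k - \<tau> - t)))\<bar> < 1"
    by (elim exE conjE) blast
  \<comment> \<open>\<open>f\<close> and \<open>g\<close> are the contributions of one spike and of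
    one corruption to the entry at index \<open>i\<close>. Plain sums make the exchange of summation
    below immediate; that contributions do not pile up is shown afterwards in
    \<open>q_bound\<close>.\<close>
  define f where "f i t = (if i = \<iota> t then c t else 0) + (if i = \<iota> t + 1 then d t else 0)" for i t
  define g where "g i k = (if i = k then 2 * \<delta> k else 0) + (if i = k + 1 then - \<delta> k else 0)
      + (if i = k - 1 then - \<delta> k else 0)" for i k
  define q where "q i = (\<Sum>t\<in>T. f i t) + (\<Sum>k\<in>corrupted. g i k)" for i
  have k_in: "k \<in> {1..n}" "k - 1 \<in> {1..n}" "k + 1 \<in> {1..n}" if "k \<in> corrupted" for k
    using corrupted_neighbors[OF that] that by (auto simp: corrupted_def)
  have k_step: "s (k + 1) = s k + \<tau>" "s (k - 1) = s k - \<tau>" if "k \<in> corrupted" for k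
  proof -
    show "s (k + 1) = s k + \<tau>" using k_in[OF that] by (intro step)
    have "s (k - 1 + 1) = s (k - 1) + \<tau>" using k_in[OF that] by (intro step) auto
    moreover have "k - 1 + 1 = k" using k_in[OF that] by auto
    ultimately show "s (k - 1) = s k - \<tau>" by simp
  qed
  have Q: "(\<Sum>i\<in>{1..n}. q i * h i) = (\<Sum>t\<in>T. c t * h (\<iota> t) + d t * h (\<iota> t + 1))
      + (\<Sum>k\<in>corrupted. \<delta> k * (2 * h k - h (k + 1) - h (k - 1)))" for h :: "nat \<Rightarrow> real"
  proof -
    have "(\<Sum>i\<in>{1..n}. q i * h i) = (\<Sum>t\<in>T. \<Sum>i\<in>{1..n}. f i t * h i) + (\<Sum>k\<in>corrupted. \<Sum>i\<in>{1..n}. g i k * h i)"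
      unfolding q_def distrib_right sum_distrib_right sum.distrib
      by (simp only: sum.swap[of _ T] sum.swap[of _ corrupted])
    also have "(\<Sum>t\<in>T. \<Sum>i\<in>{1..n}. f i t * h i) = (\<Sum>t\<in>T. c t * h (\<iota> t) + d t * h (\<iota> t + 1))"
      by (rule sum.cong) (use \<iota> in \<open>auto simp only: f_def distrib_right sum.distrib sum_indicator_index\<close>)
    also have "(\<Sum>k\<in>corrupted. \<Sum>i\<in>{1..n}. g i k * h i)
        = (\<Sum>k\<in>corrupted. \<delta> k * (2 * h k - h (k + 1) - h (k - 1)))"
    proof (rule sum.cong)
      fix k assume "k \<in> corrupted"
      note k_in[OF this]
      then show "(\<Sum>i\<in>{1..n}. g i k * h i) = \<delta> k * (2 * h k - h (k + 1) - h (k - 1))"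
        unfolding g_def distrib_right sum.distrib by (simp only: sum_indicator_index) (simp add: algebra_simps)
    qed simp
    finally show ?thesis .
  qed
  have Q': "(\<Sum>i\<in>{1..n}. q i * ?K (s i - t)) = (\<Sum>k\<in>T. c k * ?K (s (\<iota> k) - t) + d k * ?K (s (\<iota> k) + \<tau> - t))
        + (\<Sum>k\<in>s ` corrupted. \<delta>' k * (2 * ?K (k - t) - ?K (k + \<tau> - t) - ?K (k - \<tau> - t)))" for t
    unfolding Q[of "\<lambda>i. ?K (s i - t)"] sum.reindex[OF inj] o_def
    by (intro arg_cong2[of _ _ _ _ "(+)"] sum.cong) (simp_all only: \<iota>_step k_step \<delta>')
  \<comment> \<open>At most one contribution reaches an index: \<open>disj\<close> keeps spikes and
    corruptions apart, and within each family the separation exceeds two steps. So the bound 2 on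
    single contributions carries over to \<open>q\<close>.\<close>
  have q_bound: "if w i \<noteq> 0 then q i = 2 * \<delta> i else \<bar>q i\<bar> < 2" if i: "i \<in> {1..n}" for i
  proof (cases "\<exists>t\<in>T. i = \<iota> t \<or> i = \<iota> t + 1")
    case True
    then obtain t where t: "t \<in> T" "i = \<iota> t \<or> i = \<iota> t + 1" by blast
    have w0: "w i = 0" using \<iota>[OF t(1)] t(2) by (auto simp: corrupted_def)
    have g0: "g i k = 0" if k: "k \<in> corrupted" for k
    proof -
      have "s i \<in> spike_neighbors n s w T" using \<iota>[OF t(1)] t(2) by auto
      then have "s i \<noteq> s (k - 1)" "s i \<noteq> s (k + 1)" using corrupted_neighbors(5,6)[OF k] disj by auto
      moreover have "i \<noteq> k" using k w0 by (auto simp: corrupted_def)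
      ultimately show ?thesis by (auto simp: g_def)
    qed
    have "f i t' = 0" if t': "t' \<in> T" "t' \<noteq> t" for t'
    proof (rule ccontr)
      assume "f i t' \<noteq> 0"
      then have "i = \<iota> t' \<or> i = \<iota> t' + 1" by (auto simp: f_def split: if_splits)
      then have "\<bar>t' - s i\<bar> \<le> \<tau>" using \<iota>[OF t'(1)] \<iota>_step[OF t'(1)] by auto
      moreover have "\<bar>t - s i\<bar> \<le> \<tau>" using \<iota>[OF t(1)] \<iota>_step[OF t(1)] t(2) by auto
      moreover have "15/4 * \<sigma> \<le> \<bar>t' - t\<bar>" by (rule separatedD[OF sepT]) (use t t' in auto)
      ultimately show False using \<tau>_small by linarith
    qed
    then have "q i = f i t" unfolding q_def using g0 sum_single[OF T t(1), of "f i"] by simp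
    then show ?thesis using w0 cd[OF t(1)] t(2) by (auto simp: f_def)
  next
    case False
    then have "f i t = 0" if "t \<in> T" for t using that by (auto simp: f_def)
    then have qi: "q i = (\<Sum>k\<in>corrupted. g i k)" by (simp add: q_def)
    show ?thesis
    proof (cases "\<exists>k\<in>corrupted. i = k \<or> i = k + 1 \<or> i = k - 1")
      case True
      then obtain k where k: "k \<in> corrupted" "i = k \<or> i = k + 1 \<or> i = k - 1" by blast
      have "g i k' = 0" if k': "k' \<in> corrupted" "k' \<noteq> k" for k'
      proof (rule ccontr)
        assume "g i k' \<noteq> 0"
        then have "i = k' \<or> i = k' + 1 \<or> i = k' - 1" by (auto simp: g_def split: if_splits)
        then have "\<bar>s k' - s i\<bar> \<le> \<tau>" using k_step[OF k'(1)] \<tau>0 by auto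
        moreover have "\<bar>s k - s i\<bar> \<le> \<tau>" using k_step[OF k(1)] k(2) \<tau>0 by auto
        moreover have "s k' \<noteq> s k" using k k' inj by (auto simp: inj_on_def)
        then have "15/4 * \<sigma> \<le> \<bar>s k' - s k\<bar>"
          using k k' by (intro separatedD[OF sepN]) (auto simp: noise_locations_eq)
        ultimately show False using \<tau>_small by linarith
      qed
      then have "q i = g i k" unfolding qi by (rule sum_single[OF finite_corrupted k(1)])
      \<comment> \<open>Subtraction of natural numbers: at \<open>k = 0\<close> the two indices
        would coincide and the contributions would add up.\<close>
      moreover have "k \<noteq> k - 1" using k_in(2)[OF k(1)] by auto
      moreover have "w i \<noteq> 0 \<longleftrightarrow> i = k"
        using k corrupted_neighbors(3,4)[OF k(1)] i by (auto simp: corrupted_def)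
      ultimately show ?thesis using k(2) \<delta>[of k] by (auto simp: g_def)
    next
      case False
      then have "g i k = 0" if "k \<in> corrupted" for k using that by (auto simp: g_def)
      then have "q i = 0" by (simp add: qi)
      moreover have "w i = 0" using False i by (auto simp: corrupted_def)
      ultimately show ?thesis by simp
    qed
  qed
  show ?thesis
  proof (rule exI[of _ q], intro conjI ballI allI impI)
    show "(\<Sum>i\<in>{1..n}. q i * ?K (s i - t)) = \<epsilon> t" if "t \<in> T" for t unfolding Q' by (rule QT[OF that])
    show "\<bar>\<Sum>i\<in>{1..n}. q i * ?K (s i - t)\<bar> < 1" if "t \<notin> T" for t unfolding Q' by (rule Q1[OF that])
  qed (rule q_bound)
qed

end

theorem theorem2p9:
  fixes \<sigma> \<tau> lo hi :: real
    and T :: "real set" and a :: "real \<Rightarrow> real"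
    and n :: nat and s w y :: "nat \<Rightarrow> real"
  defines "K \<equiv> gaussian_kernel \<sigma>"
    and "\<mu> \<equiv> dirac_comb T a"
    and "N \<equiv> noise_locations n s w"
    and "I \<equiv> spike_neighbors n s w T"
    and "C \<equiv> noise_neighbors n s w"
  assumes "\<sigma> > 0"
    and "finite T"
    and "lo \<le> hi" and "T \<subseteq> {lo..hi}"
    and "\<tau> \<in> {0.065 * \<sigma>..0.2375 * \<sigma>}"
    and "\<forall>i\<in>{1..n}. i + 1 \<in> {1..n} \<longrightarrow> s (i + 1) = s i + \<tau>"
    and "w \<in> {1..n} \<rightarrow>\<^sub>E UNIV"
    and "\<forall>i\<in>{1..n}. y i = conv_measure K \<mu> (s i) + w i"
    and "card I = 2 * card T"
    and "card C = 2 * card N"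
    and "C \<inter> I = {}"
    and "min_separation T \<ge> ereal (3.751 * \<sigma>)"
    and "min_separation N \<ge> ereal (3.751 * \<sigma>)"
  shows "\<forall>x. is_arg_min (objective 2 n) (feasible K n s y {lo..hi}) x \<longleftrightarrow> x = (\<mu>, w)"
proof -
  have sep: "separated (15/4 * \<sigma>) A" if "min_separation A \<ge> ereal (3.751 * \<sigma>)" for A
  proof -
    \<comment> \<open>The separation is rounded to the value for which the estimates are
      calibrated.\<close>
    have "15/4 * \<sigma> \<le> 3.751 * \<sigma>" using \<open>\<sigma> > 0\<close> by simp
    then show ?thesis using min_separation_ge[OF that] by (force simp: separated_def)
  qed
  interpret sampling_grid n s w T \<sigma> \<tau>
  proof
    show "0 < \<sigma>" "finite T" by fact+
    show "13/200 * \<sigma> \<le> \<tau>" "\<tau> \<le> 19/80 * \<sigma>" using \<open>\<tau> \<in> _\<close> by simp_all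
    show "s (i + 1) = s i + \<tau>" if "i \<in> {1..n}" "i + 1 \<in> {1..n}" for i using assms(11) that by blast
    show "card (spike_neighbors n s w T) = 2 * card T" using \<open>card I = _\<close> by (simp only: I_def)
    show "card (noise_neighbors n s w) = 2 * card (noise_locations n s w)"
      using \<open>card C = _\<close> by (simp only: C_def N_def)
    show "noise_neighbors n s w \<inter> spike_neighbors n s w T = {}"
      using \<open>C \<inter> I = {}\<close> by (simp only: C_def I_def)
    show "separated (15/4 * \<sigma>) T" by (rule sep) fact
    show "separated (15/4 * \<sigma>) (noise_locations n s w)"
      using \<open>min_separation N \<ge> _\<close> unfolding N_def by (rule sep)
  qed
  have cont: "continuous_on UNIV K"
    unfolding K_def gaussian_kernel_def by (intro continuous_intros) (use \<open>\<sigma> > 0\<close> in auto)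
  have bounded: "\<bar>K u\<bar> \<le> 1" for u by (simp add: K_def gaussian_kernel_def)
  have y: "y i = conv_measure K (dirac_comb T a) (s i) + w i" if "i \<in> {1..n}" for i
    using assms(13) that unfolding \<mu>_def by blast
  show ?thesis
    unfolding \<mu>_def
    by (rule allI, rule unique_minimizer_if_dual_vectors[OF \<open>finite T\<close> \<open>T \<subseteq> _\<close> cont bounded \<open>w \<in> _\<close> _ y])
      (simp, assumption, unfold K_def, rule dual_vector_exists)
qed

end
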